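(* Let $K$ be a field of characteristic $0$ and let $x,y$ be generic $4\times4$ matrices. The traces of the following $32$ matrices form a minimal set of generators of the $K$-algebra $C_{4,2}$: $$\begin{aligned} &x,\ y,\\ &x^2,\ xy,\ y^2,\\ &x^3,\ x^2y,\ xy^2,\ y^3,\\ &x^4,\ x^3y,\ x^2y^2,\ xy^3,\ y^4,\ xyxy,\\ &x^3y^2,\ y^3x^2,\\ &(x^2y)^2,\ (y^2x)^2,\ x^2y^2xy,\ y^2x^2yx,\\ &x^3y^2xy,\ y^3x^2yx,\\ &x^3y^2x^2y,\ y^3x^2y^2x,\ x^3y^3xy,\ y^3x^3yx,\\ &x^3yx^2yxy,\ x^2y^2xyx^2y,\ y^2x^2yxy^2x,\ y^3xy^2xyx,\\ &x^3y^3x^2y^2. \end{aligned}$$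
   Context: $M_4=M_4(K)$ is the algebra of $4\times4$ matrices over $K$; $\mathrm{GL}_4(K)$ acts on $M_4^2=M_4\times M_4$ by simultaneous conjugation $a\cdot(x,y)=(axa^{-1},aya^{-1})$, and $C_{4,2}=K[M_4^2]^{\mathrm{GL}_4}$ is the algebra of invariant polynomial functions on $M_4^2$. The generic matrices $x$ and $y$ are the matrices whose entries are the coordinate functions on the first and second factor of $M_4^2$; thus for a word $w(x,y)$, $\mathrm{tr}(w(x,y))$ is a polynomial function on $M_4^2$ belonging to $C_{4,2}$. *)

theory Defs
  imports "HOL-Analysis.Determinants" "HOL-Library.Function_Algebras" "HOL-Library.Numeral_Type"
begin

type_synonym 'k mat4 = "'k ^ 4 ^ 4"

text \<open>
  Functions \<^typ>\<open>'p \<Rightarrow> 'k\<close> carry the pointwise ring structure of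
  \<^theory>\<open>HOL-Library.Function_Algebras\<close>; the scalars are the constant functions, so the
  following is the unital \<open>'k\<close>-subalgebra generated by \<open>S\<close>.
\<close>

inductive_set generated_algebra :: "('p \<Rightarrow> 'k::comm_ring_1) set \<Rightarrow> ('p \<Rightarrow> 'k) set"
  for S :: "('p \<Rightarrow> 'k) set" where
  base: "f \<in> S \<Longrightarrow> f \<in> generated_algebra S"
| const: "(\<lambda>_. c) \<in> generated_algebra S"
| add: "f \<in> generated_algebra S \<Longrightarrow> g \<in> generated_algebra S \<Longrightarrow> f + g \<in> generated_algebra S"
| mult: "f \<in> generated_algebra S \<Longrightarrow> g \<in> generated_algebra S \<Longrightarrow> f * g \<in> generated_algebra S"

definition minimal_generating_set :: "('p \<Rightarrow> 'k::comm_ring_1) set \<Rightarrow> ('p \<Rightarrow> 'k) set \<Rightarrow> bool" where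
  "minimal_generating_set S A \<longleftrightarrow>
     generated_algebra S = A \<and> (\<forall>T. T \<subset> S \<longrightarrow> generated_algebra T \<noteq> A)"

text \<open>
  The generic matrices have entries in the ring of functions on pairs of matrices: their
  entries are the coordinate functions of the first and of the second matrix.
\<close>

definition generic_x :: "('k mat4 \<times> 'k mat4 \<Rightarrow> 'k) ^ 4 ^ 4" where
  "generic_x = (\<chi> i j. (\<lambda>p. fst p $ i $ j))"

definition generic_y :: "('k mat4 \<times> 'k mat4 \<Rightarrow> 'k) ^ 4 ^ 4" where
  "generic_y = (\<chi> i j. (\<lambda>p. snd p $ i $ j))"

definition polynomial_functions :: "('k::field_char_0 mat4 \<times> 'k mat4 \<Rightarrow> 'k) set" where
  "polynomial_functions =
     generated_algebra ({generic_x $ i $ j |i j. True} \<union> {generic_y $ i $ j |i j. True})"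

definition C42 :: "('k::field_char_0 mat4 \<times> 'k mat4 \<Rightarrow> 'k) set" where
  "C42 = {f \<in> polynomial_functions.
     \<forall>a x y. invertible a \<longrightarrow>
       f (a ** x ** matrix_inv a, a ** y ** matrix_inv a) = f (x, y)}"

end

theory Submission
  imports Defs "HOL-Combinatorics.Cycles" "HOL-Computational_Algebra.Polynomial"
begin

text \<open>
  A multilinear invariant of \<open>m\<close> matrices is a tensor commuting with the diagonal action of
  \<open>GL\<close>, hence (polarization and the double centralizer of the symmetric group) a combination of the
  contractions \<open>contr\<close> along permutations, which are products of traces of words. So \<open>C42\<close>
  is generated by the traces of words in two letters.

  Antisymmetrizing five indices that take only four values gives zero. The 5-cycles in this sum express
  \<open>\<Sum>\<^sub>\<sigma> tr (z z\<^sub>\<sigma>\<^sub>1 z\<^sub>\<sigma>\<^sub>2 z\<^sub>\<sigma>\<^sub>3 z\<^sub>\<sigma>\<^sub>4)\<close> through traces of shorter words. Modulo the latter a word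
  under the trace may therefore be rewritten as in an algebra where all fourth powers vanish, and there
  explicit rewriting rules kill all words of length 10 and reduce the cyclic words of length at most 10
  to the 32 given ones.

  For minimality, every relation between the contractions of \<open>4 \<times> 4\<close> matrices follows from these
  antisymmetrizations. Hence a function on cyclic words that vanishes on
  \<open>\<Sum>\<^sub>\<sigma> z z\<^sub>\<sigma>\<^sub>1 z\<^sub>\<sigma>\<^sub>2 z\<^sub>\<sigma>\<^sub>3 z\<^sub>\<sigma>\<^sub>4\<close> induces a linear functional on invariants that is zero on products; for each
  of the 32 words such a function is given that is nonzero there and zero on the others.
\<close>

section \<open>Contractions along permutations\<close>

text \<open>The trace identity yields the linearized form of z^4 = 0 only under a trace and only
  next to a further nonempty factor. This is the origin of the number 10, the nilpotency index in
  characteristic 0 of associative algebras in which all fourth powers vanish: an indecomposable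
  trace of length n needs a word of length n - 1 that survives in the nil algebra, the last letter
  being the further factor, and n = 10 does occur among the generators. Leading coefficients of the
  rewriting rules, such as 3072, are integers that become invertible in characteristic 0. Rewriting
  alone cannot show that a trace is indecomposable, since unknown relations might exist; minimality
  rests on the second fundamental theorem. Its proof works with permutations directly: those without
  a decreasing subsequence of length five span the group algebra modulo antisymmetrizers, by
  lexicographic straightening, and they act independently on the tensor power of a 4-dimensional
  space.\<close>

definition matprod :: "('k::comm_ring_1 ^ 'n ^ 'n) list \<Rightarrow> 'k ^ 'n ^ 'n" where
  "matprod Ms = foldr (**) Ms (mat 1)"

lemma matprod_simps [simp]:
  "matprod [] = mat 1" "matprod (M # Ms) = M ** matprod Ms"
  by (simp_all add: matprod_def)

lemma matprod_append: "matprod (Ms @ Ns) = matprod Ms ** matprod Ns"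
  by (induction Ms) (simp_all add: matrix_mul_assoc)

lemma trace_matprod_append: "trace (matprod (Ms @ Ns)) = trace (matprod (Ns @ Ms))"
  by (simp only: matprod_append) (rule trace_mul_sym)

text \<open>The trace of the tensor product of the matrices \<open>Z l\<close> times the permutation
  operator of \<open>s\<close>. The index set \<open>L\<close> is arbitrary so that the cycles of
  \<open>s\<close> can be split off one at a time.\<close>

definition contr :: "'a set \<Rightarrow> ('a \<Rightarrow> 'k::comm_ring_1 ^ 'n ^ 'n) \<Rightarrow> ('a \<Rightarrow> 'a) \<Rightarrow> 'k" where
  "contr L Z s = (\<Sum>i \<in> L \<rightarrow>\<^sub>E (UNIV :: 'n set). \<Prod>l\<in>L. Z l $ i l $ i (s l))"

lemma sum_PiE_insert:
  fixes f :: "('a \<Rightarrow> 'n) \<Rightarrow> 'k::comm_monoid_add"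
  assumes "x \<notin> A"
  shows "(\<Sum>i \<in> insert x A \<rightarrow>\<^sub>E U. f i) = (\<Sum>t\<in>U. \<Sum>i \<in> A \<rightarrow>\<^sub>E U. f (i(x := t)))"
proof -
  have "inj_on (\<lambda>(y, g). g(x := y)) (U \<times> (A \<rightarrow>\<^sub>E U))"
    using assms inj_combinator[of x A "\<lambda>_. U"] by simp
  then have "(\<Sum>i \<in> insert x A \<rightarrow>\<^sub>E U. f i) = (\<Sum>p\<in>U \<times> (A \<rightarrow>\<^sub>E U). f (case p of (y, g) \<Rightarrow> g(x := y)))"
    unfolding PiE_insert_eq by (subst sum.reindex) auto
  then show ?thesis
    unfolding sum.cartesian_product by (simp only: case_prod_unfold)
qed

lemma contr_cong:
  assumes "\<And>l. l \<in> L \<Longrightarrow> Z l = Z' l" "\<And>l. l \<in> L \<Longrightarrow> s l = s' l"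
  shows "contr L Z s = contr L Z' s'"
  unfolding contr_def using assms by (intro sum.cong prod.cong) auto

text \<open>The row index \<open>r\<close> of the head is kept apart from \<open>i\<close>, so that
  an entry of the product, a path with open ends, can be expanded; \<open>r = s = i c\<close> then
  closes the path to a cycle.\<close>

fun path_weight :: "('a \<Rightarrow> 'k::comm_ring_1 ^ 'n ^ 'n) \<Rightarrow> ('a \<Rightarrow> 'n) \<Rightarrow> 'n \<Rightarrow> 'a list \<Rightarrow> 'n \<Rightarrow> 'k" where
  "path_weight Z i r [] s = (if r = s then 1 else 0)"
| "path_weight Z i r [c] s = Z c $ r $ s"
| "path_weight Z i r (c # d # cs) s = Z c $ r $ i d * path_weight Z i (i d) (d # cs) s"

lemma path_weight_cong:
  "(\<And>l. l \<in> set cs \<Longrightarrow> i l = j l) \<Longrightarrow> path_weight Z i r (c # cs) s = path_weight Z j r (c # cs) s"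
  by (induction cs arbitrary: c r) auto

lemma matprod_path_sum:
  fixes Z :: "'a \<Rightarrow> 'k::comm_ring_1 ^ 'n ^ 'n"
  assumes "distinct cs"
  shows "matprod (map Z (c # cs)) $ r $ s = (\<Sum>i \<in> set cs \<rightarrow>\<^sub>E UNIV. path_weight Z i r (c # cs) s)"
  using assms
proof (induction cs arbitrary: c r)
  case Nil
  then show ?case by simp
next
  case (Cons d cs)
  have "matprod (map Z (c # d # cs)) $ r $ s
      = (\<Sum>t\<in>UNIV. Z c $ r $ t * (\<Sum>i \<in> set cs \<rightarrow>\<^sub>E UNIV. path_weight Z i t (d # cs) s))"
    using Cons by (simp add: matrix_matrix_mult_def)
  also have "\<dots> = (\<Sum>t\<in>UNIV. \<Sum>i \<in> set cs \<rightarrow>\<^sub>E UNIV. path_weight Z (i(d := t)) r (c # d # cs) s)"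
    using Cons.prems
    by (auto simp: sum_distrib_left intro!: sum.cong arg_cong2[where f = "(*)"] path_weight_cong)
  also have "\<dots> = (\<Sum>i \<in> set (d # cs) \<rightarrow>\<^sub>E UNIV. path_weight Z i r (c # d # cs) s)"
    using Cons.prems by (simp add: sum_PiE_insert)
  finally show ?case .
qed

lemma path_weight_eq_prod:
  "path_weight Z i (i c) (c # cs) (i e)
   = (\<Prod>k<length (c # cs). Z ((c # cs) ! k) $ i ((c # cs) ! k) $ i ((cs @ [e]) ! k))"
proof (induction cs arbitrary: c)
  case Nil
  then show ?case by simp
next
  case (Cons d cs)
  let ?f = "\<lambda>k. Z ((c # d # cs) ! k) $ i ((c # d # cs) ! k) $ i (((d # cs) @ [e]) ! k)"
  have "(\<Prod>k<Suc (length (d # cs)). ?f k) = ?f 0 * (\<Prod>k<length (d # cs). ?f (Suc k))"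
    by (rule prod.lessThan_Suc_shift)
  also have "(\<Prod>k<length (d # cs). ?f (Suc k)) = path_weight Z i (i d) (d # cs) (i e)"
    unfolding Cons.IH by simp
  finally show ?case
    by simp
qed

lemma cycle_of_list_nth:
  assumes "distinct (c # cs)" "k < length (c # cs)"
  shows "cycle_of_list (c # cs) ((c # cs) ! k) = (cs @ [c]) ! k"
proof -
  have "map (cycle_of_list (c # cs)) (c # cs) = cs @ [c]"
    using cyclic_rotation[OF assms(1), of 1] by simp
  then show ?thesis
    using assms(2) by (metis nth_map)
qed

text \<open>Along a cycle the column index of each factor is the row index of the next one, and the
  last column index is the first row index, so the index sum is the expansion of the trace of a
  product.\<close>

lemma contr_cycle:
  fixes Z :: "'a \<Rightarrow> 'k::comm_ring_1 ^ 'n ^ 'n"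
  assumes "distinct cs" "cs \<noteq> []"
  shows "contr (set cs) Z (cycle_of_list cs) = trace (matprod (map Z cs))"
proof -
  obtain c cs' where cs: "cs = c # cs'"
    using assms(2) by (cases cs) auto
  have *: "path_weight Z i (i c) (c # cs') (i c) = (\<Prod>l\<in>set cs. Z l $ i l $ i (cycle_of_list cs l))" for i
  proof -
    have "bij_betw (\<lambda>k. cs ! k) {..<length cs} (set cs)"
      using assms(1) bij_betw_nth by blast
    then have "(\<Prod>l\<in>set cs. Z l $ i l $ i (cycle_of_list cs l))
        = (\<Prod>k<length cs. Z (cs ! k) $ i (cs ! k) $ i (cycle_of_list cs (cs ! k)))"
      by (simp add: prod.reindex_bij_betw[symmetric])
    also have "\<dots> = (\<Prod>k<length cs. Z (cs ! k) $ i (cs ! k) $ i ((cs' @ [c]) ! k))"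
      using assms(1) unfolding cs by (intro prod.cong refl) (simp only: cycle_of_list_nth lessThan_iff)
    finally show ?thesis
      unfolding path_weight_eq_prod cs by simp
  qed
  have "contr (set cs) Z (cycle_of_list cs)
      = (\<Sum>i \<in> insert c (set cs') \<rightarrow>\<^sub>E UNIV. path_weight Z i (i c) (c # cs') (i c))"
    unfolding contr_def * by (simp add: cs)
  also have "\<dots> = (\<Sum>t\<in>UNIV. \<Sum>i \<in> set cs' \<rightarrow>\<^sub>E UNIV. path_weight Z i t (c # cs') t)"
    using assms(1) unfolding cs
    by (auto simp: sum_PiE_insert intro!: sum.cong path_weight_cong)
  also have "\<dots> = (\<Sum>t\<in>UNIV. matprod (map Z (c # cs')) $ t $ t)"
    using assms(1) unfolding cs by (subst matprod_path_sum) auto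
  finally show ?thesis
    by (simp add: trace_def cs)
qed

text \<open>An index map on the disjoint union is a pair of index maps, and \<open>s\<close> does
  not mix the two parts, so the index sum factors.\<close>

lemma contr_union:
  fixes Z :: "'a \<Rightarrow> 'k::comm_ring_1 ^ 'n ^ 'n"
  assumes "finite A" "finite B" "A \<inter> B = {}"
    and "\<And>l. l \<in> A \<Longrightarrow> s l \<in> A" "\<And>l. l \<in> B \<Longrightarrow> s l \<in> B"
  shows "contr (A \<union> B) Z s = contr A Z s * contr B Z s"
proof -
  let ?F = "\<lambda>L i. \<Prod>l\<in>L. Z l $ i l $ i (s l)"
  have "contr A Z s * contr B Z s = (\<Sum>(i, j) \<in> (A \<rightarrow>\<^sub>E UNIV) \<times> (B \<rightarrow>\<^sub>E UNIV). ?F A i * ?F B j)"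
    by (simp add: contr_def sum_product sum.cartesian_product)
  also have "\<dots> = (\<Sum>i \<in> A \<union> B \<rightarrow>\<^sub>E UNIV. ?F A i * ?F B i)"
  proof (rule sum.reindex_bij_witness
      [where i = "\<lambda>i. (restrict i A, restrict i B)"
         and j = "\<lambda>p. case p of (i, j) \<Rightarrow> \<lambda>l. if l \<in> A then i l else j l"])
    fix p :: "('a \<Rightarrow> 'n) \<times> ('a \<Rightarrow> 'n)"
    assume p: "p \<in> (A \<rightarrow>\<^sub>E UNIV) \<times> (B \<rightarrow>\<^sub>E (UNIV :: 'n set))"
    obtain i j where ij: "p = (i, j)" by force
    have 1: "i l = undefined" if "l \<notin> A" for l using p that by (auto simp: ij PiE_def extensional_def)
    have 2: "j l = undefined" if "l \<notin> B" for l using p that by (auto simp: ij PiE_def extensional_def)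
    show "(restrict (case p of (i, j) \<Rightarrow> \<lambda>l. if l \<in> A then i l else j l) A,
        restrict (case p of (i, j) \<Rightarrow> \<lambda>l. if l \<in> A then i l else j l) B) = p"
      using 1 2 assms(3) by (auto simp: ij restrict_def fun_eq_iff)
    show "(case p of (i, j) \<Rightarrow> \<lambda>l. if l \<in> A then i l else j l) \<in> A \<union> B \<rightarrow>\<^sub>E UNIV"
      using 2 by (auto simp: ij PiE_def extensional_def)
    have "?F A (\<lambda>l. if l \<in> A then i l else j l) = ?F A i"
      using assms(4) by (intro prod.cong) auto
    moreover have "?F B (\<lambda>l. if l \<in> A then i l else j l) = ?F B j"
    proof (intro prod.cong refl)
      fix l assume "l \<in> B"
      then have "l \<notin> A" "s l \<notin> A" using assms(3,5) by auto
      then show "Z l $ (if l \<in> A then i l else j l) $ (if s l \<in> A then i (s l) else j (s l)) = Z l $ j l $ j (s l)"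
        by simp
    qed
    ultimately show "?F A (case p of (i, j) \<Rightarrow> \<lambda>l. if l \<in> A then i l else j l)
        * ?F B (case p of (i, j) \<Rightarrow> \<lambda>l. if l \<in> A then i l else j l) = (case p of (i, j) \<Rightarrow> ?F A i * ?F B j)"
      by (simp add: ij)
  next
    fix i assume "i \<in> A \<union> B \<rightarrow>\<^sub>E (UNIV :: 'n set)"
    then have 1: "i l = undefined" if "l \<notin> A" "l \<notin> B" for l using that by (auto simp: PiE_def extensional_def)
    show "(case (restrict i A, restrict i B) of (i, j) \<Rightarrow> \<lambda>l. if l \<in> A then i l else j l) = i"
      using 1 by (auto simp: fun_eq_iff restrict_def)
    show "(restrict i A, restrict i B) \<in> (A \<rightarrow>\<^sub>E UNIV) \<times> (B \<rightarrow>\<^sub>E UNIV)"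
      by auto
  qed
  also have "\<dots> = contr (A \<union> B) Z s"
    unfolding contr_def using assms(1-3) by (intro sum.cong refl) (simp add: prod.union_disjoint)
  finally show ?thesis ..
qed

text \<open>Since the cycles exhaust \<open>L\<close>, fixed points occur as one-element lists; each
  contributes the factor \<open>trace (Z l)\<close> to the contraction.\<close>

definition cycles_of :: "'a list list \<Rightarrow> 'a set \<Rightarrow> ('a \<Rightarrow> 'a) \<Rightarrow> bool" where
  "cycles_of css L s \<longleftrightarrow> distinct (concat css) \<and> set (concat css) = L \<and> [] \<notin> set css \<and>
     (\<forall>cs\<in>set css. \<forall>l\<in>set cs. s l = cycle_of_list cs l)"

lemma cycles_of_exists:
  assumes "s permutes L" "finite L"
  obtains css where "cycles_of css L s"
proof -
  have "\<exists>css. cycles_of css L s"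
    using cycle_decomposition[OF assms]
  proof (induction rule: cycle_decomp.induct)
    case empty
    then show ?case by (intro exI[of _ "[]"]) (simp add: cycles_of_def)
  next
    case (comp I p cs)
    then obtain css where css: "cycles_of css I p" by blast
    show ?case
    proof (cases "cs = []")
      case True
      then show ?thesis using css by auto
    next
      case False
      have fix_I: "p l = l" if "l \<in> set cs" for l
      proof -
        have "p permutes I"
          using comp(1)
        proof (induction rule: cycle_decomp.induct)
          case empty then show ?case by (rule permutes_id)
        next
          case (comp I p cs)
          then show ?case
            by (intro permutes_compose permutes_subset[OF cycle_permutes] permutes_subset[OF comp(4)]) auto
        qed
        then show ?thesis using that comp(3) by (auto simp: permutes_def)
      qed
      have "cycle_of_list cs (p l) = cycle_of_list ds l" if "ds \<in> set css" "l \<in> set ds" for ds l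
      proof -
        have "p l = cycle_of_list ds l" using css that by (auto simp: cycles_of_def)
        moreover have "cycle_of_list ds l \<in> set ds"
          using that permutes_in_image[OF cycle_permutes] by metis
        moreover have "set ds \<subseteq> I" using css that by (auto simp: cycles_of_def)
        ultimately show ?thesis using comp(3) by (metis IntI empty_iff id_outside_supp subsetD)
      qed
      then have "cycles_of (cs # css) (set cs \<union> I) (cycle_of_list cs \<circ> p)"
        using css comp(2,3) False fix_I
        by (auto simp: cycles_of_def)
      then show ?thesis by blast
    qed
  qed
  then show ?thesis using that by blast
qed

lemma contr_cycles_of:
  assumes "cycles_of css L s"
  shows "contr L Z s = (\<Prod>cs\<leftarrow>css. trace (matprod (map Z cs)))"
  using assms
proof (induction css arbitrary: L)
  case Nil
  then show ?case by (simp add: cycles_of_def contr_def)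
next
  case (Cons cs css)
  have L: "L = set cs \<union> set (concat css)" and 1: "cycles_of css (set (concat css)) s"
    using Cons.prems by (auto simp: cycles_of_def)
  have s: "s l = cycle_of_list ds l" if "l \<in> set ds" "ds \<in> set (cs # css)" for l ds
    using Cons.prems that by (auto simp: cycles_of_def)
  then have "s l \<in> set ds" if "l \<in> set ds" "ds \<in> set (cs # css)" for l ds
    using that permutes_in_image[OF cycle_permutes] by metis
  then have "contr L Z s = contr (set cs) Z s * contr (set (concat css)) Z s"
    unfolding L using Cons.prems by (intro contr_union) (fastforce simp: cycles_of_def)+
  also have "contr (set cs) Z s = contr (set cs) Z (cycle_of_list cs)"
    by (intro contr_cong s) auto
  also have "\<dots> = trace (matprod (map Z cs))"
    using Cons.prems by (intro contr_cycle) (auto simp: cycles_of_def)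
  finally show ?case
    using Cons.IH[OF 1] by simp
qed

section \<open>Trace identities\<close>

text \<open>Composition with the transposition is a bijection of the permutations that reverses the
  sign and keeps the value of \<open>f\<close>, so the sum equals its own negative.\<close>

lemma alternating_sum_zero:
  fixes f :: "('a \<Rightarrow> 'a) \<Rightarrow> 'k::field_char_0"
  assumes "finite L" "p \<in> L" "q \<in> L" "p \<noteq> q"
    and "\<And>s. s permutes L \<Longrightarrow> f (Transposition.transpose p q \<circ> s) = f s"
  shows "(\<Sum>s | s permutes L. of_int (sign s) * f s) = 0"
proof -
  let ?g = "\<lambda>s. of_int (sign s) * f s"
  have "(\<Sum>s | s permutes L. ?g s) = (\<Sum>s | s permutes L. ?g (Transposition.transpose p q \<circ> s))"
    using assms by (intro setum_permutations_compose_left permutes_swap_id)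
  also have "\<dots> = (\<Sum>s | s permutes L. - ?g s)"
  proof (intro sum.cong refl)
    fix s assume "s \<in> {s. s permutes L}"
    then have s: "s permutes L" by simp
    then have "permutation s" using assms(1) permutation_permutes by blast
    then have "sign (Transposition.transpose p q \<circ> s) = - sign s"
      using assms(4) by (simp add: sign_compose permutation_swap_id sign_swap_id)
    then show "?g (Transposition.transpose p q \<circ> s) = - ?g s"
      using assms(5)[OF s] by simp
  qed
  finally show ?thesis by (simp add: sum_negf)
qed

text \<open>For each index map \<open>i\<close> two elements of \<open>L\<close> share an index by
  the pigeonhole principle. Exchanging them after \<open>s\<close> does not change the product, so
  the alternating sum vanishes already before summation over \<open>i\<close>.\<close>

theorem fundamental_trace_identity:
  fixes Z :: "'a \<Rightarrow> 'k::field_char_0 ^ 'n ^ 'n"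
  assumes "finite L" "card L > CARD('n)"
  shows "(\<Sum>s | s permutes L. of_int (sign s) * contr L Z s) = 0"
proof -
  have "(\<Sum>s | s permutes L. of_int (sign s) * (\<Prod>l\<in>L. Z l $ i l $ i (s l))) = 0"
    for i :: "'a \<Rightarrow> 'n"
  proof -
    have "\<not> inj_on i L"
      using assms card_inj_on_le[of i L UNIV] by auto
    then obtain p q where pq: "p \<in> L" "q \<in> L" "p \<noteq> q" "i p = i q"
      by (auto simp: inj_on_def)
    have "i (Transposition.transpose p q l) = i l" for l
      using pq(4) by (simp add: Transposition.transpose_def)
    then show ?thesis
      using assms(1) pq by (intro alternating_sum_zero[of L p q]) auto
  qed
  then show ?thesis
    unfolding contr_def sum_distrib_left by (subst sum.swap) simp
qed

section \<open>Permutations modulo antisymmetrizers and the second fundamental theorem\<close>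

definition alternating_vanishing :: "nat \<Rightarrow> nat \<Rightarrow> ((nat \<Rightarrow> nat) \<Rightarrow> 'k::field_char_0) \<Rightarrow> bool" where
  "alternating_vanishing n m \<Lambda> \<longleftrightarrow>
     (\<forall>s P. s permutes {..<m} \<longrightarrow> P \<subseteq> {..<m} \<longrightarrow> card P = Suc n \<longrightarrow>
        (\<Sum>r | r permutes P. of_int (sign r) * \<Lambda> (s \<circ> r)) = 0)"

definition decreasing_on :: "nat set \<Rightarrow> (nat \<Rightarrow> nat) \<Rightarrow> bool" where
  "decreasing_on D s \<longleftrightarrow> (\<forall>p\<in>D. \<forall>q\<in>D. p < q \<longrightarrow> s q < s p)"

text \<open>These permutations span the group algebra modulo the antisymmetrizers on
  \<open>n + 1\<close> points and act independently on the tensor power of an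
  \<open>n\<close>-dimensional space, so they give a basis of the algebra of permutation
  operators.\<close>

definition good_perm :: "nat \<Rightarrow> nat \<Rightarrow> (nat \<Rightarrow> nat) \<Rightarrow> bool" where
  "good_perm n m s \<longleftrightarrow> s permutes {..<m} \<and> (\<forall>D \<subseteq> {..<m}. decreasing_on D s \<longrightarrow> card D \<le> n)"

definition lex_perm :: "nat \<Rightarrow> ((nat \<Rightarrow> nat) \<times> (nat \<Rightarrow> nat)) set" where
  "lex_perm m = {(t, s). t permutes {..<m} \<and> s permutes {..<m} \<and>
     (\<exists>l<m. (\<forall>k<l. t k = s k) \<and> t l < s l)}"

text \<open>Both directions are well-founded because there are finitely many permutations:
  straightening descends in the order, while independence is proved from the largest permutation
  downwards.\<close>

lemma lex_perm_wf: "wf (lex_perm m)" "wf ((lex_perm m)\<inverse>)"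
proof -
  have "lex_perm m \<subseteq> {s. s permutes {..<m}} \<times> {s. s permutes {..<m}}"
    by (auto simp: lex_perm_def)
  then have fin: "finite (lex_perm m)"
    by (rule finite_subset) (simp add: finite_permutations)
  have "trans (lex_perm m)"
  proof (rule transI)
    fix r s t assume "(r, s) \<in> lex_perm m" "(s, t) \<in> lex_perm m"
    then obtain l l' where 1: "r permutes {..<m}" "t permutes {..<m}" "l < m" "l' < m"
      and 2: "\<And>k. k < l \<Longrightarrow> r k = s k" "r l < s l" "\<And>k. k < l' \<Longrightarrow> s k = t k" "s l' < t l'"
      unfolding lex_perm_def by blast
    consider "l < l'" | "l = l'" | "l' < l" by linarith
    then have "\<exists>l<m. (\<forall>k<l. r k = t k) \<and> r l < t l"
    proof cases
      case 1
      then show ?thesis using \<open>l < m\<close> 2 by (intro exI[of _ l]) auto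
    next
      case 2
      then show ?thesis using \<open>l < m\<close> \<open>r l < s l\<close> \<open>s l' < t l'\<close> \<open>\<And>k. k < l \<Longrightarrow> r k = s k\<close>
          \<open>\<And>k. k < l' \<Longrightarrow> s k = t k\<close> by (intro exI[of _ l]) auto
    next
      case 3
      then show ?thesis using \<open>l' < m\<close> 2 by (intro exI[of _ l']) auto
    qed
    then show "(r, t) \<in> lex_perm m"
      using 1 by (simp add: lex_perm_def)
  qed
  moreover have "irrefl (lex_perm m)"
    by (auto simp: irrefl_def lex_perm_def)
  ultimately have "acyclic (lex_perm m)"
    by (simp add: acyclic_irrefl)
  then show "wf (lex_perm m)" "wf ((lex_perm m)\<inverse>)"
    using fin by (auto intro: finite_acyclic_wf finite_acyclic_wf_converse)
qed

text \<open>The first point \<open>p\<close> moved by \<open>r\<close> goes to a larger one, as all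
  smaller points are fixed; since \<open>s\<close> decreases on \<open>P\<close>, the value at
  \<open>p\<close> drops while the earlier values stay.\<close>

lemma lex_perm_decreasing:
  assumes s: "s permutes {..<m}" and P: "P \<subseteq> {..<m}" "decreasing_on P s"
    and r: "r permutes P" "r \<noteq> id"
  shows "(s \<circ> r, s) \<in> lex_perm m"
proof -
  obtain l0 where "r l0 \<noteq> l0"
    using r(2) by (auto simp: fun_eq_iff)
  define p where "p = (LEAST l. r l \<noteq> l)"
  have p: "r p \<noteq> p" unfolding p_def by (rule LeastI[of _ l0]) fact
  have least: "r k = k" if "k < p" for k
    using not_less_Least that unfolding p_def by blast
  have "p \<in> P" using p r(1) by (auto simp: permutes_def)
  then have "r p \<in> P" using r(1) by (simp add: permutes_in_image)
  have "p < r p"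
    using p least[of "r p"] permutes_inj[OF r(1)] by (metis injD linorder_neqE_nat)
  then have "s (r p) < s p"
    using P(2) \<open>p \<in> P\<close> \<open>r p \<in> P\<close> by (auto simp: decreasing_on_def)
  moreover have "s \<circ> r permutes {..<m}"
    using permutes_compose[OF permutes_subset[OF r(1) P(1)] s] .
  ultimately show ?thesis
    using s least \<open>p \<in> P\<close> P(1) by (auto simp: lex_perm_def intro!: exI[of _ p])
qed

text \<open>A decreasing subsequence of length \<open>n + 1\<close> supplies a set \<open>P\<close>
  whose relation expresses \<open>s\<close> through lexicographically smaller permutations. The
  coefficients \<open>g\<close> are chosen before \<Lambda>, so that one expansion serves all
  functionals.\<close>

lemma straightening:
  assumes "s permutes {..<m}"
  shows "\<exists>g :: (nat \<Rightarrow> nat) \<Rightarrow> 'k::field_char_0. (\<forall>t. g t \<noteq> 0 \<longrightarrow> good_perm n m t) \<and>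
    (\<forall>\<Lambda>. alternating_vanishing n m \<Lambda> \<longrightarrow> \<Lambda> s = (\<Sum>t | t permutes {..<m}. g t * \<Lambda> t))"
  using assms
proof (induction s rule: wf_induct_rule[OF lex_perm_wf(1)[of m]])
  case (1 s)
  show ?case
  proof (cases "good_perm n m s")
    case True
    have "(\<Sum>t | t permutes {..<m}. (if t = s then 1 else 0) * \<Lambda> t) = \<Lambda> s" for \<Lambda> :: "_ \<Rightarrow> 'k"
    proof -
      have "(\<Sum>t | t permutes {..<m}. (if t = s then 1 else 0) * \<Lambda> t)
          = (\<Sum>t | t permutes {..<m}. if t = s then \<Lambda> t else 0)"
        by (intro sum.cong) auto
      then show ?thesis
        using 1 by (simp add: finite_permutations)
    qed
    then show ?thesis
      using True by (intro exI[of _ "\<lambda>t. if t = s then 1 else 0"]) auto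
  next
    case False
    then obtain D where D: "D \<subseteq> {..<m}" "decreasing_on D s" "Suc n \<le> card D"
      using 1 by (auto simp: good_perm_def not_le)
    then obtain P where P: "P \<subseteq> D" "card P = Suc n" "finite P"
      using obtain_subset_with_card_n by metis
    have Pm: "P \<subseteq> {..<m}" and dec: "decreasing_on P s"
      using P D by (auto simp: decreasing_on_def)
    let ?Q = "{r. r permutes P} - {id}"
    have finQ: "finite ?Q" using P(3) by (simp add: finite_permutations)
    have "\<forall>r\<in>?Q. \<exists>g :: (nat \<Rightarrow> nat) \<Rightarrow> 'k. (\<forall>t. g t \<noteq> 0 \<longrightarrow> good_perm n m t) \<and>
        (\<forall>\<Lambda>. alternating_vanishing n m \<Lambda> \<longrightarrow> \<Lambda> (s \<circ> r) = (\<Sum>t | t permutes {..<m}. g t * \<Lambda> t))"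
    proof
      fix r assume "r \<in> ?Q"
      then have "(s \<circ> r, s) \<in> lex_perm m"
        using lex_perm_decreasing[OF 1(2) Pm dec] by auto
      moreover from this have "s \<circ> r permutes {..<m}"
        by (simp add: lex_perm_def)
      ultimately show "\<exists>g :: (nat \<Rightarrow> nat) \<Rightarrow> 'k. (\<forall>t. g t \<noteq> 0 \<longrightarrow> good_perm n m t) \<and>
        (\<forall>\<Lambda>. alternating_vanishing n m \<Lambda> \<longrightarrow> \<Lambda> (s \<circ> r) = (\<Sum>t | t permutes {..<m}. g t * \<Lambda> t))"
        by (rule 1(1))
    qed
    then obtain g :: "(nat \<Rightarrow> nat) \<Rightarrow> (nat \<Rightarrow> nat) \<Rightarrow> 'k" where
      g0: "\<forall>r\<in>?Q. (\<forall>t. g r t \<noteq> 0 \<longrightarrow> good_perm n m t) \<and>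
        (\<forall>\<Lambda>. alternating_vanishing n m \<Lambda> \<longrightarrow> \<Lambda> (s \<circ> r) = (\<Sum>t | t permutes {..<m}. g r t * \<Lambda> t))"
      by (rule bchoice[THEN exE])
    then have g: "\<And>r t. r \<in> ?Q \<Longrightarrow> g r t \<noteq> 0 \<Longrightarrow> good_perm n m t"
         "\<And>r \<Lambda>. r \<in> ?Q \<Longrightarrow> alternating_vanishing n m \<Lambda> \<Longrightarrow>
            \<Lambda> (s \<circ> r) = (\<Sum>t | t permutes {..<m}. g r t * \<Lambda> t)"
      by blast+
    define h where "h t = - (\<Sum>r\<in>?Q. of_int (sign r) * g r t)" for t
    have "good_perm n m t" if "h t \<noteq> 0" for t
    proof (rule ccontr)
      assume "\<not> good_perm n m t"
      then have "(\<Sum>r\<in>?Q. of_int (sign r) * g r t) = 0"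
        using g(1) by (intro sum.neutral) fastforce
      then show False using that by (simp add: h_def)
    qed
    moreover have "\<Lambda> s = (\<Sum>t | t permutes {..<m}. h t * \<Lambda> t)" if \<Lambda>: "alternating_vanishing n m \<Lambda>" for \<Lambda>
    proof -
      have "0 = (\<Sum>r | r permutes P. of_int (sign r) * \<Lambda> (s \<circ> r))"
        using \<Lambda> 1(2) Pm P(2) by (auto simp: alternating_vanishing_def)
      also have "\<dots> = \<Lambda> s + (\<Sum>r\<in>?Q. of_int (sign r) * \<Lambda> (s \<circ> r))"
        using P(3) by (subst sum.remove[of _ id]) (auto simp: finite_permutations permutes_id)
      finally have "\<Lambda> s = - (\<Sum>r\<in>?Q. of_int (sign r) * \<Lambda> (s \<circ> r))"
        by (simp add: eq_neg_iff_add_eq_0)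
      also have "\<dots> = - (\<Sum>r\<in>?Q. \<Sum>t | t permutes {..<m}. of_int (sign r) * g r t * \<Lambda> t)"
        using g(2)[OF _ \<Lambda>] by (simp add: sum_distrib_left mult.assoc)
      also have "\<dots> = (\<Sum>t | t permutes {..<m}. h t * \<Lambda> t)"
        by (subst sum.swap) (simp add: h_def sum_distrib_right sum_negf)
      finally show ?thesis .
    qed
    ultimately show ?thesis by blast
  qed
qed

text \<open>
  The colour of \<open>l\<close> is the length of the longest decreasing subsequence of \<open>s\<close> that ends in \<open>l\<close>.
\<close>

lemma good_perm_colouring:
  assumes "good_perm CARD('n::finite) m s"
  obtains \<kappa> :: "nat \<Rightarrow> 'n::finite" where "\<And>k l. k < l \<Longrightarrow> l < m \<Longrightarrow> \<kappa> k = \<kappa> l \<Longrightarrow> s k < s l"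
proof -
  let ?S = "\<lambda>l. {D. D \<subseteq> {..l} \<and> l \<in> D \<and> decreasing_on D s}"
  define \<rho> where "\<rho> l = Max (card ` ?S l)" for l
  have fin: "finite (?S l)" for l by (rule finite_subset[of _ "Pow {..l}"]) auto
  have single: "{l} \<in> ?S l" for l by (auto simp: decreasing_on_def)
  have pos: "0 < \<rho> l" for l
  proof -
    have "card {l} \<le> \<rho> l" unfolding \<rho>_def using fin single by (intro Max_ge imageI) auto
    then show ?thesis by simp
  qed
  have attained: "\<exists>D\<in>?S l. card D = \<rho> l" for l
  proof -
    have "card ` ?S l \<noteq> {}" using single[of l] by (metis empty_iff image_is_empty)
    then have "\<rho> l \<in> card ` ?S l" unfolding \<rho>_def by (rule Max_in[OF finite_imageI[OF fin]])
    then obtain D where "D \<in> ?S l" "card D = \<rho> l" by (metis (no_types, lifting) imageE)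
    then show ?thesis by (rule bexI[rotated])
  qed
  have le: "\<rho> l \<le> CARD('n)" if "l < m" for l
  proof -
    obtain D where "D \<subseteq> {..l}" "decreasing_on D s" "card D = \<rho> l" using attained by blast
    moreover from this that have "D \<subseteq> {..<m}" by auto
    ultimately show ?thesis using assms unfolding good_perm_def by metis
  qed
  have step: "\<rho> k < \<rho> l" if "k < l" "s l < s k" for k l
  proof -
    obtain D where D: "D \<subseteq> {..k}" "k \<in> D" "decreasing_on D s" "card D = \<rho> k" using attained by blast
    have "l \<notin> D" "finite D" using D that finite_subset by auto
    have "s l < s p" if "p \<in> D" for p
    proof (cases "p = k")
      case False
      then have "p < k" using D(1) that by force
      then have "s k < s p" using D that by (auto simp: decreasing_on_def)
      then show ?thesis using \<open>s l < s k\<close> by simp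
    qed (use \<open>s l < s k\<close> in simp)
    then have "insert l D \<in> ?S l"
      using D \<open>k < l\<close> by (fastforce simp: decreasing_on_def)
    then have "card (insert l D) \<le> \<rho> l"
      unfolding \<rho>_def using fin by (intro Max_ge imageI) auto
    then show ?thesis using \<open>l \<notin> D\<close> \<open>finite D\<close> D(4) by simp
  qed
  obtain h :: "nat \<Rightarrow> 'n" where h: "bij_betw h {0..<CARD('n)} UNIV"
    using ex_bij_betw_nat_finite[of "UNIV :: 'n set"] by auto
  \<comment> \<open>The lengths \<rho> count from 1, the enumeration \<open>h\<close> of the colours
    from 0.\<close>
  have "s k < s l" if "k < l" "l < m" "h (\<rho> k - 1) = h (\<rho> l - 1)" for k l
  proof -
    have "\<rho> k - 1 = \<rho> l - 1"
      using h that le[of k] le[of l] pos[of k] pos[of l] unfolding bij_betw_def by (auto dest: inj_onD)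
    then have "\<rho> k = \<rho> l" using pos[of k] pos[of l] by linarith
    then have "\<not> s l < s k" using step[OF that(1)] by auto
    moreover have "s k \<noteq> s l"
      using assms that by (metis good_perm_def injD less_irrefl permutes_inj)
    ultimately show ?thesis by simp
  qed
  then show ?thesis using that[of "\<lambda>l. h (\<rho> l - 1)"] by blast
qed

text \<open>The sum in \<open>zero\<close> is the entry at \<open>i\<close>, \<open>j\<close> of a
  combination of permutation operators. The colouring of a good \<open>s\<close> provides index maps
  for which all other contributing permutations are larger than \<open>s\<close>; as their
  coefficients are already known to be zero, the entry is \<open>d s\<close>.\<close>

lemma good_perm_independent:
  fixes d :: "(nat \<Rightarrow> nat) \<Rightarrow> 'k::field_char_0"
  assumes supp: "\<And>t. d t \<noteq> 0 \<Longrightarrow> good_perm CARD('n::finite) m t"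
    and zero: "\<And>i j :: nat \<Rightarrow> 'n::finite. (\<Sum>t | t permutes {..<m} \<and> (\<forall>l<m. i (t l) = j l). d t) = 0"
  shows "d s = 0"
proof (induction s rule: wf_induct_rule[OF lex_perm_wf(2)[of m]])
  case (1 s)
  show ?case
  proof (rule ccontr)
    assume "d s \<noteq> 0"
    then have good: "good_perm CARD('n) m s" by (rule supp)
    then have s: "s permutes {..<m}" by (simp add: good_perm_def)
    obtain \<kappa> :: "nat \<Rightarrow> 'n" where \<kappa>: "\<And>k l. k < l \<Longrightarrow> l < m \<Longrightarrow> \<kappa> k = \<kappa> l \<Longrightarrow> s k < s l"
      using good_perm_colouring[OF good] by blast
    \<comment> \<open>\<open>s\<close> is increasing on colour classes, so it is lexicographically least in \<open>?C\<close>.\<close>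
    let ?C = "{t. t permutes {..<m} \<and> (\<forall>l<m. (\<kappa> \<circ> inv s) (t l) = \<kappa> l)}"
    have sC: "s \<in> ?C" using s by (simp add: permutes_inverses)
    have "d t = 0" if t: "t \<in> ?C" "t \<noteq> s" for t
    proof -
      obtain l0 where "t l0 \<noteq> s l0" using t(2) by (auto simp: fun_eq_iff)
      define p where "p = (LEAST l. t l \<noteq> s l)"
      have p: "t p \<noteq> s p" unfolding p_def by (rule LeastI[of _ l0]) fact
      have least: "t k = s k" if "k < p" for k
        using not_less_Least that unfolding p_def by blast
      have pm: "p < m" using p s t by (auto simp: permutes_def)
      \<comment> \<open>The place where \<open>s\<close> has the value that \<open>t\<close> has at
        the first disagreement \<open>p\<close>. It lies after \<open>p\<close> and has the same
        colour, which forces \<open>s p < s q\<close>.\<close>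
      define q where "q = inv s (t p)"
      have sq: "s q = t p" unfolding q_def using s by (simp add: permutes_inverses)
      have "q < m"
        using pm t(1) s sq by (metis (no_types, lifting) lessThan_iff mem_Collect_eq permutes_in_image)
      have "\<kappa> q = \<kappa> p" using t(1) pm by (simp add: q_def)
      have "\<not> q < p"
      proof
        assume "q < p"
        then have "t q = t p" using least sq by simp
        then show False using t(1) \<open>q < p\<close> by (metis (mono_tags, lifting) injD less_irrefl mem_Collect_eq permutes_inj)
      qed
      moreover have "q \<noteq> p" using sq p by auto
      ultimately have "s p < s q" using \<kappa>[of p q] \<open>q < m\<close> \<open>\<kappa> q = \<kappa> p\<close> by simp
      then have "(s, t) \<in> lex_perm m"
        using s t pm least sq by (auto simp: lex_perm_def intro!: exI[of _ p])
      then show ?thesis using 1[of t] by simp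
    qed
    then have "(\<Sum>t\<in>?C. d t) = d s"
      using sC by (subst sum.remove[of _ s]) (auto intro!: sum.neutral finite_subset[OF _ finite_permutations[of "{..<m}"]])
    then show False using zero[of "\<kappa> \<circ> inv s" \<kappa>] \<open>d s \<noteq> 0\<close> by simp
  qed
qed

text \<open>At matrix units a contraction becomes an entry of the permutation operator of
  \<open>t\<close>; this turns relations between contractions into relations between
  operators.\<close>

lemma contr_elementary:
  fixes i j :: "nat \<Rightarrow> 'n::finite"
  assumes "t permutes {..<m}"
  shows "contr {..<m} (\<lambda>l. \<chi> a b. if a = i l \<and> b = j l then 1 else 0) t
    = (if \<forall>l<m. i (t l) = j l then 1 else (0 :: 'k::comm_ring_1))"
proof -
  let ?f = "\<lambda>i'. \<Prod>l<m. if i' l = i l \<and> i' (t l) = j l then 1 else (0 :: 'k)"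
  have "?f i' = 0" if "i' \<in> {..<m} \<rightarrow>\<^sub>E UNIV" "i' \<noteq> restrict i {..<m}" for i'
  proof -
    have "\<exists>l<m. i' l \<noteq> i l"
    proof (rule ccontr)
      assume "\<not> ?thesis"
      then have "i' = restrict i {..<m}" using that(1) by (auto simp: fun_eq_iff PiE_def extensional_def)
      then show False using that(2) by simp
    qed
    then show ?thesis by (intro prod_zero) auto
  qed
  then have "(\<Sum>i' \<in> {..<m} \<rightarrow>\<^sub>E UNIV. ?f i') = ?f (restrict i {..<m})"
    by (subst sum.remove[of _ "restrict i {..<m}"]) (auto intro!: sum.neutral finite_PiE)
  also have "\<dots> = (if \<forall>l<m. i (t l) = j l then 1 else 0)"
  proof -
    have "t l < m" if "l < m" for l using assms that permutes_in_image[OF assms] by (metis lessThan_iff)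
    then show ?thesis by (auto intro!: prod_zero prod.neutral)
  qed
  finally show ?thesis unfolding contr_def by simp
qed

text \<open>Two of the \<open>CARD('n) + 1\<close> points of \<open>P\<close> have the same value
  under \<open>j\<close>, and exchanging them is a symmetry of the entry.\<close>

lemma alternating_vanishing_entry:
  fixes i j :: "nat \<Rightarrow> 'n::finite"
  shows "alternating_vanishing CARD('n) m (\<lambda>t. if \<forall>l<m. i (t l) = j l then 1 else (0 :: 'k::field_char_0))"
  unfolding alternating_vanishing_def
proof (intro allI impI)
  fix s P assume s: "s permutes {..<m}" and P: "P \<subseteq> {..<m}" "card P = Suc CARD('n)"
  have fin: "finite P" using P(2) card.infinite by fastforce
  have "\<not> inj_on j P"
    using P card_inj_on_le[of j P UNIV] by auto
  then obtain p q where pq: "p \<in> P" "q \<in> P" "p \<noteq> q" "j p = j q"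
    by (auto simp: inj_on_def)
  \<comment> \<open>The symmetry multiplies \<open>r\<close> by a transposition on the right,
    whereas \<open>alternating_sum_zero\<close> multiplies on the left; hence the passage to
    inverses.\<close>
  let ?f = "\<lambda>r. if \<forall>l<m. i ((s \<circ> inv r) l) = j l then 1 else (0 :: 'k)"
  have "(\<Sum>r | r permutes P. of_int (sign r) * ?f r) = 0"
  proof (rule alternating_sum_zero[OF fin pq(1-3)])
    fix r assume r: "r permutes P"
    let ?t = "Transposition.transpose p q"
    have "inv (?t \<circ> r) = inv r \<circ> ?t"
      using permutes_bij[OF r] by (simp add: o_inv_distrib)
    moreover have "?t l < m \<longleftrightarrow> l < m" for l
      using pq P(1) by (auto simp: Transposition.transpose_def)
    moreover have "j (?t l) = j l" for l using pq(4) by (simp add: Transposition.transpose_def)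
    ultimately have "(\<forall>l<m. i ((s \<circ> inv (?t \<circ> r)) l) = j l) \<longleftrightarrow> (\<forall>l<m. i ((s \<circ> inv r) l) = j l)"
      by (simp add: comp_def) (metis Transposition.transpose_involutory)
    then show "?f (?t \<circ> r) = ?f r" by simp
  qed
  also have "(\<Sum>r | r permutes P. of_int (sign r) * ?f r)
      = (\<Sum>r | r permutes P. of_int (sign (inv r)) * ?f (inv r))"
    by (rule sum_permutations_inverse)
  also have "\<dots> = (\<Sum>r | r permutes P. of_int (sign r) * (if \<forall>l<m. i ((s \<circ> r) l) = j l then 1 else 0))"
    using fin by (intro sum.cong refl)
      (simp add: permutes_inv_inv sign_inverse permutes_imp_permutation[OF fin])
  finally show "(\<Sum>r | r permutes P. of_int (sign r) * (if \<forall>l<m. i ((s \<circ> r) l) = j l then 1 else (0 :: 'k))) = 0" .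
qed

text \<open>Straightening replaces \<open>d\<close> by coefficients \<open>d'\<close> on good
  permutations without changing the value under any \<Lambda> that kills the antisymmetrizers.
  Matrix entries are such functionals and give zero by \<open>zero\<close>, so \<open>d'\<close> is
  zero by independence, and then every such \<Lambda> kills \<open>d\<close>.\<close>

theorem second_fundamental_theorem:
  fixes d :: "(nat \<Rightarrow> nat) \<Rightarrow> 'k::field_char_0"
  assumes zero: "\<And>Z :: nat \<Rightarrow> 'k ^ 'n ^ 'n. (\<Sum>t | t permutes {..<m}. d t * contr {..<m} Z t) = 0"
    and \<Lambda>: "alternating_vanishing CARD('n) m \<Lambda>"
  shows "(\<Sum>t | t permutes {..<m}. d t * \<Lambda> t) = 0"
proof -
  let ?P = "{s. s permutes {..<m}}"
  have "\<forall>s\<in>?P. \<exists>g :: (nat \<Rightarrow> nat) \<Rightarrow> 'k. (\<forall>t. g t \<noteq> 0 \<longrightarrow> good_perm CARD('n) m t) \<and>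
    (\<forall>\<Lambda>. alternating_vanishing CARD('n) m \<Lambda> \<longrightarrow> \<Lambda> s = (\<Sum>t\<in>?P. g t * \<Lambda> t))"
    using straightening by blast
  then obtain g :: "(nat \<Rightarrow> nat) \<Rightarrow> (nat \<Rightarrow> nat) \<Rightarrow> 'k" where
    "\<forall>s\<in>?P. (\<forall>t. g s t \<noteq> 0 \<longrightarrow> good_perm CARD('n) m t) \<and>
    (\<forall>\<Lambda>. alternating_vanishing CARD('n) m \<Lambda> \<longrightarrow> \<Lambda> s = (\<Sum>t\<in>?P. g s t * \<Lambda> t))"
    by (rule bchoice[THEN exE])
  then have g: "\<And>s t. s \<in> ?P \<Longrightarrow> g s t \<noteq> 0 \<Longrightarrow> good_perm CARD('n) m t"
       "\<And>s \<Lambda>. s \<in> ?P \<Longrightarrow> alternating_vanishing CARD('n) m \<Lambda> \<Longrightarrow> \<Lambda> s = (\<Sum>t\<in>?P. g s t * \<Lambda> t)"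
    by blast+
  define d' where "d' t = (\<Sum>s\<in>?P. d s * g s t)" for t
  have rewrite: "(\<Sum>t\<in>?P. d t * \<Lambda> t) = (\<Sum>t\<in>?P. d' t * \<Lambda> t)"
    if "alternating_vanishing CARD('n) m \<Lambda>" for \<Lambda>
  proof -
    have "(\<Sum>s\<in>?P. d s * \<Lambda> s) = (\<Sum>s\<in>?P. \<Sum>t\<in>?P. d s * g s t * \<Lambda> t)"
      using g(2)[OF _ that] by (simp add: sum_distrib_left mult.assoc)
    also have "\<dots> = (\<Sum>t\<in>?P. d' t * \<Lambda> t)"
      by (subst sum.swap) (simp add: d'_def sum_distrib_right)
    finally show ?thesis .
  qed
  have "d' t = 0" for t
  proof (rule good_perm_independent[where 'n = 'n and m = m and d = d'])
    fix t assume "d' t \<noteq> 0"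
    then obtain s where "s \<in> ?P" "d s * g s t \<noteq> 0"
      unfolding d'_def by (meson sum.not_neutral_contains_not_neutral)
    then show "good_perm CARD('n) m t" using g(1) by auto
  next
    fix i j :: "nat \<Rightarrow> 'n"
    let ?e = "\<lambda>t. if \<forall>l<m. i (t l) = j l then 1 else (0 :: 'k)"
    have "(\<Sum>t\<in>?P. d' t * ?e t) = (\<Sum>t\<in>?P. d t * ?e t)"
      by (rule rewrite[symmetric]) (rule alternating_vanishing_entry)
    also have "\<dots> = (\<Sum>t\<in>?P. d t * contr {..<m} (\<lambda>l. \<chi> a b. if a = i l \<and> b = j l then 1 else 0) t)"
      by (intro sum.cong refl) (simp add: contr_elementary)
    also have "\<dots> = 0" by (rule zero)
    finally have "(\<Sum>t\<in>?P. d' t * ?e t) = 0" .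
    moreover have "(\<Sum>t\<in>?P. d' t * ?e t) = (\<Sum>t | t permutes {..<m} \<and> (\<forall>l<m. i (t l) = j l). d' t)"
      by (rule sum.mono_neutral_cong_right) (auto simp: finite_permutations)
    ultimately show "(\<Sum>t | t permutes {..<m} \<and> (\<forall>l<m. i (t l) = j l). d' t) = 0" by simp
  qed
  then show ?thesis using rewrite[OF \<Lambda>] by simp
qed

section \<open>Multilinear invariants\<close>

abbreviation tuples :: "nat \<Rightarrow> (nat \<Rightarrow> 'n) set" where
  "tuples m \<equiv> {..<m} \<rightarrow>\<^sub>E UNIV"

lemma finite_tuples [simp]: "finite (tuples m :: (nat \<Rightarrow> 'n::finite) set)"
  by (intro finite_PiE) auto

definition kron :: "nat \<Rightarrow> (nat \<Rightarrow> 'k::comm_ring_1 ^ 'n ^ 'n) \<Rightarrow> (nat \<Rightarrow> 'n) \<Rightarrow> (nat \<Rightarrow> 'n) \<Rightarrow> 'k" where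
  "kron m Z i j = (\<Prod>l<m. Z l $ i l $ j l)"

definition multilin :: "nat \<Rightarrow> ((nat \<Rightarrow> 'n) \<Rightarrow> (nat \<Rightarrow> 'n) \<Rightarrow> 'k) \<Rightarrow> (nat \<Rightarrow> 'k::comm_ring_1 ^ 'n ^ 'n) \<Rightarrow> 'k" where
  "multilin m T Z = (\<Sum>i\<in>tuples m. \<Sum>j\<in>tuples m. T i j * kron m Z i j)"

section \<open>Polarization by inclusion and exclusion\<close>

lemma alternating_sum_supersets:
  assumes "finite A" "R \<subseteq> A"
  shows "(\<Sum>S\<in>Pow A. (- 1) ^ (card A - card S) * (if R \<subseteq> S then 1 else 0))
    = (if R = A then 1 else (0 :: 'k::comm_ring_1))"
proof (cases "R = A")
  case True
  have "(\<Sum>S\<in>Pow A. (- 1) ^ (card A - card S) * (if R \<subseteq> S then 1 else (0 :: 'k)))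
      = (\<Sum>S\<in>{A}. (- 1) ^ (card A - card S) * (if R \<subseteq> S then 1 else 0))"
    using assms True by (intro sum.mono_neutral_right) auto
  then show ?thesis using True by simp
next
  case False
  then obtain a where a: "a \<in> A" "a \<notin> R" using assms(2) by blast
  define B where "B = A - {a}"
  have B: "A = insert a B" "a \<notin> B" "finite B" using a assms(1) by (auto simp: B_def)
  let ?f = "\<lambda>S. (- 1) ^ (card A - card S) * (if R \<subseteq> S then 1 else (0 :: 'k))"
  have "(\<Sum>S\<in>Pow A. ?f S) = (\<Sum>S\<in>Pow B. ?f S) + (\<Sum>S\<in>insert a ` Pow B. ?f S)"
    unfolding B(1) Pow_insert using B by (intro sum.union_disjoint) auto
  also have "(\<Sum>S\<in>insert a ` Pow B. ?f S) = (\<Sum>S\<in>Pow B. ?f (insert a S))"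
    using B by (intro sum.reindex_cong[of "insert a"]) (auto simp: inj_on_def)
  also have "\<dots> = (\<Sum>S\<in>Pow B. - ?f S)"
  proof (intro sum.cong refl)
    fix S assume "S \<in> Pow B"
    then have S: "S \<subseteq> B" "finite S" "a \<notin> S" using B finite_subset by auto
    then have "card S \<le> card B" using B card_mono by blast
    then have "card A - card S = Suc (card A - card (insert a S))"
      using S B by simp
    moreover have "R \<subseteq> insert a S \<longleftrightarrow> R \<subseteq> S" using a by auto
    ultimately show "?f (insert a S) = - ?f S" by simp
  qed
  finally show ?thesis using False by (simp add: sum_negf)
qed

text \<open>A permutation is the identity outside \<open>{..<m}\<close>, an element of the function
  space is \<open>undefined\<close> there; on a finite set the surjective self-maps are exactly the
  permutations.\<close>

lemma sum_permutes_eq_PiE: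
  fixes m :: nat
  assumes "\<And>\<phi>. f (restrict \<phi> {..<m}) = f \<phi>"
  shows "(\<Sum>\<phi> | \<phi> permutes {..<m} \<and> (\<forall>l<m. c (\<phi> l) = c l). f \<phi>)
    = (\<Sum>\<phi> | \<phi> \<in> (\<Pi>\<^sub>E l\<in>{..<m}. {k. k < m \<and> c k = c l}) \<and> \<phi> ` {..<m} = {..<m}. f \<phi>)"
    (is "sum f ?H = sum f ?B")
proof (rule sum.reindex_bij_witness[where j = "\<lambda>\<phi>. restrict \<phi> {..<m}"
      and i = "\<lambda>\<phi> l. if l < m then \<phi> l else l"])
  fix \<phi> assume "\<phi> \<in> ?H"
  then have \<phi>: "\<phi> permutes {..<m}" "\<And>l. l < m \<Longrightarrow> c (\<phi> l) = c l" by auto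
  show "(\<lambda>l. if l < m then restrict \<phi> {..<m} l else l) = \<phi>"
    using \<phi>(1) by (auto simp: fun_eq_iff permutes_def)
  show "restrict \<phi> {..<m} \<in> ?B"
    using \<phi> permutes_in_image[OF \<phi>(1)] permutes_image[OF \<phi>(1)] by auto
  show "f (restrict \<phi> {..<m}) = f \<phi>" by (rule assms)
next
  fix \<phi> assume "\<phi> \<in> ?B"
  then have \<phi>: "\<phi> \<in> (\<Pi>\<^sub>E l\<in>{..<m}. {k. k < m \<and> c k = c l})" "\<phi> ` {..<m} = {..<m}" by auto
  show "restrict (\<lambda>l. if l < m then \<phi> l else l) {..<m} = \<phi>"
    using \<phi>(1) by (auto simp: fun_eq_iff PiE_def extensional_def)
  have "inj_on \<phi> {..<m}"
    by (rule eq_card_imp_inj_on) (simp_all add: \<phi>(2))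
  then have "bij_betw \<phi> {..<m} {..<m}"
    using \<phi>(2) by (simp add: bij_betw_def)
  then have "bij_betw (\<lambda>l. if l < m then \<phi> l else l) {..<m} {..<m}"
    by (rule bij_betw_cong[THEN iffD1, rotated]) auto
  then have "(\<lambda>l. if l < m then \<phi> l else l) permutes {..<m}"
    by (rule bij_imp_permutes) auto
  then show "(\<lambda>l. if l < m then \<phi> l else l) \<in> ?H"
    using \<phi>(1) by (auto simp: PiE_iff)
qed

text \<open>Each summand on the right expands over the colour-preserving maps with image in
  \<open>S\<close>; the signs cancel all but the maps onto \<open>{..<m}\<close>. The colouring
  \<open>c\<close> is constant for full symmetrization and separates the two letters for
  bihomogeneous forms.\<close>

lemma kron_polarization:
  fixes Z :: "nat \<Rightarrow> 'k::comm_ring_1 ^ 'n ^ 'n"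
  shows "(\<Sum>\<phi> | \<phi> permutes {..<m} \<and> (\<forall>l<m. c (\<phi> l) = c l). kron m (\<lambda>l. Z (\<phi> l)) i j)
    = (\<Sum>S\<in>Pow {..<m}. (- 1) ^ (m - card S) * kron m (\<lambda>l. \<Sum>k | k \<in> S \<and> c k = c l. Z k) i j)"
proof -
  let ?B = "\<Pi>\<^sub>E l\<in>{..<m}. {k. k < m \<and> c k = c l}"
  let ?f = "\<lambda>\<phi>. kron m (\<lambda>l. Z (\<phi> l)) i j"
  have finB: "finite ?B" by (intro finite_PiE) auto
  have expand: "kron m (\<lambda>l. \<Sum>k | k \<in> S \<and> c k = c l. Z k) i j
      = (\<Sum>\<phi>\<in>?B. (if \<phi> ` {..<m} \<subseteq> S then 1 else 0) * ?f \<phi>)" if S: "S \<subseteq> {..<m}" for S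
  proof -
    have "kron m (\<lambda>l. \<Sum>k | k \<in> S \<and> c k = c l. Z k) i j
        = (\<Prod>l<m. \<Sum>k | k \<in> S \<and> c k = c l. Z k $ i l $ j l)"
      by (simp add: kron_def)
    also have "\<dots> = (\<Sum>\<phi>\<in>(\<Pi>\<^sub>E l\<in>{..<m}. {k. k \<in> S \<and> c k = c l}). ?f \<phi>)"
      unfolding kron_def using finite_subset[OF S] by (intro prod_sum_PiE) auto
    also have "\<dots> = (\<Sum>\<phi>\<in>?B. if \<phi> ` {..<m} \<subseteq> S then ?f \<phi> else 0)"
      using S finB by (intro sum.mono_neutral_cong_left) (auto simp: PiE_iff)
    also have "\<dots> = (\<Sum>\<phi>\<in>?B. (if \<phi> ` {..<m} \<subseteq> S then 1 else 0) * ?f \<phi>)"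
      by (intro sum.cong) auto
    finally show ?thesis .
  qed
  have "(\<Sum>S\<in>Pow {..<m}. (- 1) ^ (m - card S) * kron m (\<lambda>l. \<Sum>k | k \<in> S \<and> c k = c l. Z k) i j)
      = (\<Sum>S\<in>Pow {..<m}. \<Sum>\<phi>\<in>?B. (- 1) ^ (m - card S) * ((if \<phi> ` {..<m} \<subseteq> S then 1 else 0) * ?f \<phi>))"
    by (intro sum.cong refl) (simp add: expand sum_distrib_left)
  also have "\<dots> = (\<Sum>\<phi>\<in>?B. (\<Sum>S\<in>Pow {..<m}. (- 1) ^ (card {..<m} - card S) * (if \<phi> ` {..<m} \<subseteq> S then 1 else 0)) * ?f \<phi>)"
    by (subst sum.swap) (simp add: sum_distrib_right mult.assoc)
  also have "\<dots> = (\<Sum>\<phi>\<in>?B. (if \<phi> ` {..<m} = {..<m} then 1 else 0) * ?f \<phi>)"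
  proof (intro sum.cong refl)
    fix \<phi> assume "\<phi> \<in> ?B"
    then have "\<phi> ` {..<m} \<subseteq> {..<m}" by (auto simp: PiE_iff)
    then show "(\<Sum>S\<in>Pow {..<m}. (- 1) ^ (card {..<m} - card S) * (if \<phi> ` {..<m} \<subseteq> S then 1 else 0)) * ?f \<phi>
       = (if \<phi> ` {..<m} = {..<m} then 1 else 0) * ?f \<phi>"
      by (subst alternating_sum_supersets) auto
  qed
  also have "\<dots> = (\<Sum>\<phi> | \<phi> \<in> ?B \<and> \<phi> ` {..<m} = {..<m}. ?f \<phi>)"
    using finB by (intro sum.mono_neutral_cong_right) auto
  also have "\<dots> = (\<Sum>\<phi> | \<phi> permutes {..<m} \<and> (\<forall>l<m. c (\<phi> l) = c l). ?f \<phi>)"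
    by (rule sum_permutes_eq_PiE[symmetric]) (simp add: kron_def)
  finally show ?thesis ..
qed

lemma multilin_sum_left:
  "(\<Sum>x\<in>X. a x * multilin m T (Z x)) = (\<Sum>i\<in>tuples m. \<Sum>j\<in>tuples m. T i j * (\<Sum>x\<in>X. a x * kron m (Z x) i j))"
  unfolding multilin_def sum_distrib_left
  by (subst sum.swap, rule sum.cong[OF refl], subst sum.swap) (simp add: ac_simps)

lemma multilin_polarization:
  fixes Z :: "nat \<Rightarrow> 'k::comm_ring_1 ^ 'n ^ 'n"
  shows "(\<Sum>\<phi> | \<phi> permutes {..<m} \<and> (\<forall>l<m. c (\<phi> l) = c l). multilin m T (\<lambda>l. Z (\<phi> l)))
    = (\<Sum>S\<in>Pow {..<m}. (- 1) ^ (m - card S) * multilin m T (\<lambda>l. \<Sum>k | k \<in> S \<and> c k = c l. Z k))"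
  unfolding multilin_sum_left kron_polarization[symmetric]
  using multilin_sum_left[where a = "\<lambda>_. 1"] by simp

lemma kron_mult:
  fixes A B :: "nat \<Rightarrow> 'k::comm_ring_1 ^ 'n ^ 'n"
  shows "kron m (\<lambda>l. A l ** B l) i j = (\<Sum>k\<in>tuples m. kron m A i k * kron m B k j)"
proof -
  have "kron m (\<lambda>l. A l ** B l) i j = (\<Prod>l<m. \<Sum>k\<in>UNIV. A l $ i l $ k * B l $ k $ j l)"
    by (simp add: kron_def matrix_matrix_mult_def)
  also have "\<dots> = (\<Sum>k\<in>tuples m. \<Prod>l<m. A l $ i l $ k l * B l $ k l $ j l)"
    by (intro prod_sum_PiE) auto
  finally show ?thesis by (simp add: kron_def prod.distrib)
qed

lemma tuples_eqI:
  assumes "i \<in> tuples m" "j \<in> tuples m" "\<And>l. l < m \<Longrightarrow> i l = j l"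
  shows "i = j"
  using assms by (intro PiE_ext[of i "{..<m}"]) auto

lemma kron_delta:
  assumes "a \<in> tuples m" "b \<in> tuples m"
  shows "kron m (\<lambda>_. mat 1) a b = (if a = b then 1 else (0 :: 'k::comm_ring_1))"
proof (cases "a = b")
  case False
  then have "\<exists>l<m. a l \<noteq> b l" using tuples_eqI[OF assms] by blast
  then show ?thesis using False by (auto simp: kron_def mat_def intro!: prod_zero)
qed (simp add: kron_def mat_def)

definition elem_mats :: "(nat \<Rightarrow> 'n) \<Rightarrow> (nat \<Rightarrow> 'n) \<Rightarrow> nat \<Rightarrow> 'k::comm_ring_1 ^ 'n ^ 'n" where
  "elem_mats p q l = (\<chi> a b. if a = p l \<and> b = q l then 1 else 0)"

lemma kron_elem_mats:
  assumes "a \<in> tuples m" "b \<in> tuples m" "p \<in> tuples m" "q \<in> tuples m"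
  shows "kron m (elem_mats p q) a b = (if a = p \<and> b = q then 1 else (0 :: 'k::comm_ring_1))"
proof (cases "a = p \<and> b = q")
  case False
  then have "\<exists>l<m. \<not> (a l = p l \<and> b l = q l)"
    using tuples_eqI[OF assms(1,3)] tuples_eqI[OF assms(2,4)] by blast
  then show ?thesis using False by (auto simp: kron_def elem_mats_def intro!: prod_zero)
qed (simp add: kron_def elem_mats_def)

lemma sum_rotate:
  "(\<Sum>i\<in>A. \<Sum>k\<in>B. \<Sum>s\<in>D. f i k s) = (\<Sum>s\<in>D. \<Sum>i\<in>A. \<Sum>k\<in>B. f i k s)"
proof -
  have "(\<Sum>i\<in>A. \<Sum>k\<in>B. \<Sum>s\<in>D. f i k s) = (\<Sum>i\<in>A. \<Sum>s\<in>D. \<Sum>k\<in>B. f i k s)"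
    by (rule sum.cong[OF refl]) (rule sum.swap)
  also have "\<dots> = (\<Sum>s\<in>D. \<Sum>i\<in>A. \<Sum>k\<in>B. f i k s)" by (rule sum.swap)
  finally show ?thesis .
qed

lemma sum_delta_tuples:
  fixes f :: "(nat \<Rightarrow> 'n::finite) \<Rightarrow> 'k::comm_ring_1"
  assumes "p \<in> tuples m"
  shows "(\<Sum>i\<in>tuples m. (if i = p then 1 else 0) * f i) = f p"
    "(\<Sum>i\<in>tuples m. f i * (if i = p then 1 else 0)) = f p"
    "(\<Sum>i\<in>tuples m. (if p = i then 1 else 0) * f i) = f p"
    "(\<Sum>i\<in>tuples m. f i * (if p = i then 1 else 0)) = f p"
  using assms by (simp_all add: if_distrib[of "\<lambda>x. x * _"] if_distrib[of "\<lambda>x. _ * x"] sum.delta sum.delta' cong: if_cong)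

section \<open>Polynomial functions on the line\<close>

definition polyfun :: "('k::field_char_0 \<Rightarrow> 'k) \<Rightarrow> bool" where
  "polyfun f \<longleftrightarrow> (\<exists>p. \<forall>s. f s = poly p s)"

lemma polyfun_const: "polyfun (\<lambda>_. c)"
  unfolding polyfun_def by (intro exI[of _ "[:c:]"]) simp

lemma polyfun_id: "polyfun (\<lambda>s. s)"
  unfolding polyfun_def by (intro exI[of _ "[:0, 1:]"]) simp

lemma polyfun_add: "polyfun f \<Longrightarrow> polyfun g \<Longrightarrow> polyfun (\<lambda>s. f s + g s)"
  unfolding polyfun_def by (metis poly_add)

lemma polyfun_diff: "polyfun f \<Longrightarrow> polyfun g \<Longrightarrow> polyfun (\<lambda>s. f s - g s)"
  unfolding polyfun_def by (metis poly_diff)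

lemma polyfun_mult: "polyfun f \<Longrightarrow> polyfun g \<Longrightarrow> polyfun (\<lambda>s. f s * g s)"
  unfolding polyfun_def by (metis poly_mult)

lemma polyfun_sum: "(\<And>x. x \<in> X \<Longrightarrow> polyfun (f x)) \<Longrightarrow> polyfun (\<lambda>s. \<Sum>x\<in>X. f x s)"
  by (induction X rule: infinite_finite_induct) (auto intro: polyfun_const polyfun_add)

lemma polyfun_prod: "(\<And>x. x \<in> X \<Longrightarrow> polyfun (f x)) \<Longrightarrow> polyfun (\<lambda>s. \<Prod>x\<in>X. f x s)"
  by (induction X rule: infinite_finite_induct) (auto intro: polyfun_const polyfun_mult)

text \<open>An identity that holds wherever \<open>h\<close> does not vanish holds everywhere: the
  field is infinite, so polynomials are determined by their values, and they have no zero
  divisors.\<close>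

lemma polyfun_eq_zero:
  assumes "polyfun f" "polyfun h" "\<And>s. f s * h s = 0" "h a \<noteq> 0"
  shows "f s = 0"
proof -
  obtain p q where p: "\<And>s. f s = poly p s" and q: "\<And>s. h s = poly q s"
    using assms(1,2) unfolding polyfun_def by blast
  have "poly (p * q) s = 0" for s using assms(3)[of s] p q by simp
  then have "p * q = 0" using poly_all_0_iff_0 by blast
  moreover have "q \<noteq> 0" using assms(4) q[of a] by auto
  ultimately show ?thesis using p by simp
qed

lemma sum_powers_zero:
  fixes v :: "nat \<Rightarrow> 'k::field_char_0"
  assumes "\<And>s. (\<Sum>a\<le>n. v a * s ^ a) = 0" "a \<le> n"
  shows "v a = 0"
proof -
  have "poly (\<Sum>a\<le>n. monom (v a) a) s = 0" for s
    using assms(1)[of s] by (simp add: poly_sum poly_monom)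
  then have "(\<Sum>a\<le>n. monom (v a) a) = 0" using poly_all_0_iff_0 by blast
  then have "coeff (\<Sum>a\<le>n. monom (v a) a) a = 0" by simp
  then show ?thesis using assms(2) by (simp add: coeff_sum sum.delta)
qed

section \<open>The double centralizer theorem for the symmetric group\<close>

definition perm_mat :: "nat \<Rightarrow> (nat \<Rightarrow> nat) \<Rightarrow> (nat \<Rightarrow> 'n) \<Rightarrow> (nat \<Rightarrow> 'n) \<Rightarrow> 'k::comm_ring_1" where
  "perm_mat m s i j = (if i \<in> tuples m \<and> j = i \<circ> s then 1 else 0)"

lemma tuples_comp_perm:
  assumes "s permutes {..<m}"
  shows "i \<circ> s \<in> tuples m \<longleftrightarrow> i \<in> tuples m"
proof -
  have 1: "i \<circ> s \<in> tuples m" if "i \<in> tuples m" "s permutes {..<m}" for i :: "nat \<Rightarrow> 'a" and s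
    using that by (auto simp: PiE_def extensional_def permutes_def)
  have "i = (i \<circ> s) \<circ> inv s"
    using assms by (auto simp: fun_eq_iff permutes_inverses)
  then show ?thesis using 1[OF _ assms] 1[OF _ permutes_inv[OF assms]] by metis
qed

lemma sum_fun_apply: "(\<Sum>x\<in>X. f x) i = (\<Sum>x\<in>X. f x i)"
  by (induction X rule: infinite_finite_induct) simp_all

text \<open>The map \<pi> commutes with left multiplication by permutations, takes values in the
  span \<open>A\<close> and multiplies the identity by the group order. As \<open>T\<close> commutes
  with the commutant, it passes through \<pi>: the group order times \<open>T\<close> is
  \<open>T\<close> times \<pi> of the identity, which is \<pi> of \<open>T\<close> and therefore
  lies in \<open>A\<close>.\<close>

theorem double_centralizer:
  fixes T :: "(nat \<Rightarrow> 'n::finite) \<Rightarrow> (nat \<Rightarrow> 'n) \<Rightarrow> 'k::field_char_0"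
  assumes comm: "\<And>c i j. (\<And>s i j. s permutes {..<m} \<Longrightarrow> c (i \<circ> s) (j \<circ> s) = c i j) \<Longrightarrow>
      i \<in> tuples m \<Longrightarrow> j \<in> tuples m \<Longrightarrow>
      (\<Sum>q\<in>tuples m. T i q * c q j) = (\<Sum>q\<in>tuples m. c i q * T q j)"
  shows "\<exists>d. \<forall>i\<in>tuples m. \<forall>j\<in>tuples m. T i j = (\<Sum>s | s permutes {..<m}. d s * perm_mat m s i j)"
proof -
  let ?S = "{s. s permutes {..<m}}"
  let ?I = "tuples m :: (nat \<Rightarrow> 'n) set"
  let ?scale = "\<lambda>c (M :: (nat \<Rightarrow> 'n) \<Rightarrow> (nat \<Rightarrow> 'n) \<Rightarrow> 'k) i j. c * M i j"
  define A where "A = range (\<lambda>d (i :: nat \<Rightarrow> 'n) j. \<Sum>s\<in>?S. d s * perm_mat m s i j :: 'k)"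
  define act where "act s M = (\<lambda>i j. M (i \<circ> s) j)"
    for s :: "nat \<Rightarrow> nat" and M :: "(nat \<Rightarrow> 'n) \<Rightarrow> (nat \<Rightarrow> 'n) \<Rightarrow> 'k"
  have finS: "finite ?S" by (simp add: finite_permutations)
  interpret V: vector_space ?scale
    by unfold_locales (auto simp: fun_eq_iff algebra_simps)
  interpret VV: vector_space_pair ?scale ?scale ..
  have subA: "V.subspace A"
    unfolding V.subspace_def
  proof (intro conjI ballI allI)
    show "0 \<in> A" unfolding A_def
      by (intro image_eqI[of _ _ "\<lambda>_. 0"]) (auto simp: fun_eq_iff)
  next
    fix M N assume "M \<in> A" "N \<in> A"
    then obtain d e where "M = (\<lambda>i j. \<Sum>s\<in>?S. d s * perm_mat m s i j)" "N = (\<lambda>i j. \<Sum>s\<in>?S. e s * perm_mat m s i j)"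
      unfolding A_def by blast
    then show "M + N \<in> A" unfolding A_def
      by (intro image_eqI[of _ _ "\<lambda>s. d s + e s"]) (auto simp: fun_eq_iff sum.distrib algebra_simps)
  next
    fix c M assume "M \<in> A"
    then obtain d where "M = (\<lambda>i j. \<Sum>s\<in>?S. d s * perm_mat m s i j)"
      unfolding A_def by blast
    then show "(\<lambda>i j. c * M i j) \<in> A" unfolding A_def
      by (intro image_eqI[of _ _ "\<lambda>s. c * d s"]) (auto simp: fun_eq_iff sum_distrib_left algebra_simps)
  qed
  have perm_A: "perm_mat m s \<in> A" if "s \<in> ?S" for s
  proof -
    have "(\<Sum>t\<in>?S. (if t = s then 1 else 0) * perm_mat m t i j) = (perm_mat m s i j :: 'k)" for i j :: "nat \<Rightarrow> 'n"
    proof -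
      have "(\<Sum>t\<in>?S. (if t = s then 1 else 0) * perm_mat m t i j) = (\<Sum>t\<in>?S. if t = s then perm_mat m t i j else (0 :: 'k))"
        by (intro sum.cong) auto
      then show ?thesis using that finS by (simp add: sum.delta)
    qed
    then show ?thesis unfolding A_def
      by (intro image_eqI[of _ _ "\<lambda>t. if t = s then 1 else 0"]) (auto simp: fun_eq_iff)
  qed
  have act_perm: "act s (perm_mat m t) = perm_mat m (s \<circ> t)" if "s \<in> ?S" for s t
    using that by (intro ext) (simp add: act_def perm_mat_def comp_assoc tuples_comp_perm[of s m] del: PiE_UNIV)
  have act_A: "act s M \<in> A" if s: "s \<in> ?S" and M: "M \<in> A" for s M
  proof -
    obtain d where "M = (\<lambda>i j. \<Sum>t\<in>?S. d t * perm_mat m t i j)"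
      using M unfolding A_def by blast
    then have "act s M = (\<Sum>t\<in>?S. ?scale (d t) (act s (perm_mat m t)))"
      by (simp add: act_def fun_eq_iff sum_fun_apply)
    also have "\<dots> \<in> A"
      using s by (intro V.subspace_sum[OF subA] V.subspace_scale[OF subA])
        (simp add: act_perm perm_A permutes_compose)
    finally show ?thesis .
  qed
  \<comment> \<open>A linear projection onto \<open>A\<close>, as a left inverse of the
    inclusion.\<close>
  obtain p where p: "range p \<subseteq> A" "Vector_Spaces.linear ?scale ?scale p" "\<And>M. M \<in> A \<Longrightarrow> p M = M"
    using VV.linear_exists_left_inverse_on[OF V.linear_id subA inj_on_id] by (auto simp: id_def)
  interpret p: Vector_Spaces.linear ?scale ?scale p by (rule p(2))
  \<comment> \<open>Maschke: averaging makes the projection onto \<open>A\<close> equivariant, so that the rows of the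
    matrix units under \<open>\<pi>\<close> lie in the commutant of the symmetric group.\<close>
  define \<pi> where "\<pi> M = (\<Sum>s\<in>?S. act s (p (act (inv s) M)))" for M
  define e where "e k l = (\<lambda>i j. if i = k \<and> j = l then 1 else (0 :: 'k))" for k l :: "nat \<Rightarrow> 'n"
  have act_comp: "act s (act t M) = act (s \<circ> t) M" for s t M
    by (simp add: act_def comp_assoc)
  have act_add: "act s (M + N) = act s M + act s N" for s M N
    by (simp add: act_def fun_eq_iff)
  have act_scale: "act s (?scale c M) = ?scale c (act s M)" for s c M
    by (simp add: act_def fun_eq_iff)
  have act_sum: "act s (sum f X) = (\<Sum>x\<in>X. act s (f x))" for s X and f :: "_ \<Rightarrow> _"
    by (induction X rule: infinite_finite_induct) (simp_all add: act_add, simp_all add: act_def fun_eq_iff)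
  have \<pi>_add: "\<pi> (M + N) = \<pi> M + \<pi> N" for M N
    unfolding \<pi>_def by (simp add: act_add p.add sum.distrib)
  have \<pi>_scale: "\<pi> (?scale c M) = ?scale c (\<pi> M)" for c M
    unfolding \<pi>_def act_scale p.scale V.scale_sum_right ..
  have \<pi>_0: "\<pi> 0 = 0" using \<pi>_add[of 0 0] by simp
  have \<pi>_sum: "\<pi> (sum f X) = (\<Sum>x\<in>X. \<pi> (f x))" for X and f :: "_ \<Rightarrow> _"
    by (induction X rule: infinite_finite_induct) (simp_all only: sum.infinite sum.empty sum.insert \<pi>_add \<pi>_0 not_False_eq_True)
  have \<pi>_A: "\<pi> M \<in> A" for M
    unfolding \<pi>_def using p(1) by (intro V.subspace_sum[OF subA] act_A) auto
  have \<pi>_act: "\<pi> (act t M) = act t (\<pi> M)" if t: "t \<in> ?S" for t M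
  proof -
    have "\<pi> (act t M) = (\<Sum>s\<in>?S. act (t \<circ> s) (p (act (inv (t \<circ> s)) (act t M))))"
      unfolding \<pi>_def using t by (intro setum_permutations_compose_left) simp
    also have "\<dots> = (\<Sum>s\<in>?S. act t (act s (p (act (inv s) M))))"
    proof (intro sum.cong refl)
      fix s assume s: "s \<in> ?S"
      have "inv (t \<circ> s) \<circ> t = inv s"
        using s t by (simp add: o_inv_distrib permutes_bij comp_assoc permutes_inv_o)
      then show "act (t \<circ> s) (p (act (inv (t \<circ> s)) (act t M))) = act t (act s (p (act (inv s) M)))"
        by (simp add: act_comp)
    qed
    finally show ?thesis by (simp add: \<pi>_def act_sum)
  qed
  have \<pi>_id: "\<pi> (perm_mat m id) = ?scale (of_nat (card ?S)) (perm_mat m id)"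
  proof -
    have "act s (p (act (inv s) (perm_mat m id))) = perm_mat m id" if "s \<in> ?S" for s
      using that by (simp add: act_perm permutes_inv p(3) perm_A permutes_inv_o)
    then show ?thesis by (simp add: \<pi>_def fun_eq_iff sum_fun_apply)
  qed
  have e_act: "act s (e (k \<circ> s) l) = e k l" if "s \<in> ?S" for s k l
  proof -
    have "i \<circ> s = k \<circ> s \<longleftrightarrow> i = k" for i
      using that permutes_surj[of s] by (metis fun.map_comp comp_id mem_Collect_eq permutes_inv_o(1))
    then show ?thesis by (simp add: act_def e_def)
  qed
  have \<pi>_inv: "\<pi> (e (k \<circ> s) l) (i \<circ> s) j = \<pi> (e k l) i j" if "s \<in> ?S" for s k l i j
  proof -
    have "\<pi> (e k l) i j = act s (\<pi> (e (k \<circ> s) l)) i j"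
      using that by (simp add: \<pi>_act[symmetric] e_act)
    then show ?thesis by (simp add: act_def)
  qed
  \<comment> \<open>Only the values of \<open>T\<close> on tuples matter; this is the restriction to
    them, written in matrix units so that linearity of \<pi> applies.\<close>
  define T' where "T' = (\<Sum>r\<in>?I. \<Sum>k\<in>?I. ?scale (T r k) (e r k))"
  have one: "perm_mat m id = (\<Sum>k\<in>?I. e k k)"
  proof (intro ext)
    fix i j :: "nat \<Rightarrow> 'n"
    have "(\<Sum>k\<in>?I. e k k i j) = (\<Sum>k\<in>?I. if i = k then (if j = i then 1 else 0) else 0)"
      by (intro sum.cong) (auto simp: e_def)
    then show "perm_mat m id i j = (\<Sum>k\<in>?I. e k k) i j"
      by (simp add: sum_fun_apply perm_mat_def)
  qed
  have key: "of_nat (card ?S) * T i j = \<pi> T' i j" if ij: "i \<in> ?I" "j \<in> ?I" for i j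
  proof -
    have "of_nat (card ?S) * T i j = (\<Sum>r\<in>?I. T i r * \<pi> (perm_mat m id) r j)"
    proof -
      have "(\<Sum>r\<in>?I. T i r * \<pi> (perm_mat m id) r j)
        = (\<Sum>r\<in>?I. of_nat (card ?S) * T i r * (if r = j then 1 else 0))"
        unfolding \<pi>_id by (intro sum.cong refl) (auto simp: perm_mat_def)
      then show ?thesis using ij by (simp add: sum_delta_tuples)
    qed
    also have "\<dots> = (\<Sum>k\<in>?I. \<Sum>r\<in>?I. T i r * \<pi> (e k k) r j)"
      by (subst sum.swap) (simp add: one \<pi>_sum sum_fun_apply sum_distrib_left)
    also have "\<dots> = (\<Sum>k\<in>?I. \<Sum>r\<in>?I. \<pi> (e r k) i j * T r k)"
    proof (rule sum.cong[OF refl])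
      fix k assume k: "k \<in> ?I"
      show "(\<Sum>r\<in>?I. T i r * \<pi> (e k k) r j) = (\<Sum>r\<in>?I. \<pi> (e r k) i j * T r k)"
        by (rule comm[of "\<lambda>a b. \<pi> (e b k) a j" i k]) (use \<pi>_inv ij k in simp_all)
    qed
    also have "\<dots> = \<pi> T' i j"
      unfolding T'_def by (subst sum.swap) (simp add: \<pi>_sum \<pi>_scale sum_fun_apply mult.commute)
    finally show ?thesis .
  qed
  obtain d where d: "\<pi> T' = (\<lambda>i j. \<Sum>s\<in>?S. d s * perm_mat m s i j)"
    using \<pi>_A[of T'] unfolding A_def by blast
  have "card ?S \<noteq> 0" using finS by (auto simp: permutes_id intro!: exI[of _ id])
  then have "\<forall>i\<in>?I. \<forall>j\<in>?I. T i j = (\<Sum>s\<in>?S. (d s / of_nat (card ?S)) * perm_mat m s i j)"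
    using key unfolding d by (simp add: sum_divide_distrib[symmetric] field_simps)
  then show ?thesis by (rule exI[of _ "\<lambda>s. d s / of_nat (card ?S)"])
qed

section \<open>Conjugation invariants as combinations of permutations\<close>

lemma mult_matrix_inv:
  assumes "invertible (g :: 'k::comm_ring_1 ^ 'n ^ 'n)"
  shows "g ** matrix_inv g = mat 1"
  unfolding matrix_inv_def using assms[unfolded invertible_def]
  by (rule someI2_ex) blast

lemma multilin_perm_mat:
  "multilin m (perm_mat m s) Z = contr {..<m} Z s" if "s permutes {..<m}"
proof -
  have "(\<Sum>j\<in>tuples m. perm_mat m s i j * kron m Z i j) = kron m Z i (i \<circ> s)" if "i \<in> tuples m" for i
  proof -
    have "i \<circ> s \<in> tuples m" using that \<open>s permutes {..<m}\<close> by (simp only: tuples_comp_perm)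
    moreover have "(\<Sum>j\<in>tuples m. perm_mat m s i j * kron m Z i j)
        = (\<Sum>j\<in>tuples m. (if j = i \<circ> s then 1 else 0) * kron m Z i j)"
      using that by (intro sum.cong) (auto simp: perm_mat_def)
    ultimately show ?thesis by (simp only: sum_delta_tuples)
  qed
  then show ?thesis
    by (simp add: multilin_def contr_def kron_def)
qed

text \<open>Both sides are polynomial in the entries of \<open>g\<close>, and the invertible
  matrices are Zariski dense, so the identity passes from them to \<open>A\<close>.\<close>

lemma commutes_with_all:
  fixes T :: "(nat \<Rightarrow> 'n::finite) \<Rightarrow> (nat \<Rightarrow> 'n) \<Rightarrow> 'k::field_char_0" and A :: "'k ^ 'n ^ 'n"
  assumes inv: "\<And>g :: 'k ^ 'n ^ 'n. invertible g \<Longrightarrow>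
      (\<Sum>q\<in>tuples m. T p q * kron m (\<lambda>_. g) r q) = (\<Sum>i\<in>tuples m. kron m (\<lambda>_. g) i p * T i r)"
  shows "(\<Sum>q\<in>tuples m. T p q * kron m (\<lambda>_. A) r q) = (\<Sum>i\<in>tuples m. kron m (\<lambda>_. A) i p * T i r)"
proof -
  define D where "D g = (\<Sum>q\<in>tuples m. T p q * kron m (\<lambda>_. g) r q) - (\<Sum>i\<in>tuples m. kron m (\<lambda>_. g) i p * T i r)"
    for g :: "'k ^ 'n ^ 'n"
  define L where "L a b = (\<chi> i j. a * (mat 1 :: 'k ^ 'n ^ 'n) $ i $ j + b * A $ i $ j)" for a b :: 'k
  have poly_D: "polyfun (\<lambda>s. D (L (f s) (h s)))" if "polyfun f" "polyfun h" for f h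
    unfolding D_def kron_def L_def using that
    by (auto intro!: polyfun_diff polyfun_sum polyfun_mult polyfun_prod polyfun_add polyfun_const)
  have poly_det: "polyfun (\<lambda>s. det (L (f s) (h s)))" if "polyfun f" "polyfun h" for f h
    unfolding det_def L_def using that
    by (auto intro!: polyfun_sum polyfun_mult polyfun_prod polyfun_add polyfun_const)
  have L10: "L 1 0 = mat 1" by (simp add: L_def vec_eq_iff)
  \<comment> \<open>\<open>1 + s A\<close> is invertible for all but finitely many \<open>s\<close>; the leading coefficient in \<open>s\<close>,
    reached below through \<open>t = 1 / s\<close>, is the claim for \<open>A\<close>.\<close>
  have 1: "D (L 1 s) = 0" for s
  proof (rule polyfun_eq_zero[of "\<lambda>s. D (L 1 s)" "\<lambda>s. det (L 1 s)" 0])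
    show "D (L 1 s) * det (L 1 s) = 0" for s
      using inv[of "L 1 s"] by (auto simp: D_def invertible_det_nz)
    show "det (L 1 0) \<noteq> 0" by (simp add: L10)
  qed (intro poly_D poly_det polyfun_const polyfun_id)+
  have "D (L t 1) * t = 0" for t
  proof (cases "t = 0")
    case False
    have "kron m (\<lambda>_. L t 1) i j = t ^ m * kron m (\<lambda>_. L 1 (1 / t)) i j" for i j
    proof -
      have "L t 1 $ a $ b = t * L 1 (1 / t) $ a $ b" for a b
        using False by (simp add: L_def field_simps)
      then show ?thesis by (simp add: kron_def prod.distrib)
    qed
    then have "D (L t 1) = t ^ m * D (L 1 (1 / t))"
      by (simp add: D_def sum_distrib_left right_diff_distrib ac_simps)
    then show ?thesis by (simp add: 1)
  qed simp
  then have "D (L 0 1) = 0"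
    by (intro polyfun_eq_zero[of "\<lambda>t. D (L t 1)" "\<lambda>t. t" 1] poly_D polyfun_const polyfun_id) auto
  moreover have "L 0 1 = A" by (simp add: L_def vec_eq_iff)
  ultimately show ?thesis by (simp add: D_def)
qed

text \<open>Testing invariance on matrix units shows that \<open>T\<close> commutes, up to a
  transpose, with the tensor powers of invertible matrices, hence of all matrices. Polarized tensor
  powers span the matrices that are invariant under the symmetric group, so \<open>T\<close> lies in
  the double centralizer.\<close>

theorem multilinear_invariants:
  fixes T :: "(nat \<Rightarrow> 'n::finite) \<Rightarrow> (nat \<Rightarrow> 'n) \<Rightarrow> 'k::field_char_0"
  assumes inv: "\<And>g Z :: nat \<Rightarrow> 'k ^ 'n ^ 'n. invertible g \<Longrightarrow>
      multilin m T (\<lambda>l. g ** Z l ** matrix_inv g) = multilin m T Z"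
  shows "\<exists>d. \<forall>Z. multilin m T Z = (\<Sum>s | s permutes {..<m}. d s * contr {..<m} Z s)"
proof -
  let ?I = "tuples m :: (nat \<Rightarrow> 'n) set"
  let ?S = "{s. s permutes {..<m}}"
  define K where "K g = kron m (\<lambda>_. g)" for g :: "'k ^ 'n ^ 'n"
  have conj: "(\<Sum>i\<in>?I. \<Sum>j\<in>?I. T i j * (K g i p * K (matrix_inv g) q j)) = T p q"
    if g: "invertible g" and pq: "p \<in> ?I" "q \<in> ?I" for g p q
  proof -
    have kron_E: "kron m (elem_mats p q) a b = (if a = p then 1 else 0) * (if b = q then 1 else (0 :: 'k))"
      if "a \<in> ?I" "b \<in> ?I" for a b
      using that pq by (simp add: kron_elem_mats)
    have "kron m (\<lambda>l. g ** elem_mats p q l ** matrix_inv g) i j = K g i p * K (matrix_inv g) q j"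
      if "i \<in> ?I" "j \<in> ?I" for i j
    proof -
      have "kron m (\<lambda>l. g ** elem_mats p q l) i b = K g i p * (if b = q then 1 else 0)" if "b \<in> ?I" for b
      proof -
        have "kron m (\<lambda>l. g ** elem_mats p q l) i b
            = (\<Sum>a\<in>?I. K g i a * ((if a = p then 1 else 0) * (if b = q then 1 else 0)))"
          unfolding kron_mult K_def by (intro sum.cong refl) (simp only: kron_E[OF _ that])
        also have "\<dots> = (\<Sum>a\<in>?I. (K g i a * (if b = q then 1 else 0)) * (if a = p then 1 else 0))"
          by (intro sum.cong refl) simp
        finally show ?thesis using pq by (simp only: sum_delta_tuples)
      qed
      then have "kron m (\<lambda>l. g ** elem_mats p q l ** matrix_inv g) i j
          = (\<Sum>b\<in>?I. (K g i p * K (matrix_inv g) b j) * (if b = q then 1 else 0))"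
        unfolding kron_mult[of _ "\<lambda>l. g ** elem_mats p q l"] K_def by (intro sum.cong refl) simp
      then show ?thesis using pq by (simp only: sum_delta_tuples)
    qed
    then have "(\<Sum>i\<in>?I. \<Sum>j\<in>?I. T i j * (K g i p * K (matrix_inv g) q j))
        = multilin m T (\<lambda>l. g ** elem_mats p q l ** matrix_inv g)"
      unfolding multilin_def by (intro sum.cong refl) simp
    also have "\<dots> = multilin m T (elem_mats p q)" by (rule inv[OF g])
    also have "\<dots> = (\<Sum>i\<in>?I. \<Sum>j\<in>?I. (T i j * (if i = p then 1 else 0)) * (if j = q then 1 else 0))"
      unfolding multilin_def by (intro sum.cong refl) (simp only: kron_E mult.assoc)
    also have "\<dots> = T p q" using pq by (simp only: sum_delta_tuples)
    finally show ?thesis .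
  qed
  have comm_K: "(\<Sum>q\<in>?I. T p q * K A r q) = (\<Sum>i\<in>?I. K A i p * T i r)"
    if pr: "p \<in> ?I" "r \<in> ?I" for A p r
    unfolding K_def
  proof (rule commutes_with_all)
    fix g :: "'k ^ 'n ^ 'n" assume g: "invertible g"
    have unit: "(\<Sum>q\<in>?I. K (g) r q * K (matrix_inv g) q j) = (if j = r then 1 else 0)" if "j \<in> ?I" for j
      unfolding K_def kron_mult[symmetric] using that pr g
      by (auto simp: kron_delta mult_matrix_inv)
    have "(\<Sum>q\<in>?I. T p q * K g r q)
        = (\<Sum>q\<in>?I. \<Sum>i\<in>?I. \<Sum>j\<in>?I. T i j * K g i p * (K g r q * K (matrix_inv g) q j))"
      by (intro sum.cong refl, subst conj[OF g pr(1), symmetric]) (simp_all add: sum_distrib_left sum_distrib_right ac_simps)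
    also have "\<dots> = (\<Sum>i\<in>?I. \<Sum>j\<in>?I. T i j * K g i p * (\<Sum>q\<in>?I. K g r q * K (matrix_inv g) q j))"
      by (subst sum.swap, rule sum.cong[OF refl], subst sum.swap) (simp add: sum_distrib_left)
    also have "\<dots> = (\<Sum>i\<in>?I. \<Sum>j\<in>?I. T i j * K g i p * (if j = r then 1 else 0))"
      by (intro sum.cong refl) (simp only: unit)
    also have "\<dots> = (\<Sum>i\<in>?I. K g i p * T i r)"
      using pr by (simp only: sum_delta_tuples mult.commute[of _ "K g _ p"])
    finally show "(\<Sum>q\<in>?I. T p q * kron m (\<lambda>_. g) r q) = (\<Sum>i\<in>?I. kron m (\<lambda>_. g) i p * T i r)"
      by (simp add: K_def)
  qed
  \<comment> \<open>The sum of the tensor products of the \<open>Z l\<close> over all orders.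
    Polarization writes it through tensor powers of single matrices, with which \<open>T\<close> is
    already known to commute.\<close>
  define C where "C Z a b = (\<Sum>s\<in>?S. kron m (\<lambda>l. Z (s l)) a b)" for Z :: "nat \<Rightarrow> 'k ^ 'n ^ 'n" and a b
  have C_eq: "C Z a b = (\<Sum>S\<in>Pow {..<m}. (- 1) ^ (m - card S) * K (\<Sum>k\<in>S. Z k) a b)" for Z a b
    using kron_polarization[where c = "\<lambda>_. ()" and Z = Z and i = a and j = b and m = m] by (simp add: C_def K_def)
  have comm_C: "(\<Sum>q\<in>?I. T p q * C Z r q) = (\<Sum>i\<in>?I. C Z i p * T i r)"
    if pr: "p \<in> ?I" "r \<in> ?I" for Z p r
  proof -
    have "(\<Sum>q\<in>?I. T p q * C Z r q)
        = (\<Sum>S\<in>Pow {..<m}. (- 1) ^ (m - card S) * (\<Sum>q\<in>?I. T p q * K (\<Sum>k\<in>S. Z k) r q))"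
      unfolding C_eq sum_distrib_left by (subst sum.swap) (simp add: ac_simps)
    also have "\<dots> = (\<Sum>S\<in>Pow {..<m}. (- 1) ^ (m - card S) * (\<Sum>i\<in>?I. K (\<Sum>k\<in>S. Z k) i p * T i r))"
      by (simp only: comm_K[OF pr])
    also have "\<dots> = (\<Sum>i\<in>?I. C Z i p * T i r)"
      unfolding C_eq sum_distrib_left sum_distrib_right by (subst sum.swap) (simp add: ac_simps)
    finally show ?thesis .
  qed
  \<comment> \<open>An invariant matrix is, up to the group order and a transpose, the combination
    of symmetrized matrix units with its own entries as coefficients. The transpose matches the
    index order in \<open>comm_C\<close>.\<close>
  have C_elem: "(\<Sum>i\<in>?I. \<Sum>k\<in>?I. c k i * C (elem_mats i k) a b) = of_nat (card ?S) * c b a"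
    if c: "\<And>s i j. s permutes {..<m} \<Longrightarrow> c (i \<circ> s) (j \<circ> s) = c i j" and ab: "a \<in> ?I" "b \<in> ?I"
    for c :: "_ \<Rightarrow> _ \<Rightarrow> 'k" and a b
  proof -
    have "(\<Sum>i\<in>?I. \<Sum>k\<in>?I. c k i * kron m (\<lambda>l. elem_mats i k (s l)) a b) = c b a" if s: "s \<in> ?S" for s
    proof -
      have s': "s permutes {..<m}" "inv s permutes {..<m}" using s permutes_inv by auto
      have ab': "a \<circ> inv s \<in> ?I" "b \<circ> inv s \<in> ?I"
        using ab by (simp_all only: tuples_comp_perm[OF s'(2)])
      have eq: "x = i \<circ> s \<longleftrightarrow> i = x \<circ> inv s" for x i :: "nat \<Rightarrow> 'n"
        using s' by (auto simp: fun_eq_iff permutes_inverses) 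
      have "kron m (\<lambda>l. elem_mats i k (s l)) a b = (if i = a \<circ> inv s then 1 else 0) * (if k = b \<circ> inv s then 1 else (0 :: 'k))"
        if ik: "i \<in> ?I" "k \<in> ?I" for i k
      proof -
        have "i \<circ> s \<in> ?I" "k \<circ> s \<in> ?I"
          using ik by (simp_all only: tuples_comp_perm[OF s'(1)])
        moreover have "(\<lambda>l. elem_mats i k (s l) :: 'k ^ 'n ^ 'n) = elem_mats (i \<circ> s) (k \<circ> s)"
          by (simp add: elem_mats_def fun_eq_iff)
        ultimately have "kron m (\<lambda>l. elem_mats i k (s l)) a b = (if a = i \<circ> s \<and> b = k \<circ> s then 1 else (0 :: 'k))"
          using ab by (simp only: kron_elem_mats)
        then show ?thesis by (simp only: eq) simp
      qed
      then have "(\<Sum>i\<in>?I. \<Sum>k\<in>?I. c k i * kron m (\<lambda>l. elem_mats i k (s l)) a b)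
        = (\<Sum>i\<in>?I. \<Sum>k\<in>?I. (c k i * (if i = a \<circ> inv s then 1 else 0)) * (if k = b \<circ> inv s then 1 else 0))"
        by (intro sum.cong refl) (simp only: mult.assoc)
      also have "\<dots> = c (b \<circ> inv s) (a \<circ> inv s)"
        using ab' by (simp only: sum_delta_tuples)
      finally show ?thesis using c[OF s'(2)] by simp
    qed
    then have "(\<Sum>s\<in>?S. \<Sum>i\<in>?I. \<Sum>k\<in>?I. c k i * kron m (\<lambda>l. elem_mats i k (s l)) a b) = of_nat (card ?S) * c b a"
      by simp
    then show ?thesis
      unfolding C_def sum_distrib_left sum_rotate[of _ ?S] .
  qed
  have "card ?S \<noteq> 0" by (auto simp: finite_permutations permutes_id intro!: exI[of _ id])
  then have N: "of_nat (card ?S) \<noteq> (0 :: 'k)" by simp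
  have "\<exists>d. \<forall>i\<in>?I. \<forall>j\<in>?I. T i j = (\<Sum>s\<in>?S. d s * perm_mat m s i j)"
  proof (rule double_centralizer)
    fix c :: "(nat \<Rightarrow> 'n) \<Rightarrow> (nat \<Rightarrow> 'n) \<Rightarrow> 'k" and p r
    assume c: "\<And>s i j. s permutes {..<m} \<Longrightarrow> c (i \<circ> s) (j \<circ> s) = c i j" and pr: "p \<in> ?I" "r \<in> ?I"
    let ?N = "of_nat (card ?S) :: 'k"
    have C_c: "(\<Sum>i\<in>?I. \<Sum>k\<in>?I. c k i * C (elem_mats i k) a b) = of_nat (card ?S) * c b a"
      if "a \<in> ?I" "b \<in> ?I" for a b
      by (rule C_elem) (fact c that)+
    have "?N * (\<Sum>q\<in>?I. T p q * c q r) = (\<Sum>q\<in>?I. T p q * (\<Sum>i\<in>?I. \<Sum>k\<in>?I. c k i * C (elem_mats i k) r q))"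
      unfolding sum_distrib_left[of ?N] by (intro sum.cong refl) (simp add: C_c[OF pr(2)] ac_simps)
    also have "\<dots> = (\<Sum>i\<in>?I. \<Sum>k\<in>?I. c k i * (\<Sum>q\<in>?I. T p q * C (elem_mats i k) r q))"
      unfolding sum_distrib_left
      by (subst sum.swap, rule sum.cong[OF refl], subst sum.swap) (simp add: ac_simps)
    also have "\<dots> = (\<Sum>i\<in>?I. \<Sum>k\<in>?I. c k i * (\<Sum>q\<in>?I. C (elem_mats i k) q p * T q r))"
      by (simp only: comm_C[OF pr])
    also have "\<dots> = (\<Sum>q\<in>?I. (\<Sum>i\<in>?I. \<Sum>k\<in>?I. c k i * C (elem_mats i k) q p) * T q r)"
      unfolding sum_distrib_left sum_distrib_right
      by (subst (2) sum.swap, rule sum.cong[OF refl], subst sum.swap) (simp add: ac_simps)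
    also have "\<dots> = ?N * (\<Sum>q\<in>?I. c p q * T q r)"
      unfolding sum_distrib_left[of ?N] by (intro sum.cong refl) (simp add: C_c[OF _ pr(1)] ac_simps)
    finally show "(\<Sum>q\<in>?I. T p q * c q r) = (\<Sum>q\<in>?I. c p q * T q r)"
      using N by simp
  qed
  then obtain d where d: "\<And>i j. i \<in> ?I \<Longrightarrow> j \<in> ?I \<Longrightarrow> T i j = (\<Sum>s\<in>?S. d s * perm_mat m s i j)"
    by (elim exE) blast
  have "multilin m T Z = (\<Sum>s\<in>?S. d s * contr {..<m} Z s)" for Z
  proof -
    have "multilin m T Z = (\<Sum>i\<in>?I. \<Sum>j\<in>?I. \<Sum>s\<in>?S. d s * (perm_mat m s i j * kron m Z i j))"
      unfolding multilin_def by (intro sum.cong refl) (simp add: d sum_distrib_right mult.assoc)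
    also have "\<dots> = (\<Sum>s\<in>?S. d s * multilin m (perm_mat m s) Z)"
      unfolding multilin_def sum_distrib_left
      by (rule sum_rotate)
    finally show ?thesis by (simp add: multilin_perm_mat)
  qed
  then show ?thesis by (intro exI allI)
qed

section \<open>Invariants of two matrices\<close>

lemma generated_algebra_mono: "f \<in> generated_algebra S \<Longrightarrow> S \<subseteq> generated_algebra T \<Longrightarrow> f \<in> generated_algebra T"
  by (induction rule: generated_algebra.induct) (auto intro: generated_algebra.intros)

lemma generated_algebra_scale:
  "f \<in> generated_algebra S \<Longrightarrow> (\<lambda>p. c * f p) \<in> generated_algebra S"
  using generated_algebra.mult[OF generated_algebra.const, of f S c] by (simp add: times_fun_def)

lemma generated_algebra_uminus: "f \<in> generated_algebra S \<Longrightarrow> - f \<in> generated_algebra S"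
  using generated_algebra_scale[of f S "- 1"] by (simp add: fun_Compl_def)

lemma generated_algebra_diff:
  "f \<in> generated_algebra S \<Longrightarrow> g \<in> generated_algebra S \<Longrightarrow> f - g \<in> generated_algebra S"
  using generated_algebra.add[OF _ generated_algebra_uminus, of f S g] by simp

lemma generated_algebra_sum:
  "(\<And>x. x \<in> X \<Longrightarrow> f x \<in> generated_algebra S) \<Longrightarrow> (\<Sum>x\<in>X. f x) \<in> generated_algebra S"
  by (induction X rule: infinite_finite_induct)
    (auto intro: generated_algebra.add generated_algebra.const[of 0, folded zero_fun_def] simp del: zero_fun_apply)

lemma generated_algebra_prod_list:
  "(\<And>x. x \<in> set xs \<Longrightarrow> f x \<in> generated_algebra S) \<Longrightarrow> (\<lambda>p. \<Prod>x\<leftarrow>xs. f x p) \<in> generated_algebra S"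
proof (induction xs)
  case Nil
  then show ?case using generated_algebra.const[of 1 S] by simp
next
  case (Cons x xs)
  then have "f x * (\<lambda>p. \<Prod>x\<leftarrow>xs. f x p) \<in> generated_algebra S"
    by (auto intro: generated_algebra.mult)
  then show ?case by (simp add: times_fun_def)
qed

text \<open>Used twice: for monomials in the coordinate functions and for products of word traces.
  The list \<open>prd cs\<close> in the multiplicative step is the product of two such combinations,
  multiplied out.\<close>

lemma generated_algebra_products:
  fixes f :: "'p \<Rightarrow> 'k::comm_ring_1"
  assumes "f \<in> generated_algebra (g ` (W :: 'w set))"
  shows "\<exists>cs. (\<forall>(c, ws)\<in>set cs. set ws \<subseteq> W) \<and> f = (\<lambda>p. \<Sum>(c, ws)\<leftarrow>cs. c * (\<Prod>w\<leftarrow>ws. g w p))"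
  using assms
proof (induction rule: generated_algebra.induct)
  case (base f)
  then obtain w where "w \<in> W" "f = g w" by auto
  then show ?case by (intro exI[of _ "[(1, [w])]"]) simp
next
  case (const c)
  then show ?case by (intro exI[of _ "[(c, [])]"]) simp
next
  case (add f h)
  then obtain cs ds where "\<forall>(c, ws)\<in>set cs. set ws \<subseteq> W" "f = (\<lambda>p. \<Sum>(c, ws)\<leftarrow>cs. c * (\<Prod>w\<leftarrow>ws. g w p))"
    "\<forall>(c, ws)\<in>set ds. set ws \<subseteq> W" "h = (\<lambda>p. \<Sum>(c, ws)\<leftarrow>ds. c * (\<Prod>w\<leftarrow>ws. g w p))"
    by (elim exE conjE)
  then show ?case by (intro exI[of _ "cs @ ds"]) (auto simp: fun_eq_iff)
next
  case (mult f h)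
  then obtain cs ds where cs: "\<forall>(c, ws)\<in>set cs. set ws \<subseteq> W" "f = (\<lambda>p. \<Sum>(c, ws)\<leftarrow>cs. c * (\<Prod>w\<leftarrow>ws. g w p))"
    and ds: "\<forall>(c, ws)\<in>set ds. set ws \<subseteq> W" "h = (\<lambda>p. \<Sum>(c, ws)\<leftarrow>ds. c * (\<Prod>w\<leftarrow>ws. g w p))"
    by (elim exE conjE)
  define prd where "prd = (\<lambda>cs. concat (map (\<lambda>(c, ws). map (\<lambda>(d, vs). (c * d, ws @ vs)) ds) cs))"
  have "(\<Sum>(c, ws)\<leftarrow>prd cs'. c * (\<Prod>w\<leftarrow>ws. g w p))
      = (\<Sum>(c, ws)\<leftarrow>cs'. c * (\<Prod>w\<leftarrow>ws. g w p)) * h p" for cs' p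
  proof -
    have *: "(\<Sum>(c, ws)\<leftarrow>map (\<lambda>(d, vs). (c * d, ws @ vs)) ds'. c * (\<Prod>w\<leftarrow>ws. g w p))
        = c * (\<Prod>w\<leftarrow>ws. g w p) * (\<Sum>(c, ws)\<leftarrow>ds'. c * (\<Prod>w\<leftarrow>ws. g w p))"
      for c ws and ds' :: "('k \<times> 'w list) list"
      by (induction ds') (auto simp: algebra_simps)
    show ?thesis
      unfolding prd_def ds(2)
    proof (induction cs')
      case (Cons e cs')
      obtain c ws where e: "e = (c, ws)" by (cases e)
      show ?case using Cons *[of c ws ds] by (simp add: e distrib_right del: map_map)
    qed simp
  qed
  then have "f * h = (\<lambda>p. \<Sum>(c, ws)\<leftarrow>prd cs. c * (\<Prod>w\<leftarrow>ws. g w p))"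
    by (simp add: times_fun_def cs(2))
  moreover have "\<forall>(c, ws)\<in>set (prd cs). set ws \<subseteq> W"
    using cs(1) ds(1) by (fastforce simp: prd_def)
  ultimately show ?case by (intro exI[of _ "prd cs"] conjI)
qed

section \<open>Bihomogeneous components\<close>

lemma sum_list_bigraded:
  fixes v :: "'e \<Rightarrow> 'k::comm_ring_1"
  assumes "\<And>e. e \<in> set es \<Longrightarrow> A e \<le> n \<and> B e \<le> n"
  shows "(\<Sum>e\<leftarrow>es. v e * t ^ B e * s ^ A e)
    = (\<Sum>i\<le>n. (\<Sum>j\<le>n. (\<Sum>e\<leftarrow>es. if A e = i \<and> B e = j then v e else 0) * t ^ j) * s ^ i)"
  using assms
proof (induction es)
  case (Cons e es)
  have AB: "A e \<le> n" "B e \<le> n" using Cons.prems by auto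
  have "v e * t ^ B e * s ^ A e = (\<Sum>i\<le>n. if i = A e then v e * t ^ B e * s ^ i else 0)"
    using AB by simp
  also have "\<dots> = (\<Sum>i\<le>n. (\<Sum>j\<le>n. (if A e = i \<and> B e = j then v e else 0) * t ^ j) * s ^ i)"
  proof (intro sum.cong refl)
    fix i
    have "(\<Sum>j\<le>n. (if A e = i \<and> B e = j then v e else 0) * t ^ j)
      = (\<Sum>j\<le>n. if j = B e then (if A e = i then v e * t ^ j else 0) else 0)"
      by (intro sum.cong) auto
    then show "(if i = A e then v e * t ^ B e * s ^ i else 0)
      = (\<Sum>j\<le>n. (if A e = i \<and> B e = j then v e else 0) * t ^ j) * s ^ i"
      using AB by simp
  qed
  finally have "v e * t ^ B e * s ^ A e
      = (\<Sum>i\<le>n. (\<Sum>j\<le>n. (if A e = i \<and> B e = j then v e else 0) * t ^ j) * s ^ i)" .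
  moreover have "(\<Sum>e\<leftarrow>es. v e * t ^ B e * s ^ A e)
      = (\<Sum>i\<le>n. (\<Sum>j\<le>n. (\<Sum>e\<leftarrow>es. if A e = i \<and> B e = j then v e else 0) * t ^ j) * s ^ i)"
    by (rule Cons.IH) (use Cons.prems in auto)
  ultimately show ?case
    by (simp add: distrib_right sum.distrib)
qed simp

datatype letter = X | Y

fun letter_mat :: "letter \<Rightarrow> 'k mat4 \<times> 'k mat4 \<Rightarrow> 'k mat4" where
  "letter_mat X p = fst p"
| "letter_mat Y p = snd p"

definition word_trace :: "letter list \<Rightarrow> 'k::comm_ring_1 mat4 \<times> 'k mat4 \<Rightarrow> 'k" where
  "word_trace w p = trace (matprod (map (\<lambda>l. letter_mat l p) w))"

definition monom_fun :: "(letter \<times> 4 \<times> 4) list \<Rightarrow> 'k::comm_ring_1 mat4 \<times> 'k mat4 \<Rightarrow> 'k" where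
  "monom_fun ms p = (\<Prod>(l, i, j)\<leftarrow>ms. letter_mat l p $ i $ j)"

text \<open>Attached to an expression rather than to a function; its invariance is obtained by
  scaling the two matrices separately and comparing coefficients.\<close>

definition bidegree_part :: "('k \<times> (letter \<times> 4 \<times> 4) list) list \<Rightarrow> nat \<Rightarrow> nat \<Rightarrow> 'k::comm_ring_1 mat4 \<times> 'k mat4 \<Rightarrow> 'k" where
  "bidegree_part cs a b p = (\<Sum>(c, ms)\<leftarrow>cs.
     if count_list (map fst ms) X = a \<and> count_list (map fst ms) Y = b then c * monom_fun ms p else 0)"

lemma polynomial_functions_monomials:
  fixes f :: "'k::field_char_0 mat4 \<times> 'k mat4 \<Rightarrow> 'k"
  assumes "f \<in> polynomial_functions"
  shows "\<exists>cs. \<forall>p. f p = (\<Sum>(c, ms)\<leftarrow>cs. c * monom_fun ms p)"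
proof -
  let ?g = "\<lambda>m (p :: 'k mat4 \<times> 'k mat4). letter_mat (fst m) p $ fst (snd m) $ snd (snd m)"
  have gens: "{generic_x $ i $ j |i j. True} \<union> {generic_y $ i $ j |i j. True} \<subseteq> range ?g"
  proof -
    have "generic_x $ i $ j = ?g (X, i, j)" "generic_y $ i $ j = ?g (Y, i, j)" for i j
      by (simp_all add: generic_x_def generic_y_def)
    then show ?thesis by blast
  qed
  have "range ?g \<subseteq> generated_algebra (range ?g)"
    by (rule subsetI) (rule generated_algebra.base)
  then have "f \<in> generated_algebra (range ?g)"
    by (intro generated_algebra_mono[OF assms[unfolded polynomial_functions_def]] subset_trans[OF gens])
  then obtain cs where "f = (\<lambda>p. \<Sum>(c, ms)\<leftarrow>cs. c * (\<Prod>m\<leftarrow>ms. ?g m p))"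
    using generated_algebra_products by blast
  then show ?thesis by (intro exI[of _ cs]) (simp add: monom_fun_def case_prod_unfold)
qed

definition scale_mat :: "'k::comm_ring_1 \<Rightarrow> 'k mat4 \<Rightarrow> 'k mat4" where
  "scale_mat c A = (\<chi> i j. c * A $ i $ j)"

lemma scale_mat_conj: "scale_mat c (a ** A ** b) = a ** scale_mat c A ** b"
  by (simp add: scale_mat_def matrix_matrix_mult_def vec_eq_iff sum_distrib_left sum_distrib_right ac_simps)

lemma monom_fun_scale:
  "monom_fun ms (scale_mat s x, scale_mat t y)
   = s ^ count_list (map fst ms) X * t ^ count_list (map fst ms) Y * monom_fun ms (x, y)"
proof (induction ms)
  case (Cons m ms)
  obtain l i j where "m = (l, i, j)" by (cases m)
  then show ?case using Cons by (cases l) (simp_all add: monom_fun_def scale_mat_def)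
qed (simp add: monom_fun_def)

lemma bidegree_decomposition:
  fixes cs :: "('k::comm_ring_1 \<times> (letter \<times> 4 \<times> 4) list) list"
  assumes "\<And>c ms. (c, ms) \<in> set cs \<Longrightarrow> length ms \<le> n"
  shows "(\<Sum>(c, ms)\<leftarrow>cs. c * monom_fun ms (scale_mat s x, scale_mat t y))
    = (\<Sum>a\<le>n. (\<Sum>b\<le>n. bidegree_part cs a b (x, y) * t ^ b) * s ^ a)"
proof -
  define A where "A e = count_list (map fst (snd e)) X" for e :: "'k \<times> (letter \<times> 4 \<times> 4) list"
  define B where "B e = count_list (map fst (snd e)) Y" for e :: "'k \<times> (letter \<times> 4 \<times> 4) list"
  define v where "v e = fst e * monom_fun (snd e) (x, y)" for e :: "'k \<times> (letter \<times> 4 \<times> 4) list"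
  have "A e \<le> n \<and> B e \<le> n" if "e \<in> set cs" for e
  proof -
    have "length (snd e) \<le> n" using assms[of "fst e" "snd e"] that by simp
    then show ?thesis
      using count_le_length[of "map fst (snd e)"] unfolding A_def B_def by (metis length_map order_trans)
  qed
  then have "(\<Sum>e\<leftarrow>cs. v e * t ^ B e * s ^ A e)
      = (\<Sum>a\<le>n. (\<Sum>b\<le>n. (\<Sum>e\<leftarrow>cs. if A e = a \<and> B e = b then v e else 0) * t ^ b) * s ^ a)"
    by (rule sum_list_bigraded)
  then show ?thesis
    unfolding v_def A_def B_def
    by (simp add: monom_fun_scale bidegree_part_def case_prod_unfold ac_simps)
qed

text \<open>Scaling commutes with conjugation, so the invariance of \<open>f\<close> at scaled
  arguments equates two polynomials in \<open>s\<close> and \<open>t\<close> whose coefficients are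
  the components.\<close>

lemma bidegree_part_invariant:
  fixes f :: "'k::field_char_0 mat4 \<times> 'k mat4 \<Rightarrow> 'k"
  assumes f: "f \<in> C42" and cs: "\<And>p. f p = (\<Sum>(c, ms)\<leftarrow>cs. c * monom_fun ms p)"
    and g: "invertible g"
  shows "bidegree_part cs a b (g ** x ** matrix_inv g, g ** y ** matrix_inv g) = bidegree_part cs a b (x, y)"
proof -
  \<comment> \<open>The number \<open>a + b\<close> is included so that the exponents
    \<open>a\<close> and \<open>b\<close> lie in the range of the comparison even if no monomial
    reaches them.\<close>
  define n where "n = Max (insert (a + b) ((length \<circ> snd) ` set cs))"
  let ?gx = "g ** x ** matrix_inv g" and ?gy = "g ** y ** matrix_inv g"
  have len: "length ms \<le> n" if "(c, ms) \<in> set cs" for c ms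
    unfolding n_def by (rule Max_ge) (use that in \<open>auto simp: image_iff intro!: bexI[of _ "(c, ms)"]\<close>)
  have "a + b \<le> n" unfolding n_def by (rule Max_ge) auto
  then have ab: "a \<le> n" "b \<le> n" by auto
  let ?v = "\<lambda>a b. bidegree_part cs a b (?gx, ?gy) - bidegree_part cs a b (x, y)"
  have "(\<Sum>a\<le>n. (\<Sum>b\<le>n. ?v a b * t ^ b) * s ^ a) = 0" for s t
  proof -
    have "f (scale_mat s ?gx, scale_mat t ?gy) = f (scale_mat s x, scale_mat t y)"
      using f g by (simp add: C42_def scale_mat_conj)
    moreover have "f (scale_mat s u, scale_mat t v)
        = (\<Sum>a\<le>n. (\<Sum>b\<le>n. bidegree_part cs a b (u, v) * t ^ b) * s ^ a)" for u v
      unfolding cs by (rule bidegree_decomposition) (rule len)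
    ultimately show ?thesis
      by (simp add: left_diff_distrib sum_subtractf)
  qed
  then have "(\<Sum>b\<le>n. ?v a b * t ^ b) = 0" for t
    using ab(1) by (rule sum_powers_zero)
  then have "?v a b = 0"
    using ab(2) by (rule sum_powers_zero)
  then show ?thesis by simp
qed

section \<open>Polarization and restitution of bihomogeneous invariants\<close>

definition std_point :: "nat \<Rightarrow> 'k mat4 \<times> 'k mat4 \<Rightarrow> nat \<Rightarrow> 'k mat4" where
  "std_point a p l = letter_mat (if l < a then X else Y) p"

lemma multilin_add: "multilin m (\<lambda>i j. S i j + T i j) Z = multilin m S Z + multilin m T Z"
  by (simp add: multilin_def distrib_right sum.distrib)

lemma multilin_sum: "multilin m (\<lambda>i j. \<Sum>x\<in>A. T x i j) Z = (\<Sum>x\<in>A. multilin m (T x) Z)"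
  by (induction A rule: infinite_finite_induct) (simp_all add: multilin_add, simp_all add: multilin_def)

lemma multilin_single:
  assumes "i \<in> tuples m" "j \<in> tuples m"
  shows "multilin m (\<lambda>i' j'. if i' = i \<and> j' = j then c else 0) Z = c * kron m Z i j"
proof -
  have "multilin m (\<lambda>i' j'. if i' = i \<and> j' = j then c else 0) Z
      = (\<Sum>i'\<in>tuples m. \<Sum>j'\<in>tuples m. (if i' = i then 1 else 0) * ((if j' = j then 1 else 0) * (c * kron m Z i' j')))"
    unfolding multilin_def by (intro sum.cong refl) simp
  also have "\<dots> = c * kron m Z i j"
    using assms by (simp only: sum_delta_tuples sum_distrib_left[symmetric])
  finally show ?thesis .
qed

text \<open>Factors commute, so the monomial may be sorted with all entries of the first matrix in
  front; position \<open>l\<close> then belongs to the first matrix exactly if \<open>l < a\<close>,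
  as \<open>std_point\<close> requires.\<close>

lemma monom_fun_multilin:
  fixes c :: "'k::comm_ring_1"
  assumes "count_list (map fst ms) X = a" "count_list (map fst ms) Y = b"
  shows "\<exists>T. \<forall>p. c * monom_fun ms p = multilin (a + b) T (std_point a p)"
proof -
  define xs where "xs = filter (\<lambda>m. fst m = X) ms"
  define ys where "ys = filter (\<lambda>m. fst m = Y) ms"
  have "count_list (map fst ms) l = length (filter (\<lambda>m. fst m = l) ms)" for l
    by (induction ms) auto
  then have len: "length xs = a" "length ys = b"
    using assms by (auto simp: xs_def ys_def)
  define zs where "zs = xs @ ys"
  define i where "i = restrict (\<lambda>l. fst (snd (zs ! l))) {..<a + b}"
  define j where "j = restrict (\<lambda>l. snd (snd (zs ! l))) {..<a + b}"
  have ij: "i \<in> tuples (a + b)" "j \<in> tuples (a + b)" by (auto simp: i_def j_def)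
  have letter: "fst (zs ! l) = (if l < a then X else Y)" if "l < a + b" for l
  proof (cases "l < a")
    case True
    then have "zs ! l \<in> set xs" using len by (simp add: zs_def nth_append)
    then show ?thesis using True by (simp add: xs_def)
  next
    case False
    then have "zs ! l \<in> set ys" using len that by (simp add: zs_def nth_append)
    then show ?thesis using False by (simp add: ys_def)
  qed
  have "monom_fun ms p = kron (a + b) (std_point a p) i j" for p :: "'k mat4 \<times> 'k mat4"
  proof -
    have "monom_fun ms p = monom_fun zs p"
      unfolding zs_def xs_def ys_def monom_fun_def
    proof (induction ms)
      case (Cons m ms)
      then show ?case by (cases "fst m") (auto simp: ac_simps)
    qed simp
    also have "\<dots> = (\<Prod>l<length zs. (\<lambda>(l, i, j). letter_mat l p $ i $ j) (zs ! l))"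
      by (simp add: monom_fun_def prod.list_conv_set_nth atLeast0LessThan)
    also have "\<dots> = (\<Prod>l<a + b. std_point a p l $ i l $ j l)"
    proof (rule prod.cong)
      show "{..<length zs} = {..<a + b}" using len by (simp add: zs_def)
      fix l assume "l \<in> {..<a + b}"
      then show "(\<lambda>(l, i, j). letter_mat l p $ i $ j) (zs ! l) = std_point a p l $ i l $ j l"
        using letter[of l] by (cases "zs ! l") (simp add: i_def j_def std_point_def)
    qed
    finally show ?thesis by (simp add: kron_def)
  qed
  then show ?thesis
    using multilin_single[OF ij] by metis
qed

lemma bidegree_part_multilin:
  fixes cs :: "('k::comm_ring_1 \<times> (letter \<times> 4 \<times> 4) list) list"
  shows "\<exists>T. \<forall>p. bidegree_part cs a b p = multilin (a + b) T (std_point a p)"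
proof (induction cs)
  case Nil
  then show ?case by (intro exI[of _ "\<lambda>_ _. 0"]) (simp add: bidegree_part_def multilin_def)
next
  case (Cons e cs)
  then obtain T where T: "\<And>p. bidegree_part cs a b p = multilin (a + b) T (std_point a p)" by blast
  obtain c ms where e: "e = (c, ms)" by (cases e)
  show ?case
  proof (cases "count_list (map fst ms) X = a \<and> count_list (map fst ms) Y = b")
    case True
    then obtain T' where "\<And>p. c * monom_fun ms p = multilin (a + b) T' (std_point a p)"
      using monom_fun_multilin by blast
    then show ?thesis using True T
      by (intro exI[of _ "\<lambda>i j. T' i j + T i j"]) (simp add: bidegree_part_def e multilin_add)
  next
    case False
    then show ?thesis using T by (intro exI[of _ T]) (auto simp: bidegree_part_def e)
  qed
qed

lemma multilin_permute:
  fixes T :: "(nat \<Rightarrow> 'n::finite) \<Rightarrow> (nat \<Rightarrow> 'n) \<Rightarrow> 'k::comm_ring_1"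
  assumes "s permutes {..<m}"
  shows "multilin m T (\<lambda>l. Z (s l)) = multilin m (\<lambda>i j. T (i \<circ> s) (j \<circ> s)) Z"
proof -
  have bij: "bij_betw (\<lambda>i. i \<circ> s) (tuples m) (tuples m :: (nat \<Rightarrow> 'n) set)"
  proof (rule bij_betw_byWitness[where f' = "\<lambda>i. i \<circ> inv s"])
    show "\<forall>i\<in>tuples m. (i \<circ> s) \<circ> inv s = i" "\<forall>i\<in>tuples m. (i \<circ> inv s) \<circ> s = i"
      by (simp_all only: comp_assoc permutes_inv_o[OF assms] comp_id ball_triv simp_thms) 
    show "(\<lambda>i. i \<circ> s) ` tuples m \<subseteq> tuples m" "(\<lambda>i. i \<circ> inv s) ` tuples m \<subseteq> tuples m"
      unfolding image_subset_iff tuples_comp_perm[OF assms] tuples_comp_perm[OF permutes_inv[OF assms]] by simp_all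
  qed
  have kron: "kron m (\<lambda>l. Z (s l)) (i \<circ> s) (j \<circ> s) = kron m Z i j" for i j
    unfolding kron_def comp_def by (rule prod.reindex_bij_betw[OF permutes_imp_bij[OF assms]])
  let ?f = "\<lambda>i j. T i j * kron m (\<lambda>l. Z (s l)) i j"
  have "multilin m (\<lambda>i j. T (i \<circ> s) (j \<circ> s)) Z = (\<Sum>i\<in>tuples m. \<Sum>j\<in>tuples m. ?f (i \<circ> s) (j \<circ> s))"
    by (simp add: multilin_def kron)
  also have "\<dots> = (\<Sum>i\<in>tuples m. \<Sum>j\<in>tuples m. ?f (i \<circ> s) j)"
    by (rule sum.cong[OF refl]) (rule sum.reindex_bij_betw[OF bij])
  also have "\<dots> = (\<Sum>i\<in>tuples m. \<Sum>j\<in>tuples m. ?f i j)"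
    by (rule sum.reindex_bij_betw[OF bij])
  finally show ?thesis by (simp add: multilin_def)
qed

lemma contr_std_point:
  assumes "s permutes {..<m}"
  shows "(\<lambda>p. contr {..<m} (std_point a p) s) \<in> generated_algebra (range word_trace)"
proof -
  obtain css where css: "cycles_of css {..<m} s"
    using cycles_of_exists[OF assms] by auto
  let ?w = "map (\<lambda>l. if l < a then X else Y)"
  have "(\<lambda>p. contr {..<m} (std_point a p) s) = (\<lambda>p. \<Prod>cs\<leftarrow>css. word_trace (?w cs) p)"
    by (simp add: contr_cycles_of[OF css] word_trace_def std_point_def[abs_def] comp_def)
  also have "\<dots> \<in> generated_algebra (range word_trace)"
    by (intro generated_algebra_prod_list generated_algebra.base rangeI)
  finally show ?thesis .
qed

lemma matrix_sum_conj:
  fixes g h :: "'k::comm_ring_1 ^ 'n ^ 'n"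
  shows "(\<Sum>k\<in>K. g ** Z k ** h) = g ** (\<Sum>k\<in>K. Z k) ** h"
proof (induction K rule: infinite_finite_induct)
  case (insert k K)
  have "(A + B) ** h = A ** h + B ** h" for A B :: "'k ^ 'n ^ 'n"
    by (simp add: matrix_matrix_mult_def vec_eq_iff distrib_right sum.distrib)
  then show ?case using insert by (simp add: matrix_add_ldistrib)
qed simp_all

text \<open>The multilinear form of a component is symmetrized over the Young subgroup
  \<open>H\<close> of permutations that preserve the letters. By inclusion and exclusion its values
  are combinations of values of the component, so invariance carries over to independent matrices;
  evaluation at \<open>std_point\<close> returns the component times the order of
  \<open>H\<close>.\<close>

lemma bidegree_part_trace_algebra:
  fixes f :: "'k::field_char_0 mat4 \<times> 'k mat4 \<Rightarrow> 'k"
  assumes f: "f \<in> C42" and cs: "\<And>p. f p = (\<Sum>(c, ms)\<leftarrow>cs. c * monom_fun ms p)"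
  shows "bidegree_part cs a b \<in> generated_algebra (range word_trace)"
proof -
  define m where "m = a + b"
  define H where "H = {s. s permutes {..<m} \<and> (\<forall>l<m. (s l < a) = (l < a))}"
  obtain T where T: "\<And>p. bidegree_part cs a b p = multilin m T (std_point a p)"
    using bidegree_part_multilin unfolding m_def by blast
  define T' where "T' i j = (\<Sum>s\<in>H. T (i \<circ> s) (j \<circ> s))" for i j
  have T': "multilin m T' Z = (\<Sum>s\<in>H. multilin m T (\<lambda>l. Z (s l)))" for Z
    unfolding T'_def multilin_sum by (intro sum.cong refl) (simp add: H_def multilin_permute)
  have polar: "multilin m T' Z = (\<Sum>S\<in>Pow {..<m}. (- 1) ^ (m - card S) *
      bidegree_part cs a b (\<Sum>k | k \<in> S \<and> k < a. Z k, \<Sum>k | k \<in> S \<and> \<not> k < a. Z k))" for Z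
  proof -
    have "(\<lambda>l. \<Sum>k | k \<in> S \<and> (k < a) = (l < a). Z k)
        = std_point a (\<Sum>k | k \<in> S \<and> k < a. Z k, \<Sum>k | k \<in> S \<and> \<not> k < a. Z k)" for S
      by (auto simp: std_point_def fun_eq_iff)
    then show ?thesis
      unfolding T' H_def T by (subst multilin_polarization) simp
  qed
  have "multilin m T' (\<lambda>l. g ** Z l ** matrix_inv g) = multilin m T' Z" if "invertible g" for g Z
    unfolding polar matrix_sum_conj bidegree_part_invariant[OF f cs that] ..
  then obtain d where d: "\<And>Z. multilin m T' Z = (\<Sum>s | s permutes {..<m}. d s * contr {..<m} Z s)"
    using multilinear_invariants[of m T'] by blast
  have "finite H" unfolding H_def by (rule finite_subset[OF _ finite_permutations[of "{..<m}"]]) auto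
  moreover have "id \<in> H" by (simp add: H_def permutes_id)
  ultimately have card: "of_nat (card H) \<noteq> (0 :: 'k)" by auto
  have "multilin m T' (std_point a p) = of_nat (card H) * bidegree_part cs a b p" for p
  proof -
    have "(\<lambda>l. std_point a p (s l)) = std_point a p" if "s \<in> H" for s
      using that by (auto simp: H_def std_point_def fun_eq_iff permutes_def)
    then show ?thesis by (simp add: T' T)
  qed
  then have "bidegree_part cs a b p = (\<Sum>s | s permutes {..<m}. (d s / of_nat (card H)) * contr {..<m} (std_point a p) s)" for p
    using card by (simp add: d[symmetric] sum_divide_distrib[symmetric] times_divide_eq_left)
  then have "bidegree_part cs a b = (\<Sum>s | s permutes {..<m}. (\<lambda>p. (d s / of_nat (card H)) * contr {..<m} (std_point a p) s))"
    by (simp add: fun_eq_iff sum_fun_apply)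
  also have "\<dots> \<in> generated_algebra (range word_trace)"
    by (intro generated_algebra_sum generated_algebra_scale contr_std_point) simp
  finally show ?thesis .
qed

theorem first_fundamental_theorem:
  fixes f :: "'k::field_char_0 mat4 \<times> 'k mat4 \<Rightarrow> 'k"
  assumes "f \<in> C42"
  shows "f \<in> generated_algebra (range word_trace)"
proof -
  have "f \<in> polynomial_functions" using assms by (simp add: C42_def)
  then have "\<exists>cs. \<forall>p. f p = (\<Sum>(c, ms)\<leftarrow>cs. c * monom_fun ms p)"
    by (rule polynomial_functions_monomials)
  then obtain cs where "\<forall>p. f p = (\<Sum>(c, ms)\<leftarrow>cs. c * monom_fun ms p)"
    by (rule exE)
  then have cs: "\<And>p. f p = (\<Sum>(c, ms)\<leftarrow>cs. c * monom_fun ms p)" ..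
  define n where "n = Max (insert 0 ((length \<circ> snd) ` set cs))"
  have len: "length ms \<le> n" if "(c, ms) \<in> set cs" for c ms
    unfolding n_def by (rule Max_ge) (use that in \<open>auto simp: image_iff intro!: bexI[of _ "(c, ms)"]\<close>)
  have one: "scale_mat 1 A = A" for A :: "'k mat4" by (simp add: scale_mat_def vec_eq_iff)
  have "f p = (\<Sum>a\<le>n. \<Sum>b\<le>n. bidegree_part cs a b p)" for p
  proof -
    have "(\<Sum>(c, ms)\<leftarrow>cs. c * monom_fun ms (scale_mat 1 (fst p), scale_mat 1 (snd p)))
        = (\<Sum>a\<le>n. (\<Sum>b\<le>n. bidegree_part cs a b (fst p, snd p) * 1 ^ b) * 1 ^ a)"
      by (rule bidegree_decomposition) (rule len)
    then show ?thesis by (simp add: cs one)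
  qed
  then have "f = (\<Sum>a\<le>n. \<Sum>b\<le>n. bidegree_part cs a b)"
    by (simp add: fun_eq_iff sum_fun_apply)
  also have "\<dots> \<in> generated_algebra (range word_trace)"
    by (intro generated_algebra_sum bidegree_part_trace_algebra[OF assms cs])
  finally show ?thesis .
qed

section \<open>The linearized identity of degree four\<close>

fun interleave :: "'a \<Rightarrow> 'a list \<Rightarrow> 'a list list" where
  "interleave x [] = [[x]]"
| "interleave x (y # ys) = (x # y # ys) # map ((#) y) (interleave x ys)"

text \<open>Rearranges positions, so equal entries give repeated lists: four equal words contribute
  their concatenation 24 times, as in the linearization of a fourth power.\<close>

fun perm_list :: "'a list \<Rightarrow> 'a list list" where
  "perm_list [] = [[]]"
| "perm_list (x # xs) = concat (map (interleave x) (perm_list xs))"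

lemma interleave_map: "interleave (f x) (map f ys) = map (map f) (interleave x ys)"
  by (induction ys) auto

text \<open>By naturality, sums over rearrangements of words are pulled back to rearrangements of
  distinct numbers, which correspond to permutations.\<close>

lemma perm_list_map: "perm_list (map f xs) = map (map f) (perm_list xs)"
  by (induction xs) (simp_all add: map_concat interleave_map comp_def)

lemma set_interleave: "set (interleave x ys) = {as @ x # bs |as bs. ys = as @ bs}"
proof (induction ys)
  case (Cons y ys)
  have "set (interleave x (y # ys)) = insert (x # y # ys) ((#) y ` {as @ x # bs |as bs. ys = as @ bs})"
    using Cons by simp
  also have "\<dots> = {as @ x # bs |as bs. y # ys = as @ bs}"
  proof (intro equalityI subsetI)
    fix zs assume "zs \<in> insert (x # y # ys) ((#) y ` {as @ x # bs |as bs. ys = as @ bs})"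
    then consider "zs = x # y # ys" | as bs where "zs = y # as @ x # bs" "ys = as @ bs" by auto
    then show "zs \<in> {as @ x # bs |as bs. y # ys = as @ bs}"
    proof cases
      case 1
      then show ?thesis by (intro CollectI exI[of _ "[]"] exI[of _ "y # ys"]) simp
    next
      case 2
      then show ?thesis by (intro CollectI exI[of _ "y # as"] exI[of _ bs]) simp
    qed
  next
    fix zs assume "zs \<in> {as @ x # bs |as bs. y # ys = as @ bs}"
    then obtain as bs where "zs = as @ x # bs" "y # ys = as @ bs" by blast
    then show "zs \<in> insert (x # y # ys) ((#) y ` {as @ x # bs |as bs. ys = as @ bs})"
      by (cases as) auto
  qed
  finally show ?case .
qed simp

lemma set_perm_list:
  assumes "distinct xs"
  shows "set (perm_list xs) = {ys. distinct ys \<and> set ys = set xs}"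
  using assms
proof (induction xs)
  case (Cons x xs)
  show ?case
  proof (intro equalityI subsetI)
    fix zs assume "zs \<in> set (perm_list (x # xs))"
    then obtain as bs where "as @ bs \<in> set (perm_list xs)" "zs = as @ x # bs"
      by (auto simp: set_interleave)
    then show "zs \<in> {ys. distinct ys \<and> set ys = set (x # xs)}"
      using Cons by auto
  next
    fix zs assume zs: "zs \<in> {ys. distinct ys \<and> set ys = set (x # xs)}"
    then have "x \<in> set zs" by simp
    then obtain as bs where ab: "zs = as @ x # bs" by (meson split_list)
    then have "as @ bs \<in> set (perm_list xs)" using zs Cons by auto
    then show "zs \<in> set (perm_list (x # xs))" using ab by (auto simp: set_interleave)
  qed
qed auto

lemma distinct_interleave: "x \<notin> set ys \<Longrightarrow> distinct (interleave x ys)"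
  by (induction ys) (auto simp: distinct_map)

text \<open>Removing \<open>x\<close> recovers the list into which it was inserted, so different
  lists have disjoint sets of interleavings.\<close>

lemma distinct_perm_list:
  assumes "distinct xs"
  shows "distinct (perm_list xs)"
  using assms
proof (induction xs)
  case (Cons x xs)
  have nin: "x \<notin> set ys" if "ys \<in> set (perm_list xs)" for ys
    using that Cons by (simp add: set_perm_list)
  have rem: "remove1 x zs = ys" if "zs \<in> set (interleave x ys)" "ys \<in> set (perm_list xs)" for ys zs
    using that nin[OF that(2)] by (auto simp: set_interleave remove1_append)
  have nonempty: "interleave x ys \<noteq> []" for ys by (cases ys) auto
  have "inj_on (interleave x) (set (perm_list xs))"
  proof (rule inj_onI)
    fix ys ys' assume *: "ys \<in> set (perm_list xs)" "ys' \<in> set (perm_list xs)" "interleave x ys = interleave x ys'"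
    obtain z where "z \<in> set (interleave x ys)" using nonempty by (metis list.set_sel(1))
    then show "ys = ys'" using * rem by metis
  qed
  then have "distinct (map (interleave x) (perm_list xs))"
    using Cons by (simp add: distinct_map)
  moreover have "distinct ys" if "ys \<in> set (map (interleave x) (perm_list xs))" for ys
    using that nin by (auto simp: distinct_interleave)
  moreover have "set ys \<inter> set zs = {}"
    if yz: "ys \<in> set (map (interleave x) (perm_list xs))" "zs \<in> set (map (interleave x) (perm_list xs))" "ys \<noteq> zs" for ys zs
  proof (rule ccontr)
    assume "set ys \<inter> set zs \<noteq> {}"
    then obtain w where "w \<in> set ys" "w \<in> set zs" by blast
    moreover obtain a b where "a \<in> set (perm_list xs)" "b \<in> set (perm_list xs)" "ys = interleave x a" "zs = interleave x b"
      using yz by auto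
    ultimately show False using rem yz(3) by metis
  qed
  ultimately show ?case unfolding perm_list.simps by (rule distinct_concat)
qed simp

lemma sum_list_perm_list:
  fixes f :: "'a list \<Rightarrow> 'b::comm_monoid_add"
  assumes "distinct xs"
  shows "(\<Sum>ys\<leftarrow>perm_list xs. f ys) = (\<Sum>ys | distinct ys \<and> set ys = set xs. f ys)"
  using assms by (simp add: sum_list_distinct_conv_sum_set distinct_perm_list set_perm_list)

lemma sign_cycle_of_list:
  "distinct cs \<Longrightarrow> sign (cycle_of_list cs) = (- 1) ^ (length cs - 1)"
proof (induction cs rule: cycle_of_list.induct)
  case (1 i j cs)
  have "sign (cycle_of_list (i # j # cs)) = sign (Transposition.transpose i j) * sign (cycle_of_list (j # cs))"
    unfolding cycle_of_list.simps(1) by (rule sign_compose[OF permutation_swap_id permutation_of_cycle])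
  also have "\<dots> = (- 1) ^ (length (i # j # cs) - 1)" using 1 by (simp add: sign_swap_id)
  finally show ?case .
qed simp_all

lemma cycle_of_list_eqI:
  assumes "distinct (c # ps)" "distinct (c # qs)" "set qs = set ps"
    "cycle_of_list (c # ps) = cycle_of_list (c # qs)"
  shows "ps = qs"
proof -
  have len: "length ps = length qs"
    using assms(1-3) by (metis distinct.simps(2) distinct_card)
  have "(c # ps) ! k = (c # qs) ! k" if "k \<le> length ps" for k
    using that
  proof (induction k)
    case (Suc k)
    have "(ps @ [c]) ! k = (qs @ [c]) ! k"
      using cycle_of_list_nth[OF assms(1), of k] cycle_of_list_nth[OF assms(2), of k] assms(4) Suc len by simp
    then show ?case using Suc.prems len by (simp add: nth_append)
  qed simp
  then have "c # ps = c # qs" using len by (intro nth_equalityI) auto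
  then show ?thesis by simp
qed

lemma cycles_of_single:
  assumes "cycles_of [cs] L s" "s permutes L" "c \<in> L"
  shows "\<exists>ps. distinct (c # ps) \<and> set (c # ps) = L \<and> s = cycle_of_list (c # ps)"
proof -
  have cs: "distinct cs" "set cs = L" "\<And>l. l \<in> L \<Longrightarrow> s l = cycle_of_list cs l"
    using assms(1) by (auto simp: cycles_of_def)
  have s: "s = cycle_of_list cs"
  proof
    fix l show "s l = cycle_of_list cs l"
      using cs assms(2) by (cases "l \<in> L") (auto simp: permutes_def id_outside_supp)
  qed
  obtain n where n: "n < length cs" "cs ! n = c"
    using assms(3) cs(2) by (metis in_set_conv_nth)
  define ds where "ds = rotate n cs"
  have "cs \<noteq> []" using n by auto
  then have "hd ds = c" "ds \<noteq> []" using n by (simp_all add: ds_def hd_rotate_conv_nth)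
  then have "ds = c # tl ds" by (metis list.collapse)
  moreover have "distinct ds" "set ds = L" "s = cycle_of_list ds"
    using cs s cycle_of_list_rotate_independent[OF cs(1), of n] by (simp_all add: ds_def)
  ultimately show ?thesis by (intro exI[of _ "tl ds"]) simp
qed

text \<open>The length bound applies to each factor separately, so a product of shorter traces
  belongs here whatever its total degree.\<close>

definition shorter_traces :: "nat \<Rightarrow> ('k::field_char_0 mat4 \<times> 'k mat4 \<Rightarrow> 'k) set" where
  "shorter_traces n = generated_algebra (word_trace ` {w. length w < n})"

lemma letters_concat:
  "matprod (map (\<lambda>l. matprod (map (\<lambda>a. letter_mat a p) (zs l))) cs)
    = matprod (map (\<lambda>a. letter_mat a p) (concat (map zs cs)))"
  by (induction cs) (simp_all add: matprod_append)

text \<open>Five matrices, each the product of a nonempty word, are put into the fundamental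
  identity for 4 x 4 matrices. The 5-cycles, each written once with 0 in front, are even and give
  the stated sum; every cycle of any other permutation misses one of the words, so its trace is
  shorter.\<close>

lemma trace_relation_perms:
  fixes zs :: "nat \<Rightarrow> letter list"
  assumes "\<And>l. l < 5 \<Longrightarrow> zs l \<noteq> []"
  shows "(\<lambda>p :: 'k::field_char_0 mat4 \<times> 'k mat4. \<Sum>ps\<leftarrow>perm_list [1, 2, 3, 4]. word_trace (concat (map zs (0 # ps))) p)
    \<in> shorter_traces (\<Sum>l<5. length (zs l))"
proof -
  define L :: "nat set" where "L = {..<5}"
  define Z where "Z p l = matprod (map (\<lambda>a. letter_mat a p) (zs l))" for p :: "'k mat4 \<times> 'k mat4" and l
  define Q :: "nat list set" where "Q = {ps. distinct ps \<and> set ps = {1, 2, 3, 4}}"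
  define C where "C = (\<lambda>ps. cycle_of_list (0 # ps)) ` Q"
  have wt: "word_trace (concat (map zs cs)) p = trace (matprod (map (Z p) cs))" for p cs
    unfolding word_trace_def Z_def letters_concat ..
  have L: "L = {0, 1, 2, 3, 4}" by (auto simp: L_def)
  have Q: "distinct (0 # ps)" "set (0 # ps) = L" "length ps = 4" if "ps \<in> Q" for ps
    using that distinct_card[of ps] by (auto simp: Q_def L)
  have inj: "inj_on (\<lambda>ps. cycle_of_list (0 # ps)) Q"
    by (rule inj_onI) (use Q in \<open>auto intro!: cycle_of_list_eqI[of 0] simp: Q_def\<close>)
  have C_sub: "C \<subseteq> {s. s permutes L}"
    unfolding C_def using Q(2) cycle_permutes by (metis (no_types, lifting) image_subsetI mem_Collect_eq)
  have fin: "finite {s. s permutes L}" by (simp add: finite_permutations L_def)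
  have main: "(\<Sum>ps\<leftarrow>perm_list [1, 2, 3, 4]. word_trace (concat (map zs (0 # ps))) p)
      = (\<Sum>s\<in>{s. s permutes L} - C. of_int (- sign s) * contr L (Z p) s)" for p
  proof -
    have "(\<Sum>ps\<leftarrow>perm_list [1, 2, 3, 4]. word_trace (concat (map zs (0 # ps))) p)
        = (\<Sum>ps\<in>Q. word_trace (concat (map zs (0 # ps))) p)"
      by (subst sum_list_perm_list) (auto simp: Q_def)
    also have "\<dots> = (\<Sum>ps\<in>Q. of_int (sign (cycle_of_list (0 # ps))) * contr L (Z p) (cycle_of_list (0 # ps)))"
    proof (intro sum.cong refl)
      fix ps assume ps: "ps \<in> Q"
      have "contr L (Z p) (cycle_of_list (0 # ps)) = word_trace (concat (map zs (0 # ps))) p"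
        unfolding wt using contr_cycle[OF Q(1)[OF ps], of "Z p"] unfolding Q(2)[OF ps] by blast
      then show "word_trace (concat (map zs (0 # ps))) p
          = of_int (sign (cycle_of_list (0 # ps))) * contr L (Z p) (cycle_of_list (0 # ps))"
        using sign_cycle_of_list[OF Q(1)[OF ps]] Q(3)[OF ps] by simp
    qed
    also have "\<dots> = (\<Sum>s\<in>C. of_int (sign s) * contr L (Z p) s)"
      unfolding C_def by (simp add: sum.reindex[OF inj])
    also have "\<dots> = - (\<Sum>s\<in>{s. s permutes L} - C. of_int (sign s) * contr L (Z p) s)"
    proof -
      have "(\<Sum>s | s permutes L. of_int (sign s) * contr L (Z p) s) = 0"
        by (rule fundamental_trace_identity) (auto simp: L_def)
      then show ?thesis
        using sum.subset_diff[OF C_sub fin, of "\<lambda>s. of_int (sign s) * contr L (Z p) s"]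
        by (simp add: eq_neg_iff_add_eq_0 add.commute)
    qed
    finally show ?thesis by (simp add: sum_negf)
  qed
  have "(\<lambda>p. contr L (Z p) s) \<in> shorter_traces (\<Sum>l<5. length (zs l))"
    if s: "s \<in> {s. s permutes L} - C" for s
  proof -
    obtain css where css: "cycles_of css L s"
      using cycles_of_exists[of s L] s by (auto simp: L_def)
    have short: "length (concat (map zs cs)) < (\<Sum>l<5. length (zs l))" if cs: "cs \<in> set css" for cs
    proof -
      have dist: "distinct cs" "cs \<noteq> []" "set cs \<subseteq> L"
        using css cs by (auto simp: cycles_of_def distinct_concat_iff)
      have "set cs \<noteq> L"
      proof
        assume eq: "set cs = L"
        have 1: "cycles_of [cs] L s" using css cs eq dist by (auto simp: cycles_of_def)
        have 2: "s permutes L" "0 \<in> L" using s by (simp_all add: L_def)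
        obtain ps where ps: "distinct (0 # ps)" "set (0 # ps) = L" "s = cycle_of_list (0 # ps)"
          using cycles_of_single[OF 1 2] by (elim exE conjE)
        have "set ps = L - {0}" using ps(1,2) by auto
        also have "\<dots> = {1, 2, 3, 4}" by (auto simp: L)
        finally have "ps \<in> Q" using ps(1) by (simp add: Q_def)
        with ps(3) have "s \<in> C" unfolding C_def by (rule image_eqI)
        then show False using s by blast
      qed
      then obtain l where l: "l \<in> L" "l \<notin> set cs" using dist by blast
      have "length (concat (map zs cs)) = (\<Sum>l\<leftarrow>cs. length (zs l))"
        by (simp add: length_concat comp_def)
      also have "\<dots> = (\<Sum>l\<in>set cs. length (zs l))"
        using dist by (simp add: sum_list_distinct_conv_sum_set)
      also have "\<dots> < (\<Sum>l\<in>L. length (zs l))"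
        using dist l assms by (intro sum_strict_mono2[of L _ l]) (auto simp: L_def)
      finally show ?thesis by (simp add: L_def)
    qed
    have "(\<lambda>p. contr L (Z p) s) = (\<lambda>p. \<Prod>cs\<leftarrow>css. word_trace (concat (map zs cs)) p)"
      by (simp only: contr_cycles_of[OF css] wt)
    also have "\<dots> \<in> shorter_traces (\<Sum>l<5. length (zs l))"
      unfolding shorter_traces_def
      by (intro generated_algebra_prod_list generated_algebra.base) (use short in auto)
    finally show ?thesis .
  qed
  then have "(\<Sum>s\<in>{s. s permutes L} - C. (\<lambda>p. of_int (- sign s) * contr L (Z p) s))
      \<in> shorter_traces (\<Sum>l<5. length (zs l))"
    unfolding shorter_traces_def by (intro generated_algebra_sum generated_algebra_scale) auto
  then show ?thesis
    unfolding main by (simp add: sum_fun_apply[abs_def])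
qed

lemma trace_relation:
  assumes "z \<noteq> []" "length zs = 4" "[] \<notin> set zs"
  shows "(\<lambda>p. \<Sum>qs\<leftarrow>perm_list zs. word_trace (z @ concat qs) p)
    \<in> shorter_traces (length z + length (concat zs))"
proof -
  obtain a b c d where zs: "zs = [a, b, c, d]"
    using assms(2) by (auto simp: length_Suc_conv numeral_eq_Suc)
  let ?z = "(!) (z # zs)"
  have "?z l \<noteq> []" if "l < 5" for l
  proof (cases l)
    case (Suc k)
    then have "zs ! k \<in> set zs" using that assms(2) by simp
    then show ?thesis using assms(3) Suc by auto
  qed (use assms(1) in simp)
  then have "(\<lambda>p :: 'a mat4 \<times> 'a mat4. \<Sum>ps\<leftarrow>perm_list [1, 2, 3, 4]. word_trace (concat (map ?z (0 # ps))) p)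
    \<in> shorter_traces (\<Sum>l<5. length (?z l))"
    by (rule trace_relation_perms)
  moreover have "perm_list zs = map (map ?z) (perm_list [1, 2, 3, 4])"
    unfolding perm_list_map[symmetric] zs by (simp add: numeral_eq_Suc)
  moreover have "(\<Sum>l<5. length (?z l)) = length z + length (concat zs)"
    unfolding zs by (simp add: numeral_eq_Suc)
  ultimately show ?thesis
    by (simp add: comp_def del: perm_list.simps)
qed

section \<open>Reduction of words\<close>

datatype 'a trie = Tip | Bin 'a "'a trie" "'a trie"

fun lookup :: "'a \<Rightarrow> 'a trie \<Rightarrow> letter list \<Rightarrow> 'a" where
  "lookup d Tip w = d"
| "lookup d (Bin a l r) [] = a"
| "lookup d (Bin a l r) (X # w) = lookup d l w"
| "lookup d (Bin a l r) (Y # w) = lookup d r w"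

fun update :: "'a \<Rightarrow> ('a \<Rightarrow> 'a) \<Rightarrow> letter list \<Rightarrow> 'a trie \<Rightarrow> 'a trie" where
  "update d f [] Tip = Bin (f d) Tip Tip"
| "update d f [] (Bin a l r) = Bin (f a) l r"
| "update d f (X # w) Tip = Bin d (update d f w Tip) Tip"
| "update d f (Y # w) Tip = Bin d Tip (update d f w Tip)"
| "update d f (X # w) (Bin a l r) = Bin a (update d f w l) r"
| "update d f (Y # w) (Bin a l r) = Bin a l (update d f w r)"

lemma lookup_update: "lookup d (update d f w t) v = (if v = w then f (lookup d t w) else lookup d t v)"
proof (induction d f w t arbitrary: v rule: update.induct)
  case (1 d f)
  then show ?case by (cases v rule: list.exhaust; cases "hd v") auto
next
  case (2 d f a l r)
  then show ?case by (cases v; cases "hd v") auto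
next
  case (3 d f w)
  then show ?case by (cases v; cases "hd v") auto
next
  case (4 d f w)
  then show ?case by (cases v; cases "hd v") auto
next
  case (5 d f w a l r)
  then show ?case by (cases v; cases "hd v") auto
next
  case (6 d f w a l r)
  then show ?case by (cases v; cases "hd v") auto
qed

type_synonym poly = "(int \<times> letter list) list"

fun add_terms :: "(letter list \<Rightarrow> letter list) \<Rightarrow> poly \<Rightarrow> int trie \<Rightarrow> int trie" where
  "add_terms key [] t = t"
| "add_terms key ((c, w) # p) t = add_terms key p (update 0 ((+) c) (key w) t)"

fun zero_trie :: "int trie \<Rightarrow> bool" where
  "zero_trie Tip = True"
| "zero_trie (Bin a l r) \<longleftrightarrow> a = 0 \<and> zero_trie l \<and> zero_trie r"

lemma lookup_zero_trie: "zero_trie t \<Longrightarrow> lookup 0 t w = 0"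
  by (induction "0 :: int" t w rule: lookup.induct) auto

lemma lookup_add_terms:
  "lookup 0 (add_terms key p t) v = lookup 0 t v + (\<Sum>(c, w)\<leftarrow>p. if key w = v then c else 0)"
  by (induction key p t rule: add_terms.induct) (auto simp: lookup_update)

text \<open>The function \<open>key\<close> chooses representatives: \<open>id\<close> compares
  noncommutative polynomials, \<open>necklace\<close> compares words up to rotation.\<close>

definition vanishes :: "(letter list \<Rightarrow> letter list) \<Rightarrow> poly \<Rightarrow> bool" where
  "vanishes key p \<longleftrightarrow> zero_trie (add_terms key p Tip)"

lemma vanishes_sum:
  fixes \<phi> :: "letter list \<Rightarrow> 'k::comm_ring_1"
  assumes "vanishes key p" "\<And>w. \<phi> (key w) = \<phi> w"
  shows "(\<Sum>(c, w)\<leftarrow>p. of_int c * \<phi> w) = 0"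
proof -
  define K where "K = (\<lambda>(c, w). key w) ` set p"
  have "finite K" by (simp add: K_def)
  have "(\<Sum>(c, w)\<leftarrow>q. of_int c * \<phi> w) = (\<Sum>v\<in>K. of_int (\<Sum>(c, w)\<leftarrow>q. if key w = v then c else 0) * \<phi> v)"
    if "set q \<subseteq> set p" for q
    using that
  proof (induction q)
    case (Cons e q)
    obtain c w where e: "e = (c, w)" by (cases e)
    have "key w \<in> K" using Cons.prems by (auto simp: K_def e intro!: image_eqI[of _ _ "(c, w)"])
    then have "of_int c * \<phi> w = (\<Sum>v\<in>K. of_int (if key w = v then c else 0) * \<phi> v)"
      using \<open>finite K\<close> assms(2) by (simp add: if_distrib[of of_int] if_distrib[of "\<lambda>x. x * _"] cong: if_cong)
    then show ?case
      using Cons by (simp add: e distrib_right sum.distrib)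
  qed simp
  moreover have "(\<Sum>(c, w)\<leftarrow>p. if key w = v then c else 0) = 0" for v
    using lookup_zero_trie[of "add_terms key p Tip" v] assms(1) by (simp add: vanishes_def lookup_add_terms)
  ultimately show ?thesis by simp
qed

text \<open>
  \<open>Rel [z\<^sub>1, z\<^sub>2, z\<^sub>3, z\<^sub>4]\<close> stands for the sum of the products \<open>z\<^sub>\<sigma>\<^sub>1 z\<^sub>\<sigma>\<^sub>2 z\<^sub>\<sigma>\<^sub>3 z\<^sub>\<sigma>\<^sub>4\<close> over all
  permutations, the linearization of \<open>z\<^sup>4\<close>; \<open>Rule u w v\<close> stands for \<open>u r v\<close>, where \<open>r\<close> is the
  relation with leading word \<open>w\<close> that has already been derived.
\<close>

datatype item = Rel "letter list list" | Rule "letter list" "letter list" "letter list"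

definition context_poly :: "letter list \<Rightarrow> poly \<Rightarrow> letter list \<Rightarrow> poly" where
  "context_poly u p v = map (\<lambda>(c, w). (c, u @ w @ v)) p"

fun expand :: "poly trie \<Rightarrow> item \<Rightarrow> poly" where
  "expand rs (Rel zs) = map (\<lambda>qs. (1, concat qs)) (perm_list zs)"
| "expand rs (Rule u w v) = context_poly u (lookup [] rs w) v"

fun item_degree :: "item \<Rightarrow> nat" where
  "item_degree (Rel zs) = length (concat zs)"
| "item_degree (Rule u w v) = length u + length w + length v"

fun proper_item :: "item \<Rightarrow> bool" where
  "proper_item (Rel zs) \<longleftrightarrow> length zs = 4 \<and> [] \<notin> set zs"
| "proper_item (Rule u w v) \<longleftrightarrow> True"

definition difference :: "poly trie \<Rightarrow> poly \<Rightarrow> (int \<times> item) list \<Rightarrow> poly" where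
  "difference rs p cert = p @ concat (map (\<lambda>(c, it). map (\<lambda>(d, w). (- c * d, w)) (expand rs it)) cert)"

text \<open>Homogeneity matters: every item has the length of the leading word, so a context that
  completes the rule to total length \<open>n\<close> does the same for each item.\<close>

definition check_rule :: "poly trie \<Rightarrow> poly \<Rightarrow> (int \<times> item) list \<Rightarrow> bool" where
  "check_rule rs p cert \<longleftrightarrow>
     (\<forall>(c, it)\<in>set cert. proper_item it \<and> item_degree it = length (snd (hd p))) \<and>
     vanishes id (difference rs p cert)"

text \<open>The order of the certificates counts, since \<open>Rule\<close> refers to the rules
  stored so far. A word without a rule is looked up as the zero polynomial, which is a valid
  relation.\<close>

fun derive_rules :: "poly trie \<Rightarrow> (poly \<times> (int \<times> item) list) list \<Rightarrow> poly trie option" where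
  "derive_rules rs [] = Some rs"
| "derive_rules rs ((p, cert) # cs) =
     (if check_rule rs p cert then derive_rules (update [] (\<lambda>_. p) (snd (hd p)) rs) cs else None)"

definition poly_trace :: "poly \<Rightarrow> 'k::comm_ring_1 mat4 \<times> 'k mat4 \<Rightarrow> 'k" where
  "poly_trace p x = (\<Sum>(c, w)\<leftarrow>p. of_int c * word_trace w x)"

lemma word_trace_rotate: "word_trace (u @ v) = word_trace (v @ u)"
  by (simp add: fun_eq_iff word_trace_def trace_matprod_append)

lemma poly_trace_append: "poly_trace (p @ q) = poly_trace p + poly_trace q"
  by (simp add: fun_eq_iff poly_trace_def)

lemma context_poly_append: "context_poly u (p @ q) v = context_poly u p v @ context_poly u q v"
  by (simp add: context_poly_def)

lemma context_poly_context: "context_poly u (context_poly u' p v') v = context_poly (u @ u') p (v' @ v)"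
  by (simp add: context_poly_def comp_def case_prod_unfold)

lemma poly_trace_difference:
  "poly_trace (context_poly u (difference rs p cert) v) x
    = poly_trace (context_poly u p v) x
      - (\<Sum>(c, it)\<leftarrow>cert. of_int c * poly_trace (context_poly u (expand rs it) v) x)"
proof -
  have 1: "(\<Sum>(c, w)\<leftarrow>context_poly u (map (\<lambda>(d, w). (- c * d, w)) q) v. of_int c * word_trace w x)
      = - (of_int c * poly_trace (context_poly u q v) x)" for c q
    by (induction q) (auto simp: context_poly_def poly_trace_def algebra_simps)
  have "poly_trace (context_poly u (concat (map (\<lambda>(c, it). map (\<lambda>(d, w). (- c * d, w)) (expand rs it)) cert)) v) x
      = - (\<Sum>(c, it)\<leftarrow>cert. of_int c * poly_trace (context_poly u (expand rs it) v) x)"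
  proof (induction cert)
    case Nil
    then show ?case by (simp add: poly_trace_def context_poly_def)
  next
    case (Cons a cert)
    obtain c it where a: "a = (c, it)" by (cases a)
    have "poly_trace (context_poly u (map (\<lambda>(d, w). (- c * d, w)) (expand rs it)) v) x
        = - (of_int c * poly_trace (context_poly u (expand rs it) v) x)"
      unfolding poly_trace_def[of "context_poly u (map _ _) v"] by (rule 1)
    then show ?case
      using Cons by (simp add: a context_poly_append poly_trace_append)
  qed
  then show ?thesis
    by (simp add: difference_def context_poly_append poly_trace_append)
qed

text \<open>The induction hypothesis of \<open>words_generated\<close>, under which the trace
  relations for words of length \<open>n\<close> become memberships in the algebra.\<close>

definition closed_below :: "('k::field_char_0 mat4 \<times> 'k mat4 \<Rightarrow> 'k) set \<Rightarrow> nat \<Rightarrow> bool" where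
  "closed_below S n \<longleftrightarrow> (\<forall>w. length w < n \<longrightarrow> word_trace w \<in> generated_algebra S)"

text \<open>
  The condition \<open>u @ v \<noteq> []\<close> reflects that \<open>Rel\<close> is a consequence of the trace identity only when it is
  multiplied by a further nonempty word.
\<close>

definition valid_rules :: "('k::field_char_0 mat4 \<times> 'k mat4 \<Rightarrow> 'k) set \<Rightarrow> nat \<Rightarrow> poly trie \<Rightarrow> bool" where
  "valid_rules S n rs \<longleftrightarrow> (\<forall>u w v. u @ v \<noteq> [] \<longrightarrow> length u + length w + length v = n \<longrightarrow>
     poly_trace (context_poly u (lookup [] rs w) v) \<in> generated_algebra S)"

lemma sum_list_in_algebra:
  "(\<And>c it. (c, it) \<in> set cert \<Longrightarrow> f it \<in> generated_algebra S) \<Longrightarrow>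
   (\<lambda>x. \<Sum>(c, it)\<leftarrow>cert. of_int c * f it x) \<in> generated_algebra S"
proof (induction cert)
  case Nil
  then show ?case using generated_algebra.const[of 0 S] by simp
next
  case (Cons a cert)
  obtain c it where a: "a = (c, it)" by (cases a)
  have "(\<lambda>x. of_int c * f it x) + (\<lambda>x. \<Sum>(c, it)\<leftarrow>cert. of_int c * f it x) \<in> generated_algebra S"
    using Cons by (intro generated_algebra.add generated_algebra_scale) (auto simp: a)
  then show ?case by (simp add: a plus_fun_def)
qed

text \<open>Under the trace the two sides of the context merge into the word \<open>v @ u\<close>,
  which serves as the further factor \<open>z\<close> of \<open>trace_relation\<close>.\<close>

lemma expand_in_algebra:
  fixes S :: "('k::field_char_0 mat4 \<times> 'k mat4 \<Rightarrow> 'k) set"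
  assumes cl: "closed_below S n" and rs: "valid_rules S n rs"
    and it: "proper_item it" "u @ v \<noteq> []" "length u + item_degree it + length v = n"
  shows "poly_trace (context_poly u (expand rs it) v) \<in> generated_algebra S"
proof (cases it)
  case (Rel zs)
  have rot: "word_trace ((v @ u) @ concat qs) = (word_trace (u @ concat qs @ v) :: 'k mat4 \<times> 'k mat4 \<Rightarrow> 'k)" for qs
    using word_trace_rotate[of v "u @ concat qs"] by simp
  have "(\<lambda>p :: 'k mat4 \<times> 'k mat4. \<Sum>qs\<leftarrow>perm_list zs. word_trace ((v @ u) @ concat qs) p)
      \<in> shorter_traces (length (v @ u) + length (concat zs))"
    using it by (intro trace_relation) (auto simp: Rel)
  also have "length (v @ u) + length (concat zs) = n" using it by (simp add: Rel)
  also have "shorter_traces n \<subseteq> generated_algebra S"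
    unfolding shorter_traces_def
    using cl by (auto simp: closed_below_def intro: generated_algebra_mono)
  finally have "(\<lambda>p :: 'k mat4 \<times> 'k mat4. \<Sum>qs\<leftarrow>perm_list zs. word_trace (u @ concat qs @ v) p) \<in> generated_algebra S"
    unfolding rot .
  also have "(\<lambda>p :: 'k mat4 \<times> 'k mat4. \<Sum>qs\<leftarrow>perm_list zs. word_trace (u @ concat qs @ v) p)
      = poly_trace (context_poly u (expand rs it) v)"
    by (simp add: Rel poly_trace_def context_poly_def comp_def fun_eq_iff)
  finally show ?thesis .
next
  case (Rule u' w v')
  then show ?thesis
    using rs it by (auto simp: valid_rules_def context_poly_context)
qed

lemma check_rule_in_algebra:
  fixes S :: "('k::field_char_0 mat4 \<times> 'k mat4 \<Rightarrow> 'k) set"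
  assumes cl: "closed_below S n" and rs: "valid_rules S n rs"
    and p: "check_rule rs p cert" "u @ v \<noteq> []" "length u + length (snd (hd p)) + length v = n"
  shows "poly_trace (context_poly u p v) \<in> generated_algebra S"
proof -
  have "poly_trace (context_poly u (difference rs p cert) v) x = 0" for x :: "'k mat4 \<times> 'k mat4"
    using vanishes_sum[of id "difference rs p cert" "\<lambda>w. word_trace (u @ w @ v) x"] p(1)
    by (simp add: check_rule_def poly_trace_def context_poly_def comp_def case_prod_unfold)
  then have "poly_trace (context_poly u p v)
      = (\<lambda>x :: 'k mat4 \<times> 'k mat4. \<Sum>(c, it)\<leftarrow>cert. of_int c * poly_trace (context_poly u (expand rs it) v) x)"
    by (intro ext) (simp add: poly_trace_difference)
  also have "\<dots> \<in> generated_algebra S"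
    using p by (intro sum_list_in_algebra expand_in_algebra[OF cl rs]) (auto simp: check_rule_def)
  finally show ?thesis .
qed

lemma derive_rules_valid:
  assumes "closed_below S n" "valid_rules S n rs" "derive_rules rs cs = Some rs'"
  shows "valid_rules S n rs'"
  using assms(2,3)
proof (induction rs cs rule: derive_rules.induct)
  case (2 rs p cert cs)
  then have ok: "check_rule rs p cert" by (auto split: if_splits)
  have "valid_rules S n (update [] (\<lambda>_. p) (snd (hd p)) rs)"
    unfolding valid_rules_def
  proof (intro allI impI)
    fix u w v :: "letter list"
    assume "u @ v \<noteq> []" "length u + length w + length v = n"
    then show "poly_trace (context_poly u (lookup [] (update [] (\<lambda>_. p) (snd (hd p)) rs) w) v) \<in> generated_algebra S"
      using 2(2) check_rule_in_algebra[OF assms(1) 2(2) ok, of u v]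
      by (auto simp: lookup_update valid_rules_def)
  qed
  then show ?case using 2 ok by simp
qed simp

section \<open>Normal words\<close>

definition next_words :: "poly trie \<Rightarrow> letter list list \<Rightarrow> letter list list" where
  "next_words rs N = filter (\<lambda>w. lookup [] rs w = []) (concat (map (\<lambda>b. [b @ [X], b @ [Y]]) N))"

text \<open>Words none of whose nonempty prefixes has a rule. Words are reduced by appending letters
  on the right, so rules are attached to whole prefixes and not to inner subwords.\<close>

primrec normal_words :: "poly trie \<Rightarrow> nat \<Rightarrow> letter list list" where
  "normal_words rs 0 = [[]]"
| "normal_words rs (Suc d) = next_words rs (normal_words rs d)"

lemma set_next_words: "set (next_words rs N) = {b @ [l] |b l. b \<in> set N \<and> lookup [] rs (b @ [l]) = []}"
proof (intro equalityI subsetI)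
  fix w assume "w \<in> set (next_words rs N)"
  then obtain b where "b \<in> set N" "w = b @ [X] \<or> w = b @ [Y]" "lookup [] rs w = []"
    by (auto simp: next_words_def)
  then show "w \<in> {b @ [l] |b l. b \<in> set N \<and> lookup [] rs (b @ [l]) = []}" by blast
next
  fix w assume "w \<in> {b @ [l] |b l. b \<in> set N \<and> lookup [] rs (b @ [l]) = []}"
  then obtain b l where "w = b @ [l]" "b \<in> set N" "lookup [] rs (b @ [l]) = []" by blast
  then show "w \<in> set (next_words rs N)" by (cases l) (auto simp: next_words_def)
qed

lemma length_normal_words: "b \<in> set (normal_words rs d) \<Longrightarrow> length b = d"
  by (induction d arbitrary: b) (auto simp: set_next_words)

text \<open>The tail of a rule must already consist of normal words, so a single application of the
  rule ends the reduction of \<open>w\<close>.\<close>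

definition reducible :: "poly trie \<Rightarrow> letter list list \<Rightarrow> letter list \<Rightarrow> bool" where
  "reducible rs N w \<longleftrightarrow> (case lookup [] rs w of [] \<Rightarrow> True
     | (c, w') # p \<Rightarrow> c \<noteq> 0 \<and> w' = w \<and> list_all (\<lambda>(c, w). w \<in> set N) p)"

definition complete_rules :: "poly trie \<Rightarrow> nat \<Rightarrow> bool" where
  "complete_rules rs m \<longleftrightarrow> (\<forall>d<m. \<forall>b\<in>set (normal_words rs d). \<forall>l.
     reducible rs (normal_words rs (Suc d)) (b @ [l]))"

text \<open>Characteristic 0 enters here: the leading coefficients of the certificates are nonzero
  integers and are divided out.\<close>

lemma solve_in_algebra:
  fixes f g :: "'p \<Rightarrow> 'k::field_char_0"
  assumes "c \<noteq> 0" "(\<lambda>x. of_int c * f x + g x) \<in> generated_algebra S" "g \<in> generated_algebra S"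
  shows "f \<in> generated_algebra S"
proof -
  have "(\<lambda>x. (1 / of_int c) * ((\<lambda>x. of_int c * f x + g x) - g) x) \<in> generated_algebra S"
    using assms by (intro generated_algebra_scale generated_algebra_diff)
  then show ?thesis using assms(1) by simp
qed

text \<open>Induction on the length of the reduced prefix: its last letter moves into the right
  context, the shorter prefix is replaced by normal words, and each of these followed by that letter
  is normal again or has a rule.\<close>

lemma normal_words_suffice:
  assumes rs: "valid_rules S n rs" and cr: "complete_rules rs m" and d: "d \<le> m"
    and w: "length w = d" "u @ v \<noteq> []" "length u + d + length v = n"
    and normal: "\<And>b. b \<in> set (normal_words rs d) \<Longrightarrow> word_trace (u @ b @ v) \<in> generated_algebra S"
  shows "word_trace (u @ w @ v) \<in> generated_algebra S"
  using d w normal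
proof (induction d arbitrary: w v)
  case 0
  then show ?case by simp
next
  case (Suc d)
  obtain w' l where w: "w = w' @ [l]" "length w' = d"
    using Suc.prems(2) by (metis append_butlast_last_id diff_Suc_1 length_butlast length_0_conv nat.distinct(1))
  have step: "word_trace (u @ b @ l # v) \<in> generated_algebra S" if b: "b \<in> set (normal_words rs d)" for b
  proof (cases "lookup [] rs (b @ [l])")
    case Nil
    then have "b @ [l] \<in> set (normal_words rs (Suc d))"
      using b by (auto simp: set_next_words)
    then show ?thesis using Suc.prems(5)[of "b @ [l]"] by simp
  next
    case (Cons e p)
    have len: "length b = d" using b by (rule length_normal_words)
    have "reducible rs (normal_words rs (Suc d)) (b @ [l])"
      using cr b Suc.prems(1) by (simp add: complete_rules_def)
    then obtain c where e: "e = (c, b @ [l])" "c \<noteq> 0"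
      and p: "\<And>c w. (c, w) \<in> set p \<Longrightarrow> w \<in> set (normal_words rs (Suc d))"
      by (cases e) (auto simp: reducible_def Cons list_all_iff)
    have "poly_trace (context_poly u (lookup [] rs (b @ [l])) v) \<in> generated_algebra S"
      using rs Suc.prems(3,4) len by (auto simp: valid_rules_def)
    then have "(\<lambda>x. of_int c * word_trace (u @ b @ l # v) x + poly_trace (context_poly u p v) x) \<in> generated_algebra S"
      by (simp add: Cons e poly_trace_def[abs_def] context_poly_def)
    moreover have "poly_trace (context_poly u p v) \<in> generated_algebra S"
    proof -
      have "(\<lambda>x. \<Sum>(c, w)\<leftarrow>p. of_int c * word_trace (u @ w @ v) x) \<in> generated_algebra S"
        using p Suc.prems(5) by (intro sum_list_in_algebra) blast
      then show ?thesis
        by (simp add: poly_trace_def[abs_def] context_poly_def comp_def case_prod_unfold)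
    qed
    ultimately show ?thesis
      by (rule solve_in_algebra[OF e(2), of "word_trace (u @ b @ l # v)" "poly_trace (context_poly u p v)"])
  qed
  have "word_trace (u @ w' @ l # v) \<in> generated_algebra S"
    by (rule Suc.IH) (use Suc.prems(1,4) w(2) step in simp_all)
  then show ?case using w by simp
qed

section \<open>Cyclic words\<close>

fun lex_le :: "letter list \<Rightarrow> letter list \<Rightarrow> bool" where
  "lex_le [] v = True"
| "lex_le (l # u) [] = False"
| "lex_le (X # u) (X # v) = lex_le u v"
| "lex_le (X # u) (Y # v) = True"
| "lex_le (Y # u) (X # v) = False"
| "lex_le (Y # u) (Y # v) = lex_le u v"

text \<open>The first argument only counts the rotations still to be tried.\<close>

fun least_rotation :: "letter list \<Rightarrow> letter list \<Rightarrow> letter list \<Rightarrow> letter list" where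
  "least_rotation [] r best = best"
| "least_rotation (l # k) r best = (let r' = rotate1 r in least_rotation k r' (if lex_le r' best then r' else best))"

text \<open>Soundness rests on the result being a rotation of \<open>w\<close>; that it is the least
  one makes all rotations of a word meet in one key.\<close>

definition necklace :: "letter list \<Rightarrow> letter list" where
  "necklace w = least_rotation w w w"

lemma word_trace_rotate1: "word_trace (rotate1 w) = word_trace w"
  by (cases w) (simp_all add: word_trace_rotate[of _ "[_]"])

lemma word_trace_necklace:
  "word_trace (necklace w) = (word_trace w :: 'k::comm_ring_1 mat4 \<times> 'k mat4 \<Rightarrow> 'k)" (is "_ = ?t")
proof -
  have "word_trace (least_rotation k r b) = ?t" if "word_trace r = ?t" "word_trace b = ?t" for k r b
    using that by (induction k r b rule: least_rotation.induct) (auto simp: Let_def word_trace_rotate1)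
  then show ?thesis by (simp add: necklace_def)
qed

text \<open>There is no outer context at this stage, so every item must bring a nonempty one:
  \<open>Rel\<close> is excluded and \<open>Rule\<close> needs a nonempty right factor.\<close>

definition check_necklace :: "letter list list \<Rightarrow> poly trie \<Rightarrow> poly \<times> (int \<times> item) list \<Rightarrow> bool" where
  "check_necklace G rs = (\<lambda>(p, cert). fst (hd p) \<noteq> 0 \<and> p \<noteq> [] \<and> list_all (\<lambda>(c, w). w \<in> set G) (tl p) \<and>
     list_all (\<lambda>(c, it). case it of Rel zs \<Rightarrow> False
       | Rule u w v \<Rightarrow> v \<noteq> [] \<and> item_degree it = length (snd (hd p))) cert \<and>
     vanishes necklace (difference rs p cert))"

definition covers :: "letter list list \<Rightarrow> poly trie \<Rightarrow> nat \<Rightarrow> bool" where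
  "covers G rs m \<longleftrightarrow> (\<forall>d<m. \<forall>b\<in>set (normal_words rs d). \<forall>l. necklace (b @ [l]) \<in> set G)"

fun all_reducible :: "letter list list \<Rightarrow> poly trie \<Rightarrow> letter list list \<Rightarrow> letter list list \<Rightarrow> bool" where
  "all_reducible G rs N [] \<longleftrightarrow> True"
| "all_reducible G rs N (b # bs) \<longleftrightarrow> reducible rs N (b @ [X]) \<and> necklace (b @ [X]) \<in> set G \<and>
     reducible rs N (b @ [Y]) \<and> necklace (b @ [Y]) \<in> set G \<and> all_reducible G rs N bs"

text \<open>One pass over the levels of normal words checks that the rules are complete, that every
  cyclic word \<open>b @ [l]\<close> is accounted for and that no normal word is left at the
  end.\<close>

fun sweep :: "letter list list \<Rightarrow> poly trie \<Rightarrow> letter list list \<Rightarrow> nat \<Rightarrow> bool" where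
  "sweep G rs N 0 \<longleftrightarrow> N = []"
| "sweep G rs N (Suc k) \<longleftrightarrow> (let N' = next_words rs N in all_reducible G rs N' N \<and> sweep G rs N' k)"

lemma all_reducible_iff:
  "all_reducible G rs N bs \<longleftrightarrow> (\<forall>b\<in>set bs. \<forall>l. reducible rs N (b @ [l]) \<and> necklace (b @ [l]) \<in> set G)"
proof -
  have "(\<forall>l. P l) \<longleftrightarrow> P X \<and> P Y" for P :: "letter \<Rightarrow> bool" by (metis letter.exhaust)
  then show ?thesis by (induction bs) auto
qed

lemma sweep_normal_words:
  "sweep G rs (normal_words rs d) k \<Longrightarrow> normal_words rs (d + k) = [] \<and>
     (\<forall>e. d \<le> e \<longrightarrow> e < d + k \<longrightarrow> all_reducible G rs (normal_words rs (Suc e)) (normal_words rs e))"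
proof (induction k arbitrary: d)
  case (Suc k)
  have *: "all_reducible G rs (normal_words rs (Suc d)) (normal_words rs d)" "sweep G rs (normal_words rs (Suc d)) k"
    using Suc.prems by (auto simp: Let_def)
  have "all_reducible G rs (normal_words rs (Suc e)) (normal_words rs e)" if "d \<le> e" "e < d + Suc k" for e
    using Suc.IH[OF *(2)] *(1) that by (cases "e = d") auto
  then show ?case using Suc.IH[OF *(2)] by simp
qed simp

lemma sweep_complete:
  assumes "sweep G rs [[]] m"
  shows "normal_words rs m = []" "complete_rules rs m" "covers G rs m"
  using sweep_normal_words[of G rs 0 m] assms
  by (simp_all add: complete_rules_def covers_def all_reducible_iff)

lemma check_necklace_in_algebra:
  fixes S :: "('k::field_char_0 mat4 \<times> 'k mat4 \<Rightarrow> 'k) set"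
  assumes cl: "closed_below S n" and rs: "valid_rules S n rs" and G: "word_trace ` set G \<subseteq> generated_algebra S"
    and p: "check_necklace G rs (p, cert)" "length (snd (hd p)) = n"
  shows "word_trace (snd (hd p)) \<in> generated_algebra S"
proof -
  obtain c w q where pq: "p = (c, w) # q" "c \<noteq> 0"
    using p(1) by (cases p) (auto simp: check_necklace_def)
  have "poly_trace (context_poly [] (difference rs p cert) []) x = 0" for x :: "'k mat4 \<times> 'k mat4"
    using vanishes_sum[of necklace "difference rs p cert" "\<lambda>w. word_trace w x"] p(1)
    by (simp add: check_necklace_def poly_trace_def context_poly_def word_trace_necklace)
  then have "poly_trace (context_poly [] p [])
      = (\<lambda>x :: 'k mat4 \<times> 'k mat4. \<Sum>(c, it)\<leftarrow>cert. of_int c * poly_trace (context_poly [] (expand rs it) []) x)"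
    by (intro ext) (simp add: poly_trace_difference)
  also have "\<dots> \<in> generated_algebra S"
  proof (rule sum_list_in_algebra)
    fix c it assume it: "(c, it) \<in> set cert"
    then have "case it of Rel zs \<Rightarrow> False | Rule u w v \<Rightarrow> v \<noteq> [] \<and> item_degree it = length (snd (hd p))"
      using p(1) unfolding check_necklace_def list_all_iff by blast
    then obtain u w' v where "it = Rule u w' v" "v \<noteq> []" "length u + length w' + length v = n"
      using p(2) by (cases it) auto
    then show "poly_trace (context_poly [] (expand rs it) []) \<in> generated_algebra S"
      using rs by (simp add: context_poly_context valid_rules_def)
  qed
  finally have "(\<lambda>x. of_int c * word_trace w x + poly_trace q x) \<in> generated_algebra S"
    by (simp add: pq poly_trace_def[abs_def] context_poly_def)
  moreover have "poly_trace q \<in> generated_algebra S"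
    unfolding poly_trace_def[abs_def]
  proof (rule sum_list_in_algebra)
    fix d v assume "(d, v) \<in> set q"
    then have "v \<in> set G"
      using p(1) by (auto simp: pq check_necklace_def list_all_iff)
    then show "word_trace v \<in> generated_algebra S" using G by blast
  qed
  ultimately have "word_trace w \<in> generated_algebra S"
    by (rule solve_in_algebra[OF pq(2), of "word_trace w" "poly_trace q"])
  then show ?thesis by (simp add: pq(1))
qed

text \<open>Induction on the length of \<open>w\<close>. A word longer than \<open>m\<close> has a
  prefix of length \<open>m\<close> followed by a nonempty context, and there is no normal word of
  length \<open>m\<close>. A nonempty word of length at most \<open>m\<close> keeps its last letter
  as context while the rest is made normal; the resulting cyclic words are generators or have a
  certificate.\<close>

theorem words_generated:
  fixes S :: "('k::field_char_0 mat4 \<times> 'k mat4 \<Rightarrow> 'k) set"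
  assumes S: "word_trace ` set G \<subseteq> generated_algebra S"
    and rules: "derive_rules Tip cs = Some rs"
    and ncs: "list_all (check_necklace G rs) ncs"
    and sweep: "sweep (G @ map (\<lambda>(p, cert). snd (hd p)) ncs) rs [[]] m"
  shows "word_trace w \<in> generated_algebra S"
proof (induction "length w" arbitrary: w rule: less_induct)
  case less
  note nil = sweep_complete(1)[OF sweep] and cr = sweep_complete(2)[OF sweep] and cov = sweep_complete(3)[OF sweep]
  define n where "n = length w"
  have cl: "closed_below S n" using less by (simp add: closed_below_def n_def)
  have "poly_trace (context_poly u [] v) = (\<lambda>_ :: 'k mat4 \<times> 'k mat4. 0 :: 'k)" for u v
    by (simp add: poly_trace_def[abs_def] context_poly_def)
  then have "valid_rules S n Tip"
    by (simp add: valid_rules_def generated_algebra.const)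
  then have rs: "valid_rules S n rs"
    using derive_rules_valid[OF cl _ rules] by blast
  consider "n = 0" | d where "n = Suc d" "d < m" | "m < n" by (cases n; cases "n \<le> m") auto
  then show ?case
  proof cases
    case 1
    then have "word_trace w = (\<lambda>_. trace (mat 1 :: 'k mat4))" by (simp add: n_def word_trace_def fun_eq_iff)
    then show ?thesis by (simp add: generated_algebra.const)
  next
    case (2 d)
    then have "w \<noteq> []" by (auto simp: n_def)
    then have w: "w = [] @ butlast w @ [last w]" "length (butlast w) = d" using 2 by (simp_all add: n_def)
    have step: "word_trace ([] @ b @ [last w]) \<in> generated_algebra S" if b: "b \<in> set (normal_words rs d)" for b
    proof -
      have len: "length b = d" using b by (rule length_normal_words)
      let ?t = "necklace (b @ [last w])"
      have tr: "word_trace ?t = (word_trace (b @ [last w]) :: 'k mat4 \<times> 'k mat4 \<Rightarrow> 'k)"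
        by (rule word_trace_necklace)
      have "length ?t = n"
      proof -
        have "length (least_rotation k r b') = n" if "length r = n" "length b' = n" for k r b'
          using that by (induction k r b' rule: least_rotation.induct) (auto simp: Let_def)
        then show ?thesis using len 2 by (simp add: necklace_def)
      qed
      have "?t \<in> set (G @ map (\<lambda>(p, cert). snd (hd p)) ncs)"
        using cov b 2 unfolding covers_def by blast
      then consider "?t \<in> set G" | p cert where "(p, cert) \<in> set ncs" "?t = snd (hd p)" by auto
      then have "word_trace ?t \<in> generated_algebra S"
      proof cases
        case 1
        then show ?thesis using S by blast
      next
        case (2 p cert)
        then show ?thesis
          using ncs check_necklace_in_algebra[OF cl rs S, of p cert] \<open>length ?t = n\<close>
          by (auto simp: list_all_iff)
      qed
      then show ?thesis by (simp add: tr)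
    qed
    have "word_trace ([] @ butlast w @ [last w]) \<in> generated_algebra S"
      by (rule normal_words_suffice[OF rs cr, of d]) (use 2 w(2) step in simp_all)
    then show ?thesis using w(1) by metis
  next
    case 3
    have "word_trace ([] @ take m w @ drop m w) \<in> generated_algebra S"
      by (rule normal_words_suffice[OF rs cr order_refl]) (use 3 nil in \<open>simp_all add: n_def\<close>)
    then show ?thesis by simp
  qed
qed

text \<open>
  A pair \<open>(p, cert)\<close> asserts that \<open>p\<close> equals the combination \<open>cert\<close> of items: as noncommutative
  polynomials in \<open>rule_certs\<close>, and up to rotation of words in \<open>necklace_certs\<close>. The head of \<open>p\<close> is
  the term that is eliminated.
\<close>

definition rule_certs :: "(poly \<times> (int \<times> item) list) list" where
  "rule_certs = [
     ([(24, [X,X,X,X])], [(1, Rel [[X], [X], [X], [X]])]),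
     ([(6, [Y,X,X,X]), (6, [X,Y,X,X]), (6, [X,X,Y,X]), (6, [X,X,X,Y])], [(1, Rel [[X], [X], [X], [Y]])]),
     ([(4, [Y,Y,X,X]), (4, [Y,X,Y,X]), (4, [Y,X,X,Y]), (4, [X,Y,Y,X]), (4, [X,Y,X,Y]), (4, [X,X,Y,Y])], [(1, Rel
     [[X], [X], [Y], [Y]])]),
     ([(6, [Y,Y,Y,X]), (6, [Y,Y,X,Y]), (6, [Y,X,Y,Y]), (6, [X,Y,Y,Y])], [(1, Rel [[X], [Y], [Y], [Y]])]),
     ([(24, [Y,Y,Y,Y])], [(1, Rel [[Y], [Y], [Y], [Y]])]),
     ([(24, [X,Y,X,X,X]), (24, [X,X,Y,X,X]), (24, [X,X,X,Y,X])], [(4, Rule [] [Y,X,X,X] [X]), (-1, Rule [Y]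
     [X,X,X,X] [])]),
     ([(12, [X,Y,Y,X,X]), (12, [X,Y,X,Y,X]), (12, [X,Y,X,X,Y]), (12, [X,X,Y,Y,X]), (12, [X,X,Y,X,Y]), (12,
     [X,X,X,Y,Y])], [(3, Rule [] [Y,Y,X,X] [X]), (-2, Rule [Y] [Y,X,X,X] []), (2, Rule [] [Y,X,X,X] [Y])]),
     ([(12, [Y,X,Y,X,X]), (12, [Y,X,X,Y,X]), (12, [X,Y,X,Y,X]), (-12, [X,X,X,Y,Y])], [(-2, Rel [[X], [X], [X],
     [Y,Y]]), (3, Rule [] [Y,Y,X,X] [X])]),
     ([(12, [X,Y,Y,Y,X]), (12, [X,Y,Y,X,Y]), (12, [X,Y,X,Y,Y]), (12, [X,X,Y,Y,Y])], [(2, Rule [] [Y,Y,Y,X] [X]),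
     (-3, Rule [Y] [Y,Y,X,X] []), (3, Rule [] [Y,Y,X,X] [Y])]),
     ([(12, [Y,Y,X,Y,X]), (12, [Y,X,Y,Y,X]), (12, [Y,X,Y,X,Y]), (-12, [X,X,Y,Y,Y])], [(-6, Rel [[X], [X], [Y],
     [Y,Y]]), (3, Rule [] [Y,Y,X,X] [Y]), (4, Rule [] [Y,Y,Y,X] [X])]),
     ([(24, [X,Y,Y,Y,Y])], [(1, Rule [] [Y,Y,Y,Y] [X]), (-4, Rule [Y] [Y,Y,Y,X] []), (4, Rule [] [Y,Y,Y,X] [Y])]),
     ([(24, [X,X,Y,X,X,X]), (24, [X,X,X,Y,X,X])], [(1, Rule [X] [X,Y,X,X,X] []), (-1, Rule [] [X,X,X,X] [Y,X])]),
     ([(24, [X,X,Y,Y,X,X]), (24, [X,X,Y,X,Y,X]), (24, [X,X,Y,X,X,Y]), (24, [X,X,X,Y,Y,X]), (24, [X,X,X,Y,X,Y])],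
     [(2, Rule [X] [X,Y,Y,X,X] []), (-1, Rule [] [X,X,X,X] [Y,Y])]),
     ([(24, [X,Y,X,Y,X,X]), (24, [X,Y,X,X,Y,X]), (24, [X,X,Y,X,Y,X])], [(2, Rule [X] [Y,X,Y,X,X] []), (1, Rule []
     [X,X,X,X] [Y,Y])]),
     ([(12, [Y,X,X,Y,X,X]), (-12, [X,X,Y,X,Y,X]), (-12, [X,X,X,Y,Y,X]), (-12, [X,X,X,Y,X,Y])], [(-2, Rel [[X], [X],
     [X], [Y,X,Y]]), (1, Rule [] [Y,X,Y,X,X] [X])]),
     ([(12, [X,X,Y,Y,Y,X]), (12, [X,X,Y,Y,X,Y]), (12, [X,X,Y,X,Y,Y]), (12, [X,X,X,Y,Y,Y])], [(1, Rule [X]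
     [X,Y,Y,Y,X] [])]),
     ([(12, [X,Y,Y,X,Y,X]), (12, [X,Y,X,Y,Y,X]), (12, [X,Y,X,Y,X,Y]), (-12, [X,X,X,Y,Y,Y])], [(1, Rule [X]
     [Y,Y,X,Y,X] [])]),
     ([(12, [Y,X,Y,X,Y,X]), (12, [X,X,X,Y,Y,Y])], [(2, Rel [[X], [X], [X], [Y,Y,Y]]), (-2, Rule [Y,Y] [Y,X,X,X]
     []), (1, Rule [Y] [Y,X,Y,X,X] []), (2, Rule [Y] [Y,X,X,X] [Y]), (-1, Rule [] [Y,X,Y,X,X] [Y]), (-1, Rule []
     [X,Y,Y,Y,X] [X]), (1, Rule [X] [Y,Y,X,Y,X] [])]),
     ([(12, [Y,X,Y,Y,X,X]), (12, [Y,X,X,Y,Y,X]), (-12, [X,Y,X,Y,X,Y]), (-12, [X,Y,X,X,Y,Y]), (-12, [X,X,Y,X,Y,Y]),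
     (-12, [X,X,X,Y,Y,Y])], [(1, Rule [Y] [X,Y,Y,X,X] []), (-2, Rel [[X], [X], [X], [Y,Y,Y]]), (2, Rule [Y,Y]
     [Y,X,X,X] []), (-1, Rule [Y] [Y,X,Y,X,X] []), (-2, Rule [Y] [Y,X,X,X] [Y]), (1, Rule [] [X,Y,Y,Y,X] [X]), (-1,
     Rule [X] [Y,Y,X,Y,X] []), (-2, Rule [] [Y,X,X,X] [Y,Y])]),
     ([(24, [X,X,Y,Y,Y,Y])], [(1, Rule [X] [X,Y,Y,Y,Y] [])]),
     ([(12, [Y,X,Y,Y,Y,X]), (12, [Y,X,Y,Y,X,Y]), (12, [Y,X,Y,X,Y,Y]), (12, [Y,X,X,Y,Y,Y])], [(1, Rule [Y]
     [X,Y,Y,Y,X] [])]),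
     ([(12, [Y,Y,X,Y,Y,X]), (-12, [Y,X,Y,X,Y,Y]), (-12, [Y,X,X,Y,Y,Y]), (-12, [X,Y,X,Y,Y,Y])], [(-6, Rel [[X], [X],
     [Y], [Y,Y,Y]]), (6, Rule [Y,Y] [Y,Y,X,X] []), (-1, Rule [Y] [Y,Y,X,Y,X] []), (-3, Rule [Y] [Y,Y,X,X] [Y]), (1,
     Rule [X] [X,Y,Y,Y,Y] []), (-3, Rule [] [Y,Y,X,X] [Y,Y]), (1, Rule [Y] [X,Y,Y,Y,X] []), (1, Rule [] [X,Y,Y,Y,Y]
     [X]), (1, Rule [] [X,Y,Y,Y,X] [Y])]),
     ([(24, [Y,X,Y,Y,Y,Y])], [(1, Rule [Y] [X,Y,Y,Y,Y] [])]),
     ([(24, [X,X,X,Y,X,X,X])], [(1, Rule [X] [X,X,Y,X,X,X] []), (-1, Rule [X] [X,Y,X,X,X] [X]), (1, Rule []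
     [X,X,Y,X,X,X] [X])]),
     ([(24, [X,X,X,Y,Y,X,X]), (24, [X,X,X,Y,X,Y,X]), (24, [X,X,X,Y,X,X,Y])], [(1, Rule [X] [X,X,Y,Y,X,X] []), (-2,
     Rule [X] [X,Y,Y,X,X] [X]), (1, Rule [] [X,X,Y,Y,X,X] [X]), (-1, Rule [X] [X,Y,X,X,X] [Y]), (1, Rule []
     [X,X,Y,X,X,X] [Y])]),
     ([(24, [X,X,Y,X,Y,X,X]), (24, [X,X,Y,X,X,Y,X]), (24, [X,X,X,Y,X,Y,X])], [(1, Rule [X] [X,Y,X,Y,X,X] [])]),
     ([(24, [X,Y,X,X,Y,X,X]), (-24, [X,X,X,Y,X,Y,X])], [(2, Rule [X] [Y,X,X,Y,X,X] []), (2, Rule [X] [X,Y,Y,X,X]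
     [X]), (-1, Rule [] [X,X,Y,Y,X,X] [X]), (1, Rule [X] [X,Y,X,X,X] [Y]), (-1, Rule [] [X,X,Y,X,X,X] [Y])]),
     ([(24, [X,X,X,Y,Y,Y,X]), (24, [X,X,X,Y,Y,X,Y]), (24, [X,X,X,Y,X,Y,Y])], [(2, Rule [X] [X,X,Y,Y,Y,X] []), (-2,
     Rule [X] [X,Y,Y,X,X] [Y]), (1, Rule [] [X,X,Y,Y,X,X] [Y])]),
     ([(24, [X,X,Y,Y,X,Y,X]), (24, [X,X,Y,X,Y,Y,X]), (24, [X,X,Y,X,Y,X,Y])], [(2, Rule [X] [X,Y,Y,X,Y,X] []), (2,
     Rule [X] [X,Y,Y,X,X] [Y]), (-1, Rule [] [X,X,Y,Y,X,X] [Y])]),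
     ([(24, [X,Y,X,Y,X,Y,X])], [(2, Rule [X] [Y,X,Y,X,Y,X] []), (-2, Rule [X] [X,Y,Y,X,X] [Y]), (1, Rule []
     [X,X,Y,Y,X,X] [Y])]),
     ([(24, [Y,X,X,Y,X,Y,X]), (-24, [X,Y,X,X,Y,Y,X]), (-24, [X,Y,X,X,Y,X,Y]), (24, [X,X,Y,X,Y,Y,X]), (24,
     [X,X,Y,X,Y,X,Y]), (24, [X,X,Y,X,X,Y,Y]), (72, [X,X,X,Y,X,Y,Y])], [(4, Rel [[X], [X], [X], [Y,X,Y,Y]]), (1,
     Rule [Y] [X,X,Y,Y,X,X] []), (-2, Rule [] [Y,X,X,Y,X,X] [Y]), (-2, Rule [Y] [X,Y,Y,X,X] [X]), (1, Rule [Y]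
     [X,Y,X,Y,X,X] []), (2, Rule [] [Y,X,Y,X,X] [X,Y]), (-1, Rule [Y] [X,Y,X,X,X] [Y]), (-1, Rule [] [X,Y,X,Y,X,X]
     [Y]), (-2, Rule [X] [Y,X,Y,Y,X,X] []), (-2, Rule [X] [X,Y,Y,X,X] [Y]), (1, Rule [] [X,X,Y,Y,X,X] [Y])]),
     ([(24, [X,Y,X,Y,Y,X,X]), (24, [X,Y,X,X,Y,Y,X]), (-24, [X,X,Y,X,Y,X,Y]), (-24, [X,X,Y,X,X,Y,Y]), (-24,
     [X,X,X,Y,X,Y,Y])], [(2, Rule [X] [Y,X,Y,Y,X,X] []), (2, Rule [X] [X,Y,Y,X,X] [Y]), (-1, Rule [] [X,X,Y,Y,X,X]
     [Y])]),
     ([(24, [Y,X,X,Y,Y,X,X]), (-48, [X,X,Y,X,Y,Y,X]), (-24, [X,X,Y,X,Y,X,Y]), (-24, [X,X,Y,X,X,Y,Y]), (24,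
     [X,X,X,Y,Y,X,Y]), (-24, [X,X,X,Y,X,Y,Y])], [(-4, Rel [[X], [X], [X], [Y,X,Y,Y]]), (2, Rule [X] [Y,X,Y,Y,X,X]
     []), (-2, Rule [X] [X,Y,Y,X,X] [Y]), (1, Rule [] [X,X,Y,Y,X,X] [Y]), (2, Rule [] [Y,X,Y,Y,X,X] [X]), (2, Rule
     [X] [Y,X,Y,X,Y,X] []), (2, Rule [X] [X,X,Y,Y,Y,X] [])]),
     ([(24, [X,X,X,Y,Y,Y,Y])], [(1, Rule [X] [X,X,Y,Y,Y,Y] [])]),
     ([(12, [X,Y,X,Y,Y,Y,X]), (12, [X,Y,X,Y,Y,X,Y]), (12, [X,Y,X,Y,X,Y,Y]), (12, [X,Y,X,X,Y,Y,Y])], [(1, Rule [X]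
     [Y,X,Y,Y,Y,X] [])]),
     ([(24, [Y,X,X,Y,Y,Y,X]), (24, [Y,X,X,Y,Y,X,Y]), (24, [Y,X,X,Y,X,Y,Y]), (-24, [X,Y,X,X,Y,Y,Y]), (-24,
     [X,X,Y,X,Y,Y,Y])], [(2, Rule [Y] [X,X,Y,Y,Y,X] []), (2, Rule [] [Y,X,Y,X,X] [Y,Y]), (-2, Rule [Y] [X,Y,Y,X,X]
     [Y]), (2, Rule [] [Y,X,Y,Y,X,X] [Y]), (2, Rule [] [Y,X,Y,X,Y,X] [Y]), (1, Rule [X] [X,X,Y,Y,Y,Y] [])]),
     ([(12, [X,Y,Y,X,Y,Y,X]), (-12, [X,Y,X,Y,X,Y,Y]), (-12, [X,Y,X,X,Y,Y,Y]), (-12, [X,X,Y,X,Y,Y,Y])], [(1, Rule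
     [X] [Y,Y,X,Y,Y,X] [])]),
     ([(24, [Y,X,Y,X,Y,Y,X]), (-24, [Y,X,X,Y,Y,X,Y]), (24, [Y,X,X,Y,X,Y,Y]), (-24, [X,Y,X,Y,Y,X,Y]), (24,
     [X,Y,X,Y,X,Y,Y]), (24, [X,X,Y,Y,X,Y,Y]), (72, [X,X,Y,X,Y,Y,Y])], [(12, Rel [[X], [X], [Y], [Y,X,Y,Y]]), (-2,
     Rule [] [Y,Y,X,Y,Y,X] [X]), (-4, Rule [X] [Y,X,Y,Y,Y,X] []), (-2, Rule [] [Y,X,Y,Y,Y,X] [X]), (-2, Rule []
     [Y,X,Y,Y,X,X] [Y]), (-2, Rule [X] [Y,Y,X,Y,Y,X] []), (-1, Rule [X] [X,X,Y,Y,Y,Y] [])]),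
     ([(24, [Y,X,Y,Y,X,Y,X]), (24, [Y,X,X,Y,Y,X,Y]), (-24, [Y,X,X,Y,X,Y,Y]), (24, [X,Y,X,Y,Y,X,Y]), (-24,
     [X,Y,X,Y,X,Y,Y]), (24, [X,Y,X,X,Y,Y,Y]), (-24, [X,X,Y,Y,X,Y,Y]), (-48, [X,X,Y,X,Y,Y,Y])], [(2, Rule [Y]
     [X,Y,Y,X,Y,X] []), (-12, Rel [[X], [X], [Y], [Y,X,Y,Y]]), (2, Rule [] [Y,Y,X,Y,Y,X] [X]), (4, Rule [X]
     [Y,X,Y,Y,Y,X] []), (2, Rule [] [Y,X,Y,Y,Y,X] [X]), (2, Rule [X] [Y,Y,X,Y,Y,X] []), (-4, Rule [] [Y,X,Y,X,Y,X]
     [Y]), (-2, Rule [] [Y,X,Y,X,X] [Y,Y]), (2, Rule [Y] [X,Y,Y,X,X] [Y]), (1, Rule [X] [X,X,Y,Y,Y,Y] [])]),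
     ([(24, [X,Y,X,Y,Y,Y,Y])], [(1, Rule [X] [Y,X,Y,Y,Y,Y] [])]),
     ([(24, [Y,X,X,Y,Y,Y,Y])], [(1, Rule [Y] [X,X,Y,Y,Y,Y] [])]),
     ([(12, [Y,Y,X,Y,Y,Y,X]), (-12, [Y,X,Y,Y,X,Y,Y]), (-12, [Y,X,Y,X,Y,Y,Y]), (-12, [X,Y,Y,X,Y,Y,Y])], [(1, Rule
     [Y] [Y,X,Y,Y,Y,X] []), (-1, Rule [] [Y,Y,X,Y,Y,X] [Y]), (-1, Rule [] [Y,Y,X,Y,X] [Y,Y]), (-3, Rule []
     [Y,Y,X,X] [Y,Y,Y])]),
     ([(24, [Y,Y,X,Y,Y,Y,Y])], [(1, Rule [Y] [Y,X,Y,Y,Y,Y] [])]),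
     ([(24, [X,X,X,Y,X,Y,X,X]), (24, [X,X,X,Y,X,X,Y,X])], [(1, Rule [X] [X,X,Y,X,Y,X,X] []), (-1, Rule []
     [X,Y,X,X,X] [Y,X,X]), (1, Rule [X,Y] [X,X,Y,X,X,X] []), (-1, Rule [] [X,Y,X,X,Y,X,X] [X]), (1, Rule [X]
     [X,Y,X,X,Y,X,X] [])]),
     ([(24, [X,X,Y,X,X,Y,X,X])], [(1, Rule [] [X,Y,X,X,X] [Y,X,X]), (-1, Rule [X,Y] [X,X,Y,X,X,X] []), (1, Rule []
     [X,Y,X,X,Y,X,X] [X])]),
     ([(96, [X,X,X,Y,X,Y,Y,X]), (96, [X,X,X,Y,X,Y,X,Y]), (96, [X,X,X,Y,X,X,Y,Y])], [(4, Rel [[X], [X], [X],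
     [Y,X,X,Y,Y]]), (-1, Rule [] [Y,X,X,Y,Y,X,X] [X]), (-2, Rule [X] [X,Y,X,Y,Y,X,X] []), (-1, Rule [X]
     [X,Y,X,Y,X,Y,X] []), (1, Rule [X] [X,X,Y,Y,X,Y,X] []), (-5, Rule [X] [Y,X,X,Y,Y,X,X] []), (5, Rule [X]
     [X,X,Y,Y,X,X] [Y]), (-5, Rule [] [X,X,X,Y,Y,X,X] [Y]), (-4, Rule [] [X,Y,X,X,X] [Y,X,Y]), (-4, Rule []
     [X,Y,X,X,X] [Y,Y,X]), (4, Rule [X,Y] [X,X,Y,Y,X,X] []), (-4, Rule [X] [Y,X,X,Y,X,Y,X] []), (-4, Rule []
     [X,Y,X,X,Y,X,X] [Y])]),
     ([(96, [X,X,X,Y,Y,X,Y,X]), (-96, [X,X,X,Y,X,X,Y,Y])], [(3, Rule [X] [X,X,Y,Y,X,Y,X] []), (-4, Rel [[X], [X],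
     [X], [Y,X,X,Y,Y]]), (1, Rule [] [Y,X,X,Y,Y,X,X] [X]), (2, Rule [X] [X,Y,X,Y,Y,X,X] []), (1, Rule [X]
     [X,Y,X,Y,X,Y,X] []), (5, Rule [X] [Y,X,X,Y,Y,X,X] []), (-5, Rule [X] [X,X,Y,Y,X,X] [Y]), (5, Rule []
     [X,X,X,Y,Y,X,X] [Y]), (4, Rule [] [X,Y,X,X,X] [Y,X,Y]), (4, Rule [] [X,Y,X,X,X] [Y,Y,X]), (-4, Rule [X,Y]
     [X,X,Y,Y,X,X] []), (4, Rule [X] [Y,X,X,Y,X,Y,X] []), (4, Rule [] [X,Y,X,X,Y,X,X] [Y])]),
     ([(24, [X,X,Y,X,Y,X,Y,X])], [(1, Rule [X] [X,Y,X,Y,X,Y,X] [])]),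
     ([(96, [X,Y,X,X,Y,X,Y,X]), (-96, [X,X,Y,X,X,Y,Y,X]), (-96, [X,X,Y,X,X,Y,X,Y])], [(-4, Rule [X] [Y,X,X,Y,X,Y,X]
     []), (-4, Rel [[X], [X], [X], [Y,X,X,Y,Y]]), (1, Rule [] [Y,X,X,Y,Y,X,X] [X]), (2, Rule [X] [X,Y,X,Y,Y,X,X]
     []), (1, Rule [X] [X,Y,X,Y,X,Y,X] []), (-1, Rule [X] [X,X,Y,Y,X,Y,X] []), (-7, Rule [X] [Y,X,X,Y,Y,X,X] []),
     (7, Rule [X] [X,X,Y,Y,X,X] [Y]), (-7, Rule [] [X,X,X,Y,Y,X,X] [Y]), (-8, Rule [] [X,Y,X,X,X] [Y,X,Y]), (-8,
     Rule [] [X,Y,X,X,X] [Y,Y,X]), (8, Rule [X,Y] [X,X,Y,Y,X,X] []), (-8, Rule [] [X,Y,X,X,Y,X,X] [Y])]),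
     ([(24, [X,X,Y,X,Y,Y,X,X]), (24, [X,X,Y,X,X,Y,Y,X]), (-24, [X,X,X,Y,X,Y,X,Y]), (-24, [X,X,X,Y,X,X,Y,Y])], [(1,
     Rule [X] [X,Y,X,Y,Y,X,X] []), (1, Rule [] [X,Y,X,X,X] [Y,X,Y]), (1, Rule [] [X,Y,X,X,X] [Y,Y,X]), (-1, Rule
     [X,Y] [X,X,Y,Y,X,X] []), (1, Rule [X] [Y,X,X,Y,Y,X,X] []), (1, Rule [X] [Y,X,X,Y,X,Y,X] []), (1, Rule []
     [X,Y,X,X,Y,X,X] [Y]), (-1, Rule [X] [X,X,Y,Y,X,X] [Y]), (1, Rule [] [X,X,X,Y,Y,X,X] [Y])]),
     ([(48, [X,Y,X,X,Y,Y,X,X]), (48, [X,X,X,Y,X,Y,X,Y]), (48, [X,X,X,Y,X,X,Y,Y])], [(1, Rule [X] [Y,X,X,Y,Y,X,X]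
     []), (4, Rel [[X], [X], [X], [Y,X,X,Y,Y]]), (-1, Rule [] [Y,X,X,Y,Y,X,X] [X]), (-2, Rule [X] [X,Y,X,Y,Y,X,X]
     []), (-1, Rule [X] [X,Y,X,Y,X,Y,X] []), (1, Rule [X] [X,X,Y,Y,X,Y,X] []), (-1, Rule [X] [X,X,Y,Y,X,X] [Y]),
     (1, Rule [] [X,X,X,Y,Y,X,X] [Y])]),
     ([(96, [X,X,X,Y,X,Y,Y,Y])], [(4, Rel [[X], [X], [X], [Y,X,Y,Y,Y]]), (-2, Rule [] [Y,X,Y,Y,Y,X] [X,X]), (1,
     Rule [] [Y,X,Y,Y,X,Y,X] [X]), (1, Rule [] [Y,X,Y,X,Y,Y,X] [X]), (1, Rule [] [Y,X,X,Y,Y,Y,X] [X]), (-1, Rule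
     [Y] [X,X,Y,Y,X,Y,X] []), (1, Rule [] [Y,X,X,Y,X,Y,X] [Y]), (-2, Rule [] [X,Y,X,Y,Y,Y,X] [X]), (1, Rule [X]
     [Y,X,Y,Y,X,Y,X] []), (1, Rule [X] [Y,X,Y,X,Y,Y,X] []), (1, Rule [X] [Y,X,X,Y,Y,Y,X] []), (-2, Rule [X]
     [X,Y,X,Y,Y,Y,X] [])]),
     ([(96, [X,Y,X,X,Y,Y,X,Y]), (-96, [X,Y,X,X,Y,X,Y,Y]), (-96, [X,X,Y,X,Y,Y,X,Y]), (-192, [X,X,Y,X,Y,X,Y,Y])],
     [(12, Rel [[X], [X], [X], [Y,Y,X,Y,Y]]), (-2, Rule [Y] [Y,X,Y,Y,X,X] [X]), (1, Rule [Y] [Y,X,X,Y,Y,X,X] []),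
     (-1, Rule [] [Y,X,X,Y,X,Y,X] [Y]), (-2, Rule [Y] [X,Y,X,Y,X,Y,X] []), (-2, Rule [Y] [X,Y,X,Y,Y,X,X] []), (-1,
     Rule [Y] [X,X,Y,Y,X,Y,X] []), (-18, Rule [X] [X,Y,X,Y,Y,Y,X] []), (-2, Rule [Y] [X,X,X,Y,Y,Y,X] []), (5, Rule
     [X] [Y,X,Y,Y,X,Y,X] []), (-4, Rule [] [Y,Y,X,Y,Y,X] [X,X]), (1, Rule [] [Y,X,X,Y,Y,Y,X] [X]), (-10, Rule []
     [X,Y,X,Y,Y,Y,X] [X]), (2, Rule [Y] [X,Y,Y,X,X] [Y,X]), (-2, Rule [] [Y,X,Y,Y,X,X] [Y,X]), (1, Rule [X]
     [Y,X,Y,X,Y,Y,X] []), (-1, Rule [X] [Y,X,X,Y,Y,Y,X] []), (-1, Rule [] [X,X,X,Y,Y,Y,Y] [X]), (1, Rule [Y]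
     [X,X,Y,Y,X,X] [Y]), (-1, Rule [] [Y,X,X,Y,Y,X,X] [Y]), (-4, Rule [] [Y,X,X,Y,X,X] [Y,Y]), (-6, Rule []
     [X,Y,Y,X,Y,Y,X] [X]), (-6, Rule [X] [X,Y,Y,X,Y,Y,X] []), (12, Rel [[X], [X], [X], [Y,X,Y,Y,Y]]), (-6, Rule []
     [Y,X,Y,Y,Y,X] [X,X]), (3, Rule [] [Y,X,Y,Y,X,Y,X] [X]), (3, Rule [] [Y,X,Y,X,Y,Y,X] [X])]),
     ([(12, [X,X,Y,X,Y,Y,Y,X]), (12, [X,X,Y,X,Y,Y,X,Y]), (12, [X,X,Y,X,Y,X,Y,Y]), (12, [X,X,Y,X,X,Y,Y,Y])], [(1,
     Rule [X] [X,Y,X,Y,Y,Y,X] [])]),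
     ([(96, [X,Y,X,X,Y,Y,Y,X]), (192, [X,Y,X,X,Y,X,Y,Y]), (96, [X,X,Y,X,Y,Y,X,Y]), (192, [X,X,Y,X,Y,X,Y,Y]), (-96,
     [X,X,Y,X,X,Y,Y,Y])], [(6, Rule [X] [Y,X,X,Y,Y,Y,X] []), (-12, Rel [[X], [X], [X], [Y,Y,X,Y,Y]]), (2, Rule [Y]
     [Y,X,Y,Y,X,X] [X]), (-1, Rule [Y] [Y,X,X,Y,Y,X,X] []), (2, Rule [] [Y,X,X,Y,X,Y,X] [Y]), (2, Rule [Y]
     [X,Y,X,Y,X,Y,X] []), (2, Rule [Y] [X,Y,X,Y,Y,X,X] []), (16, Rule [X] [X,Y,X,Y,Y,Y,X] []), (2, Rule [Y]
     [X,X,X,Y,Y,Y,X] []), (-4, Rule [X] [Y,X,Y,Y,X,Y,X] []), (4, Rule [] [Y,Y,X,Y,Y,X] [X,X]), (8, Rule []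
     [X,Y,X,Y,Y,Y,X] [X]), (-2, Rule [Y] [X,Y,Y,X,X] [Y,X]), (2, Rule [] [Y,X,Y,Y,X,X] [Y,X]), (1, Rule []
     [X,X,X,Y,Y,Y,Y] [X]), (-1, Rule [Y] [X,X,Y,Y,X,X] [Y]), (1, Rule [] [Y,X,X,Y,Y,X,X] [Y]), (4, Rule []
     [Y,X,X,Y,X,X] [Y,Y]), (6, Rule [] [X,Y,Y,X,Y,Y,X] [X]), (6, Rule [X] [X,Y,Y,X,Y,Y,X] []), (-8, Rel [[X], [X],
     [X], [Y,X,Y,Y,Y]]), (4, Rule [] [Y,X,Y,Y,Y,X] [X,X]), (-2, Rule [] [Y,X,Y,Y,X,Y,X] [X]), (-2, Rule []
     [Y,X,Y,X,Y,Y,X] [X])]),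
     ([(96, [X,X,Y,Y,X,Y,Y,X]), (-96, [X,X,Y,X,Y,X,Y,Y]), (-96, [X,X,Y,X,X,Y,Y,Y])], [(8, Rule [X] [X,Y,Y,X,Y,Y,X]
     []), (4, Rel [[X], [X], [X], [Y,X,Y,Y,Y]]), (-2, Rule [] [Y,X,Y,Y,Y,X] [X,X]), (1, Rule [] [Y,X,Y,Y,X,Y,X]
     [X]), (1, Rule [] [Y,X,Y,X,Y,Y,X] [X]), (1, Rule [] [Y,X,X,Y,Y,Y,X] [X]), (-1, Rule [Y] [X,X,Y,Y,X,Y,X] []),
     (1, Rule [] [Y,X,X,Y,X,Y,X] [Y]), (-2, Rule [] [X,Y,X,Y,Y,Y,X] [X]), (1, Rule [X] [Y,X,Y,Y,X,Y,X] []), (1,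
     Rule [X] [Y,X,Y,X,Y,Y,X] []), (1, Rule [X] [Y,X,X,Y,Y,Y,X] []), (-2, Rule [X] [X,Y,X,Y,Y,Y,X] [])]),
     ([(96, [X,Y,X,Y,X,Y,Y,X]), (-192, [X,X,Y,X,Y,Y,X,Y]), (-96, [X,X,Y,X,Y,X,Y,Y]), (96, [X,X,X,Y,Y,X,Y,Y])], [(2,
     Rule [X] [Y,X,Y,X,Y,Y,X] []), (12, Rel [[X], [X], [X], [Y,Y,X,Y,Y]]), (-2, Rule [Y] [Y,X,Y,Y,X,X] [X]), (1,
     Rule [Y] [Y,X,X,Y,Y,X,X] []), (-4, Rule [] [Y,X,X,Y,X,Y,X] [Y]), (-2, Rule [Y] [X,Y,X,Y,X,Y,X] []), (-2, Rule
     [Y] [X,Y,X,Y,Y,X,X] []), (2, Rule [Y] [X,X,Y,Y,X,Y,X] []), (-12, Rule [X] [X,Y,X,Y,Y,Y,X] []), (-2, Rule [Y]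
     [X,X,X,Y,Y,Y,X] []), (2, Rule [X] [Y,X,Y,Y,X,Y,X] []), (-4, Rule [] [Y,Y,X,Y,Y,X] [X,X]), (-2, Rule []
     [Y,X,X,Y,Y,Y,X] [X]), (-4, Rule [] [X,Y,X,Y,Y,Y,X] [X]), (2, Rule [Y] [X,Y,Y,X,X] [Y,X]), (-2, Rule []
     [Y,X,Y,Y,X,X] [Y,X]), (-4, Rule [X] [Y,X,X,Y,Y,Y,X] []), (-1, Rule [] [X,X,X,Y,Y,Y,Y] [X]), (1, Rule [Y]
     [X,X,Y,Y,X,X] [Y]), (-1, Rule [] [Y,X,X,Y,Y,X,X] [Y]), (-4, Rule [] [Y,X,X,Y,X,X] [Y,Y]), (-6, Rule []
     [X,Y,Y,X,Y,Y,X] [X]), (-6, Rule [X] [X,Y,Y,X,Y,Y,X] [])]),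
     ([(96, [Y,X,X,Y,X,Y,Y,X]), (96, [X,Y,X,X,Y,X,Y,Y]), (96, [X,X,Y,X,Y,Y,X,Y]), (96, [X,X,Y,X,Y,X,Y,Y]), (-96,
     [X,X,Y,X,X,Y,Y,Y]), (-96, [X,X,X,Y,Y,X,Y,Y])], [(8, Rule [] [Y,Y,X,Y,Y,X] [X,X]), (2, Rule [Y] [Y,X,Y,Y,X,X]
     [X]), (-1, Rule [Y] [Y,X,X,Y,Y,X,X] []), (2, Rule [Y] [X,Y,X,Y,X,Y,X] []), (1, Rule [] [Y,X,Y,X,Y,Y,X] [X]),
     (-1, Rule [Y] [X,X,Y,Y,X,Y,X] []), (6, Rule [X] [X,Y,Y,X,Y,Y,X] []), (10, Rule [X] [X,Y,X,Y,Y,Y,X] []), (2,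
     Rule [Y] [X,X,X,Y,Y,Y,X] []), (-3, Rule [X] [Y,X,Y,Y,X,Y,X] []), (-1, Rule [X] [Y,X,Y,X,Y,Y,X] []), (2, Rule
     [Y] [X,Y,X,Y,Y,X,X] []), (3, Rule [] [Y,X,X,Y,X,Y,X] [Y]), (3, Rule [] [Y,X,X,Y,Y,Y,X] [X]), (10, Rule []
     [X,Y,X,Y,Y,Y,X] [X]), (-2, Rule [Y] [X,Y,Y,X,X] [Y,X]), (2, Rule [] [Y,X,Y,Y,X,X] [Y,X]), (5, Rule [X]
     [Y,X,X,Y,Y,Y,X] []), (1, Rule [] [X,X,X,Y,Y,Y,Y] [X]), (-1, Rule [Y] [X,X,Y,Y,X,X] [Y]), (1, Rule []
     [Y,X,X,Y,Y,X,X] [Y]), (4, Rule [] [Y,X,X,Y,X,X] [Y,Y]), (-20, Rel [[X], [X], [X], [Y,Y,X,Y,Y]]), (10, Rule []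
     [X,Y,Y,X,Y,Y,X] [X]), (-4, Rel [[X], [X], [X], [Y,X,Y,Y,Y]]), (2, Rule [] [Y,X,Y,Y,Y,X] [X,X]), (-1, Rule []
     [Y,X,Y,Y,X,Y,X] [X])]),
     ([(96, [X,Y,X,Y,Y,X,Y,X]), (192, [X,X,Y,X,Y,Y,X,Y]), (96, [X,X,Y,X,Y,X,Y,Y]), (96, [X,X,Y,X,X,Y,Y,Y]), (-96,
     [X,X,X,Y,Y,X,Y,Y])], [(1, Rule [X] [Y,X,Y,Y,X,Y,X] []), (-12, Rel [[X], [X], [X], [Y,Y,X,Y,Y]]), (2, Rule [Y]
     [Y,X,Y,Y,X,X] [X]), (-1, Rule [Y] [Y,X,X,Y,Y,X,X] []), (3, Rule [] [Y,X,X,Y,X,Y,X] [Y]), (2, Rule [Y]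
     [X,Y,X,Y,X,Y,X] []), (2, Rule [Y] [X,Y,X,Y,Y,X,X] []), (-1, Rule [Y] [X,X,Y,Y,X,Y,X] []), (14, Rule [X]
     [X,Y,X,Y,Y,Y,X] []), (2, Rule [Y] [X,X,X,Y,Y,Y,X] []), (4, Rule [] [Y,Y,X,Y,Y,X] [X,X]), (1, Rule []
     [Y,X,X,Y,Y,Y,X] [X]), (6, Rule [] [X,Y,X,Y,Y,Y,X] [X]), (-2, Rule [Y] [X,Y,Y,X,X] [Y,X]), (2, Rule []
     [Y,X,Y,Y,X,X] [Y,X]), (1, Rule [X] [Y,X,Y,X,Y,Y,X] []), (3, Rule [X] [Y,X,X,Y,Y,Y,X] []), (1, Rule []
     [X,X,X,Y,Y,Y,Y] [X]), (-1, Rule [Y] [X,X,Y,Y,X,X] [Y]), (1, Rule [] [Y,X,X,Y,Y,X,X] [Y]), (4, Rule []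
     [Y,X,X,Y,X,X] [Y,Y]), (6, Rule [] [X,Y,Y,X,Y,Y,X] [X]), (6, Rule [X] [X,Y,Y,X,Y,Y,X] []), (-4, Rel [[X], [X],
     [X], [Y,X,Y,Y,Y]]), (2, Rule [] [Y,X,Y,Y,Y,X] [X,X]), (-1, Rule [] [Y,X,Y,Y,X,Y,X] [X]), (-1, Rule []
     [Y,X,Y,X,Y,Y,X] [X])]),
     ([(96, [Y,X,X,Y,Y,X,Y,X]), (96, [X,Y,X,X,Y,X,Y,Y]), (-96, [X,X,Y,X,Y,Y,X,Y]), (96, [X,X,X,Y,Y,X,Y,Y])], [(3,
     Rule [Y] [X,X,Y,Y,X,Y,X] []), (-4, Rule [] [Y,Y,X,Y,Y,X] [X,X]), (1, Rule [X] [Y,X,Y,Y,X,Y,X] []), (3, Rule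
     [X] [Y,X,Y,X,Y,Y,X] []), (-3, Rule [] [Y,X,X,Y,X,Y,X] [Y]), (-6, Rule [] [X,Y,X,Y,Y,Y,X] [X]), (8, Rel [[X],
     [X], [X], [Y,Y,X,Y,Y]]), (-4, Rule [] [X,Y,Y,X,Y,Y,X] [X]), (4, Rel [[X], [X], [X], [Y,X,Y,Y,Y]]), (-2, Rule
     [] [Y,X,Y,Y,Y,X] [X,X]), (1, Rule [] [Y,X,Y,Y,X,Y,X] [X]), (-1, Rule [] [Y,X,Y,X,Y,Y,X] [X]), (-1, Rule []
     [Y,X,X,Y,Y,Y,X] [X]), (-1, Rule [X] [Y,X,X,Y,Y,Y,X] []), (2, Rule [X] [X,Y,X,Y,Y,Y,X] [])]),
     ([(24, [X,X,Y,X,Y,Y,Y,Y])], [(1, Rule [X] [X,Y,X,Y,Y,Y,Y] [])]),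
     ([(24, [X,Y,X,X,Y,Y,Y,Y])], [(1, Rule [X] [Y,X,X,Y,Y,Y,Y] [])]),
     ([(192, [Y,X,X,Y,X,Y,Y,Y]), (192, [X,Y,X,Y,X,Y,Y,Y]), (192, [X,X,Y,Y,X,Y,Y,Y])], [(24, Rel [[X], [X], [Y],
     [Y,X,Y,Y,Y]]), (-2, Rule [] [Y,Y,X,Y,Y,Y,X] [X]), (-2, Rule [] [Y,X,Y,Y,Y,Y] [X,X]), (-4, Rule []
     [Y,X,Y,Y,Y,X] [Y,X]), (1, Rule [] [Y,X,X,Y,Y,Y,Y] [X]), (-4, Rule [] [Y,X,Y,Y,Y,X] [X,Y]), (3, Rule []
     [Y,X,Y,X,Y,Y,X] [Y]), (4, Rule [] [Y,X,X,Y,Y,Y,X] [Y]), (-4, Rule [Y] [X,Y,X,Y,Y,Y,X] []), (4, Rule [Y]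
     [X,Y,Y,X,Y,X] [Y]), (4, Rule [X] [Y,X,X,Y,Y,Y,Y] []), (-7, Rule [X] [X,Y,X,Y,Y,Y,Y] []), (4, Rule []
     [Y,Y,X,Y,Y,X] [X,Y]), (-4, Rule [Y] [Y,X,Y,Y,X,X] [Y]), (-2, Rule [Y] [Y,X,Y,Y,Y,X] [X]), (2, Rule [Y]
     [X,Y,Y,X,Y,Y,X] []), (2, Rule [Y] [Y,X,Y,Y,X,Y,X] []), (1, Rule [Y] [Y,X,Y,X,Y,Y,X] []), (1, Rule [Y]
     [Y,X,X,Y,Y,Y,X] []), (-6, Rule [X] [Y,Y,X,Y,Y,Y,X] []), (-2, Rule [] [Y,Y,X,Y,Y,X] [Y,X]), (-3, Rule []
     [X,Y,X,Y,Y,Y,Y] [X])]),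
     ([(12, [X,Y,Y,X,Y,Y,Y,X]), (-12, [X,Y,X,Y,Y,X,Y,Y]), (-12, [X,Y,X,Y,X,Y,Y,Y]), (-12, [X,X,Y,Y,X,Y,Y,Y])], [(1,
     Rule [X] [Y,Y,X,Y,Y,Y,X] [])]),
     ([(96, [Y,X,Y,X,Y,Y,Y,X]), (96, [Y,X,X,Y,Y,X,Y,Y]), (96, [X,Y,X,Y,Y,X,Y,Y]), (96, [X,X,Y,Y,X,Y,Y,Y])], [(4,
     Rule [Y] [X,Y,X,Y,Y,Y,X] []), (-4, Rule [Y] [X,Y,Y,X,Y,X] [Y]), (4, Rule [] [Y,X,Y,Y,X,Y,X] [Y]), (3, Rule [X]
     [X,Y,X,Y,Y,Y,Y] []), (-4, Rule [] [Y,Y,X,Y,Y,X] [X,Y]), (4, Rule [Y] [Y,X,Y,Y,X,X] [Y]), (2, Rule [Y]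
     [Y,X,Y,Y,Y,X] [X]), (-6, Rule [] [Y,Y,X,Y,Y,Y,X] [X]), (-2, Rule [Y] [X,Y,Y,X,Y,Y,X] []), (-2, Rule [Y]
     [Y,X,Y,Y,X,Y,X] []), (-1, Rule [Y] [Y,X,Y,X,Y,Y,X] []), (-1, Rule [Y] [Y,X,X,Y,Y,Y,X] []), (-10, Rule [X]
     [Y,Y,X,Y,Y,Y,X] []), (2, Rule [] [Y,Y,X,Y,Y,X] [Y,X]), (1, Rule [] [Y,X,Y,X,Y,Y,X] [Y]), (3, Rule []
     [Y,X,X,Y,Y,Y,Y] [X]), (-1, Rule [] [X,Y,X,Y,Y,Y,Y] [X]), (-8, Rule [] [X,Y,X,Y,Y,Y,X] [Y]), (24, Rel [[X],
     [X], [Y], [Y,X,Y,Y,Y]]), (-2, Rule [] [Y,X,Y,Y,Y,Y] [X,X]), (-4, Rule [] [Y,X,Y,Y,Y,X] [Y,X]), (-4, Rule []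
     [Y,X,Y,Y,Y,X] [X,Y])]),
     ([(48, [Y,X,Y,Y,X,Y,Y,X]), (48, [X,Y,X,Y,X,Y,Y,Y])], [(6, Rule [Y] [X,Y,Y,X,Y,Y,X] []), (4, Rule [Y]
     [X,Y,Y,X,Y,X] [Y]), (-2, Rule [] [Y,X,Y,Y,X,Y,X] [Y]), (-1, Rule [] [Y,X,Y,X,Y,Y,X] [Y]), (2, Rule [X]
     [Y,X,X,Y,Y,Y,Y] []), (1, Rule [X] [X,Y,X,Y,Y,Y,Y] []), (4, Rule [] [Y,Y,X,Y,Y,X] [X,Y]), (-4, Rule [Y]
     [Y,X,Y,Y,X,X] [Y]), (-2, Rule [Y] [Y,X,Y,Y,Y,X] [X]), (2, Rule [] [Y,Y,X,Y,Y,Y,X] [X]), (2, Rule [Y]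
     [Y,X,Y,Y,X,Y,X] []), (1, Rule [Y] [Y,X,Y,X,Y,Y,X] []), (1, Rule [Y] [Y,X,X,Y,Y,Y,X] []), (2, Rule [X]
     [Y,Y,X,Y,Y,Y,X] []), (-2, Rule [] [Y,Y,X,Y,Y,X] [Y,X]), (-1, Rule [] [Y,X,X,Y,Y,Y,Y] [X]), (-1, Rule []
     [X,Y,X,Y,Y,Y,Y] [X]), (2, Rule [] [Y,X,X,Y,Y,Y,X] [Y]), (4, Rule [] [X,Y,X,Y,Y,Y,X] [Y])]),
     ([(24, [X,Y,Y,X,Y,Y,Y,Y])], [(1, Rule [X] [Y,Y,X,Y,Y,Y,Y] [])]),
     ([(24, [Y,X,Y,X,Y,Y,Y,Y])], [(1, Rule [Y] [X,Y,X,Y,Y,Y,Y] [])]),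
     ([(24, [X,X,X,Y,X,X,Y,X,X])], [(1, Rule [X] [X,X,Y,X,X,Y,X,X] [])]),
     ([(384, [X,X,X,Y,X,X,Y,Y,X]), (384, [X,X,X,Y,X,X,Y,X,Y])], [(16, Rel [[X], [X], [X], [Y,X,X,Y,X,Y]]), (-4,
     Rule [] [Y,X,X,Y,X,Y,X] [X,X]), (-2, Rule [] [X,Y,X,X,Y,Y,X,X] [X]), (-12, Rule [X] [X,X,Y,X,Y,X,Y,X] []),
     (-2, Rule [] [X,Y,X,X,Y,X,Y,X] [X]), (4, Rule [] [X,X,Y,X,Y,Y,X,X] [X]), (4, Rule [] [X,X,Y,X,Y,X,Y,X] [X]),
     (-4, Rule [X] [X,Y,X,X,Y,Y,X,X] []), (-8, Rule [X] [X,X,Y,X,Y,Y,X,X] []), (5, Rule [] [X,X,X,Y,X,Y,Y,X] [X]),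
     (-3, Rule [X] [X,Y,X,X,Y,X,Y,X] [])]),
     ([(24, [X,X,X,Y,X,Y,X,Y,X])], [(1, Rule [X] [X,X,Y,X,Y,X,Y,X] [])]),
     ([(384, [X,X,Y,X,X,Y,X,Y,X])], [(1, Rule [X] [X,Y,X,X,Y,X,Y,X] []), (16, Rel [[X], [X], [X], [Y,X,X,Y,X,Y]]),
     (-4, Rule [] [Y,X,X,Y,X,Y,X] [X,X]), (-2, Rule [] [X,Y,X,X,Y,Y,X,X] [X]), (-12, Rule [X] [X,X,Y,X,Y,X,Y,X]
     []), (-2, Rule [] [X,Y,X,X,Y,X,Y,X] [X]), (4, Rule [] [X,X,Y,X,Y,Y,X,X] [X]), (4, Rule [] [X,X,Y,X,Y,X,Y,X]
     [X]), (-4, Rule [X] [X,Y,X,X,Y,Y,X,X] []), (-8, Rule [X] [X,X,Y,X,Y,Y,X,X] []), (5, Rule [] [X,X,X,Y,X,Y,Y,X]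
     [X])]),
     ([(96, [X,X,Y,X,X,Y,Y,X,X])], [(2, Rule [X] [X,Y,X,X,Y,Y,X,X] []), (4, Rule [X] [X,X,Y,X,Y,Y,X,X] []), (-1,
     Rule [] [X,X,X,Y,X,Y,Y,X] [X]), (4, Rule [X] [X,X,Y,X,Y,X,Y,X] [])]),
     ([(384, [X,X,X,Y,X,X,Y,Y,Y])], [(16, Rel [[X], [X], [X], [Y,X,X,Y,Y,Y]]), (-4, Rule [] [Y,X,X,Y,Y,Y,X] [X,X]),
     (1, Rule [] [Y,X,X,Y,Y,X,Y,X] [X]), (1, Rule [] [X,X,X,Y,X,Y,Y,X] [Y]), (2, Rule [X] [X,Y,X,Y,Y,X,Y,X] []),
     (1, Rule [] [Y,X,X,Y,X,Y,Y,X] [X]), (2, Rule [X] [X,Y,X,Y,X,Y,Y,X] []), (-1, Rule [X] [X,Y,X,X,Y,Y,Y,X] []),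
     (-2, Rule [] [X,Y,X,X,Y,Y,Y,X] [X]), (-8, Rule [] [X,X,Y,X,Y,Y,Y,X] [X]), (1, Rule [X] [Y,X,X,Y,X,Y,Y,X] []),
     (1, Rule [X] [Y,X,X,Y,Y,X,Y,X] []), (-1, Rule [] [X,Y,X,X,Y,Y,X,Y] [X])]),
     ([(384, [X,X,Y,X,X,Y,Y,X,Y]), (-384, [X,X,Y,X,X,Y,X,Y,Y]), (-384, [X,X,X,Y,X,Y,X,Y,Y])], [(4, Rule [X]
     [X,Y,X,X,Y,Y,X,Y] []), (3, Rule [] [X,X,X,Y,X,Y,Y,X] [Y]), (-16, Rel [[X], [X], [X], [Y,X,X,Y,Y,Y]]), (4, Rule
     [] [Y,X,X,Y,Y,Y,X] [X,X]), (-1, Rule [] [Y,X,X,Y,Y,X,Y,X] [X]), (-2, Rule [X] [X,Y,X,Y,Y,X,Y,X] []), (-1, Rule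
     [] [Y,X,X,Y,X,Y,Y,X] [X]), (-2, Rule [X] [X,Y,X,Y,X,Y,Y,X] []), (1, Rule [X] [X,Y,X,X,Y,Y,Y,X] []), (2, Rule
     [] [X,Y,X,X,Y,Y,Y,X] [X]), (8, Rule [] [X,X,Y,X,Y,Y,Y,X] [X]), (-1, Rule [X] [Y,X,X,Y,X,Y,Y,X] []), (-1, Rule
     [X] [Y,X,X,Y,Y,X,Y,X] []), (1, Rule [] [X,Y,X,X,Y,Y,X,Y] [X])]),
     ([(192, [X,X,Y,X,X,Y,Y,Y,X]), (384, [X,X,Y,X,X,Y,X,Y,Y]), (192, [X,X,X,Y,X,Y,X,Y,Y])], [(1, Rule [X]
     [X,Y,X,X,Y,Y,Y,X] []), (-1, Rule [] [X,X,X,Y,X,Y,Y,X] [Y]), (16, Rel [[X], [X], [X], [Y,X,X,Y,Y,Y]]), (-4,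
     Rule [] [Y,X,X,Y,Y,Y,X] [X,X]), (1, Rule [] [Y,X,X,Y,Y,X,Y,X] [X]), (2, Rule [X] [X,Y,X,Y,Y,X,Y,X] []), (1,
     Rule [] [Y,X,X,Y,X,Y,Y,X] [X]), (2, Rule [X] [X,Y,X,Y,X,Y,Y,X] []), (-2, Rule [] [X,Y,X,X,Y,Y,Y,X] [X]), (-8,
     Rule [] [X,X,Y,X,Y,Y,Y,X] [X]), (1, Rule [X] [Y,X,X,Y,X,Y,Y,X] []), (1, Rule [X] [Y,X,X,Y,Y,X,Y,X] []), (-1,
     Rule [] [X,Y,X,X,Y,Y,X,Y] [X])]),
     ([(384, [X,X,X,Y,Y,X,Y,Y,X]), (-384, [X,X,X,Y,X,Y,X,Y,Y])], [(4, Rule [X] [X,X,Y,Y,X,Y,Y,X] []), (16, Rel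
     [[X], [X], [X], [Y,X,X,Y,Y,Y]]), (-4, Rule [] [Y,X,X,Y,Y,Y,X] [X,X]), (1, Rule [] [Y,X,X,Y,Y,X,Y,X] [X]), (1,
     Rule [] [X,X,X,Y,X,Y,Y,X] [Y]), (2, Rule [X] [X,Y,X,Y,Y,X,Y,X] []), (1, Rule [] [Y,X,X,Y,X,Y,Y,X] [X]), (2,
     Rule [X] [X,Y,X,Y,X,Y,Y,X] []), (-1, Rule [X] [X,Y,X,X,Y,Y,Y,X] []), (-2, Rule [] [X,Y,X,X,Y,Y,Y,X] [X]), (-8,
     Rule [] [X,X,Y,X,Y,Y,Y,X] [X]), (1, Rule [X] [Y,X,X,Y,X,Y,Y,X] []), (1, Rule [X] [Y,X,X,Y,Y,X,Y,X] []), (-1,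
     Rule [] [X,Y,X,X,Y,Y,X,Y] [X])]),
     ([(192, [X,X,Y,X,Y,X,Y,Y,X]), (192, [X,X,X,Y,X,Y,X,Y,Y])], [(3, Rule [] [X,X,X,Y,X,Y,Y,X] [Y]), (-16, Rel
     [[X], [X], [X], [Y,X,X,Y,Y,Y]]), (4, Rule [] [Y,X,X,Y,Y,Y,X] [X,X]), (-1, Rule [] [Y,X,X,Y,Y,X,Y,X] [X]), (-1,
     Rule [] [Y,X,X,Y,X,Y,Y,X] [X]), (1, Rule [X] [X,Y,X,X,Y,Y,Y,X] []), (2, Rule [] [X,Y,X,X,Y,Y,Y,X] [X]), (8,
     Rule [] [X,X,Y,X,Y,Y,Y,X] [X]), (1, Rule [X] [Y,X,X,Y,X,Y,Y,X] []), (-3, Rule [X] [Y,X,X,Y,Y,X,Y,X] []), (3,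
     Rule [] [X,Y,X,X,Y,Y,X,Y] [X]), (4, Rule [X] [X,Y,X,Y,X,Y,Y,X] [])]),
     ([(192, [X,Y,X,X,Y,X,Y,Y,X]), (192, [X,X,Y,X,X,Y,X,Y,Y])], [(1, Rule [X] [Y,X,X,Y,X,Y,Y,X] []), (-1, Rule []
     [X,X,X,Y,X,Y,Y,X] [Y]), (16, Rel [[X], [X], [X], [Y,X,X,Y,Y,Y]]), (-4, Rule [] [Y,X,X,Y,Y,Y,X] [X,X]), (1,
     Rule [] [Y,X,X,Y,Y,X,Y,X] [X]), (1, Rule [] [Y,X,X,Y,X,Y,Y,X] [X]), (-2, Rule [X] [X,Y,X,Y,X,Y,Y,X] []), (-1,
     Rule [X] [X,Y,X,X,Y,Y,Y,X] []), (-2, Rule [] [X,Y,X,X,Y,Y,Y,X] [X]), (-8, Rule [] [X,X,Y,X,Y,Y,Y,X] [X]), (3,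
     Rule [X] [Y,X,X,Y,Y,X,Y,X] []), (-3, Rule [] [X,Y,X,X,Y,Y,X,Y] [X])]),
     ([(384, [X,X,Y,X,Y,Y,X,Y,X]), (-384, [X,X,X,Y,X,Y,X,Y,Y])], [(2, Rule [X] [X,Y,X,Y,Y,X,Y,X] []), (-7, Rule []
     [X,X,X,Y,X,Y,Y,X] [Y]), (16, Rel [[X], [X], [X], [Y,X,X,Y,Y,Y]]), (-4, Rule [] [Y,X,X,Y,Y,Y,X] [X,X]), (1,
     Rule [] [Y,X,X,Y,Y,X,Y,X] [X]), (1, Rule [] [Y,X,X,Y,X,Y,Y,X] [X]), (-6, Rule [X] [X,Y,X,Y,X,Y,Y,X] []), (-1,
     Rule [X] [X,Y,X,X,Y,Y,Y,X] []), (-2, Rule [] [X,Y,X,X,Y,Y,Y,X] [X]), (-8, Rule [] [X,X,Y,X,Y,Y,Y,X] [X]), (-3,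
     Rule [X] [Y,X,X,Y,X,Y,Y,X] []), (5, Rule [X] [Y,X,X,Y,Y,X,Y,X] []), (-5, Rule [] [X,Y,X,X,Y,Y,X,Y] [X])]),
     ([(24, [X,X,Y,X,X,Y,Y,Y,Y])], [(1, Rule [X] [X,Y,X,X,Y,Y,Y,Y] [])]),
     ([(768, [X,X,X,Y,Y,X,Y,Y,Y])], [(32, Rel [[X], [X], [X], [Y,Y,X,Y,Y,Y]]), (-16, Rule [] [Y,Y,X,Y,Y,Y,X]
     [X,X]), (-4, Rule [] [Y,X,Y,Y,X,Y,Y,X] [X]), (-2, Rule [] [Y,X,Y,X,Y,Y,Y,X] [X]), (2, Rule [Y]
     [X,X,Y,Y,X,Y,Y,X] []), (-1, Rule [] [Y,X,X,Y,X,Y,Y,Y] [X]), (16, Rule [Y] [X,X,Y,X,Y,Y,Y,X] []), (-2, Rule []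
     [Y,X,X,Y,X,Y,Y,X] [Y]), (-8, Rule [X] [X,Y,X,X,Y,Y,Y,Y] []), (-16, Rule [X] [X,Y,Y,X,Y,Y,Y,X] []), (-32, Rule
     [] [X,Y,Y,X,Y,Y,Y,X] [X]), (-4, Rule [X] [Y,X,Y,Y,X,Y,Y,X] []), (1, Rule [X] [Y,X,X,Y,X,Y,Y,Y] [])]),
     ([(768, [X,Y,X,X,Y,X,Y,Y,Y]), (768, [X,X,Y,X,Y,X,Y,Y,Y])], [(3, Rule [X] [Y,X,X,Y,X,Y,Y,Y] []), (-32, Rel
     [[X], [X], [X], [Y,Y,X,Y,Y,Y]]), (16, Rule [] [Y,Y,X,Y,Y,Y,X] [X,X]), (4, Rule [] [Y,X,Y,Y,X,Y,Y,X] [X]), (2,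
     Rule [] [Y,X,Y,X,Y,Y,Y,X] [X]), (-2, Rule [Y] [X,X,Y,Y,X,Y,Y,X] []), (1, Rule [] [Y,X,X,Y,X,Y,Y,Y] [X]), (-16,
     Rule [Y] [X,X,Y,X,Y,Y,Y,X] []), (2, Rule [] [Y,X,X,Y,X,Y,Y,X] [Y]), (8, Rule [X] [X,Y,X,X,Y,Y,Y,Y] []), (16,
     Rule [X] [X,Y,Y,X,Y,Y,Y,X] []), (32, Rule [] [X,Y,Y,X,Y,Y,Y,X] [X]), (4, Rule [X] [Y,X,Y,Y,X,Y,Y,X] [])]),
     ([(768, [X,X,Y,Y,X,Y,Y,Y,X]), (-768, [X,X,Y,X,Y,Y,X,Y,Y]), (-768, [X,X,Y,X,Y,X,Y,Y,Y])], [(48, Rule [X]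
     [X,Y,Y,X,Y,Y,Y,X] []), (32, Rel [[X], [X], [X], [Y,Y,X,Y,Y,Y]]), (-16, Rule [] [Y,Y,X,Y,Y,Y,X] [X,X]), (-4,
     Rule [] [Y,X,Y,Y,X,Y,Y,X] [X]), (-2, Rule [] [Y,X,Y,X,Y,Y,Y,X] [X]), (2, Rule [Y] [X,X,Y,Y,X,Y,Y,X] []), (-1,
     Rule [] [Y,X,X,Y,X,Y,Y,Y] [X]), (16, Rule [Y] [X,X,Y,X,Y,Y,Y,X] []), (-2, Rule [] [Y,X,X,Y,X,Y,Y,X] [Y]), (-8,
     Rule [X] [X,Y,X,X,Y,Y,Y,Y] []), (-32, Rule [] [X,Y,Y,X,Y,Y,Y,X] [X]), (-4, Rule [X] [Y,X,Y,Y,X,Y,Y,X] []), (1,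
     Rule [X] [Y,X,X,Y,X,Y,Y,Y] [])]),
     ([(192, [X,Y,X,Y,X,Y,Y,Y,X]), (384, [X,X,Y,X,Y,Y,X,Y,Y]), (192, [X,X,Y,X,Y,X,Y,Y,Y])], [(2, Rule [X]
     [Y,X,Y,X,Y,Y,Y,X] []), (-2, Rule [] [X,Y,X,X,Y,Y,X,Y] [Y]), (-1, Rule [X] [Y,X,X,Y,X,Y,Y,Y] [])]),
     ([(48, [X,Y,X,Y,Y,X,Y,Y,X]), (48, [X,X,Y,X,Y,X,Y,Y,Y])], [(1, Rule [X] [Y,X,Y,Y,X,Y,Y,X] [])]),
     ([(768, [Y,X,X,Y,Y,X,Y,Y,X])], [(6, Rule [Y] [X,X,Y,Y,X,Y,Y,X] []), (-3, Rule [] [Y,X,X,Y,X,Y,Y,Y] [X]), (48,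
     Rule [Y] [X,X,Y,X,Y,Y,Y,X] []), (-6, Rule [] [Y,X,X,Y,X,Y,Y,X] [Y]), (-24, Rule [X] [X,Y,X,X,Y,Y,Y,Y] []), (8,
     Rule [X] [Y,X,Y,X,Y,Y,Y,X] []), (-8, Rule [] [X,Y,X,X,Y,Y,X,Y] [Y]), (80, Rule [X] [X,Y,Y,X,Y,Y,Y,X] []),
     (-32, Rel [[X], [X], [X], [Y,Y,X,Y,Y,Y]]), (16, Rule [] [Y,Y,X,Y,Y,Y,X] [X,X]), (4, Rule [] [Y,X,Y,Y,X,Y,Y,X]
     [X]), (2, Rule [] [Y,X,Y,X,Y,Y,Y,X] [X]), (32, Rule [] [X,Y,Y,X,Y,Y,Y,X] [X]), (4, Rule [X] [Y,X,Y,Y,X,Y,Y,X]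
     []), (-1, Rule [X] [Y,X,X,Y,X,Y,Y,Y] [])]),
     ([(24, [X,X,Y,Y,X,Y,Y,Y,Y])], [(1, Rule [X] [X,Y,Y,X,Y,Y,Y,Y] [])]),
     ([(192, [X,Y,X,Y,X,Y,Y,Y,Y])], [(1, Rule [] [Y,X,X,Y,X,Y,Y,Y] [Y]), (-8, Rule [Y] [X,X,Y,X,Y,Y,Y,Y] []), (-8,
     Rule [X] [X,Y,Y,X,Y,Y,Y,Y] [])]),
     ([(768, [Y,X,X,Y,Y,X,Y,Y,Y]), (768, [X,Y,X,Y,Y,X,Y,Y,Y])], [(96, Rel [[X], [X], [Y], [Y,Y,X,Y,Y,Y]]), (-16,
     Rule [Y] [Y,Y,X,Y,Y,Y,X] [X]), (-32, Rule [Y] [X,Y,Y,X,Y,Y,Y,X] []), (-8, Rule [] [Y,Y,X,Y,Y,Y,Y] [X,X]),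
     (-32, Rule [Y] [X,Y,X,Y,Y,Y,X] [Y]), (16, Rule [Y] [X,Y,X,X,Y,Y,Y,Y] []), (-16, Rule [X] [X,Y,Y,X,Y,Y,Y,Y]
     []), (-16, Rule [] [Y,Y,X,Y,Y,Y,X] [X,Y]), (-4, Rule [] [Y,X,Y,Y,X,Y,Y,X] [Y]), (-32, Rule []
     [X,Y,Y,X,Y,Y,Y,X] [Y]), (-16, Rule [Y] [Y,X,Y,Y,Y,X] [Y,X]), (8, Rule [Y] [Y,X,X,Y,Y,Y,Y] [X]), (2, Rule []
     [Y,X,Y,X,Y,Y,Y,X] [Y]), (-16, Rule [X,Y] [Y,Y,X,Y,Y,Y,X] []), (-16, Rule [] [X,Y,Y,X,Y,Y,X] [Y,Y]), (-1, Rule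
     [] [Y,X,X,Y,X,Y,Y,Y] [Y]), (8, Rule [Y] [X,X,Y,X,Y,Y,Y,Y] []), (-8, Rule [] [X,Y,X,X,Y,Y,Y,Y] [Y]), (-8, Rule
     [] [X,Y,Y,X,Y,Y,Y,Y] [X]), (-16, Rule [] [X,Y,Y,X,Y,X] [Y,Y,Y]), (-16, Rule [] [X,X,Y,Y,Y,X] [Y,Y,Y])]),
     ([(384, [Y,X,Y,Y,X,Y,Y,Y,X]), (384, [X,Y,X,Y,Y,X,Y,Y,Y])], [(-2, Rule [] [Y,X,Y,X,Y,Y,Y,X] [Y]), (96, Rel
     [[X], [X], [Y], [Y,Y,X,Y,Y,Y]]), (-16, Rule [Y] [Y,Y,X,Y,Y,Y,X] [X]), (-8, Rule [] [Y,Y,X,Y,Y,Y,Y] [X,X]),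
     (-16, Rule [] [Y,Y,X,Y,Y,Y,X] [X,Y]), (-4, Rule [] [Y,X,Y,Y,X,Y,Y,X] [Y]), (-32, Rule [] [X,Y,Y,X,Y,Y,Y,X]
     [Y]), (-16, Rule [Y] [Y,X,Y,Y,Y,X] [Y,X]), (8, Rule [Y] [Y,X,X,Y,Y,Y,Y] [X]), (-16, Rule [X,Y] [Y,Y,X,Y,Y,Y,X]
     []), (-16, Rule [] [X,Y,Y,X,Y,Y,X] [Y,Y]), (-1, Rule [] [Y,X,X,Y,X,Y,Y,Y] [Y]), (8, Rule [Y] [X,X,Y,X,Y,Y,Y,Y]
     []), (-8, Rule [] [X,Y,X,X,Y,Y,Y,Y] [Y]), (-8, Rule [] [X,Y,Y,X,Y,Y,Y,Y] [X]), (-16, Rule [] [X,Y,Y,X,Y,X]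
     [Y,Y,Y]), (-16, Rule [] [X,X,Y,Y,Y,X] [Y,Y,Y])]),
     ([(24, [Y,X,Y,Y,X,Y,Y,Y,Y])], [(1, Rule [Y] [X,Y,Y,X,Y,Y,Y,Y] [])]),
     ([(384, [X,X,X,Y,X,X,Y,X,Y,X])], [(1, Rule [X] [X,X,Y,X,X,Y,X,Y,X] [])]),
     ([(768, [X,X,X,Y,X,X,Y,X,Y,Y])], [(-1, Rule [X] [X,X,Y,X,X,Y,Y,X,Y] []), (1, Rule [] [X,X,X,Y,X,X,Y,Y,X] [Y]),
     (16, Rule [X] [X,X,Y,X,Y,Y,X,X] [Y]), (-4, Rule [] [X,X,X,Y,X,Y,Y,X] [X,Y]), (16, Rule [] [X,X,X,Y,X,Y,X,Y,X]
     [Y]), (1, Rule [X] [X,X,X,Y,X,X,Y,Y,Y] [])]),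
     ([(384, [X,X,X,Y,X,Y,X,Y,Y,X])], [(2, Rule [X] [X,X,Y,X,Y,X,Y,Y,X] []), (16, Rule [X] [X,X,Y,X,Y,Y,X,X] [Y]),
     (-4, Rule [] [X,X,X,Y,X,Y,Y,X] [X,Y]), (16, Rule [] [X,X,X,Y,X,Y,X,Y,X] [Y]), (1, Rule [X] [X,X,X,Y,X,X,Y,Y,Y]
     [])]),
     ([(768, [X,X,Y,X,X,Y,X,Y,Y,X])], [(4, Rule [X] [X,Y,X,X,Y,X,Y,Y,X] []), (1, Rule [X] [X,X,Y,X,X,Y,Y,X,Y] []),
     (-1, Rule [] [X,X,X,Y,X,X,Y,Y,X] [Y]), (-16, Rule [X] [X,X,Y,X,Y,Y,X,X] [Y]), (4, Rule [] [X,X,X,Y,X,Y,Y,X]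
     [X,Y]), (-16, Rule [] [X,X,X,Y,X,Y,X,Y,X] [Y]), (-1, Rule [X] [X,X,X,Y,X,X,Y,Y,Y] [])]),
     ([(3072, [X,X,X,Y,X,Y,X,Y,Y,Y])], [(128, Rel [[X], [X], [X], [Y,X,Y,X,Y,Y,Y]]), (-8, Rule [] [Y,X,Y,X,Y,Y,Y,X]
     [X,X]), (1, Rule [] [Y,X,X,Y,Y,X,Y,Y,X] [X]), (16, Rule [] [X,Y,X,Y,Y,X,Y,Y,X] [X]), (1, Rule []
     [X,X,Y,Y,X,Y,Y,Y,X] [X]), (48, Rule [X] [X,Y,X,Y,Y,X,Y,Y,X] []), (-4, Rule [] [X,Y,X,Y,X,Y,Y,Y,X] [X])]),
     ([(3072, [X,X,Y,X,X,Y,X,Y,Y,Y])], [(4, Rule [X] [X,Y,X,X,Y,X,Y,Y,Y] []), (-128, Rel [[X], [X], [X],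
     [Y,X,Y,X,Y,Y,Y]]), (8, Rule [] [Y,X,Y,X,Y,Y,Y,X] [X,X]), (-1, Rule [] [Y,X,X,Y,Y,X,Y,Y,X] [X]), (-16, Rule []
     [X,Y,X,Y,Y,X,Y,Y,X] [X]), (-1, Rule [] [X,X,Y,Y,X,Y,Y,Y,X] [X]), (-48, Rule [X] [X,Y,X,Y,Y,X,Y,Y,X] []), (4,
     Rule [] [X,Y,X,Y,X,Y,Y,Y,X] [X])]),
     ([(3072, [X,X,Y,X,Y,X,Y,Y,Y,X])], [(16, Rule [X] [X,Y,X,Y,X,Y,Y,Y,X] []), (8, Rule [X] [X,X,Y,Y,X,Y,Y,Y,X]
     []), (-8, Rule [] [X,X,X,Y,Y,X,Y,Y,Y] [X]), (128, Rel [[X], [X], [X], [Y,X,Y,X,Y,Y,Y]]), (-8, Rule []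
     [Y,X,Y,X,Y,Y,Y,X] [X,X]), (1, Rule [] [Y,X,X,Y,Y,X,Y,Y,X] [X]), (16, Rule [] [X,Y,X,Y,Y,X,Y,Y,X] [X]), (1,
     Rule [] [X,X,Y,Y,X,Y,Y,Y,X] [X]), (48, Rule [X] [X,Y,X,Y,Y,X,Y,Y,X] []), (-4, Rule [] [X,Y,X,Y,X,Y,Y,Y,X]
     [X])]),
     ([(3072, [X,X,Y,X,Y,Y,X,Y,Y,X])], [(16, Rule [X] [X,Y,X,Y,Y,X,Y,Y,X] []), (-128, Rel [[X], [X], [X],
     [Y,X,Y,X,Y,Y,Y]]), (8, Rule [] [Y,X,Y,X,Y,Y,Y,X] [X,X]), (-1, Rule [] [Y,X,X,Y,Y,X,Y,Y,X] [X]), (-16, Rule []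
     [X,Y,X,Y,Y,X,Y,Y,X] [X]), (-1, Rule [] [X,X,Y,Y,X,Y,Y,Y,X] [X]), (4, Rule [] [X,Y,X,Y,X,Y,Y,Y,X] [X])]),
     ([(192, [X,X,Y,X,Y,X,Y,Y,Y,Y])], [(1, Rule [X] [X,Y,X,Y,X,Y,Y,Y,Y] [])]),
     ([(1536, [X,X,Y,X,Y,Y,X,Y,Y,Y])], [(-8, Rule [] [X,Y,X,X,Y,Y,X,Y] [Y,Y]), (1, Rule [X] [Y,X,X,Y,Y,X,Y,Y,Y]
     []), (-1, Rule [] [X,Y,X,X,Y,X,Y,Y,Y] [Y]), (-4, Rule [X] [X,Y,X,Y,X,Y,Y,Y,Y] [])]),
     ([(1536, [X,Y,X,Y,Y,X,Y,Y,Y,X])], [(4, Rule [X] [Y,X,Y,Y,X,Y,Y,Y,X] []), (8, Rule [] [X,Y,X,X,Y,Y,X,Y] [Y,Y]),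
     (-1, Rule [X] [Y,X,X,Y,Y,X,Y,Y,Y] []), (1, Rule [] [X,Y,X,X,Y,X,Y,Y,Y] [Y]), (4, Rule [X] [X,Y,X,Y,X,Y,Y,Y,Y]
     [])]),
     ([(768, [X,Y,X,Y,Y,X,Y,Y,Y,Y])], [(1, Rule [] [Y,X,X,Y,Y,X,Y,Y,Y] [Y]), (-32, Rule [Y] [X,X,Y,Y,X,Y,Y,Y,Y]
     [])])]"

text \<open>A pair with empty certificate only identifies the least rotation of a generator with the
  form in which the generator is listed.\<close>

definition necklace_certs :: "(poly \<times> (int \<times> item) list) list" where
  "necklace_certs = [
     ([(24, [X,X,X,X,Y])], [(1, Rule [] [X,X,X,X] [Y])]),
     ([(12, [X,X,Y,X,Y]), (12, [X,X,X,Y,Y])], [(1, Rule [] [Y,X,X,X] [Y])]),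
     ([(1, [X,X,Y,Y,Y]), (-1, [Y,Y,Y,X,X])], []),
     ([(12, [X,Y,X,Y,Y]), (12, [Y,Y,Y,X,X])], [(1, Rule [] [Y,Y,X,X] [Y])]),
     ([(24, [X,Y,Y,Y,Y])], [(1, Rule [] [Y,Y,Y,X] [Y])]),
     ([(72, [X,X,X,X,X,Y])], [(1, Rule [] [X,Y,X,X,X] [X])]),
     ([(72, [X,X,X,X,Y,Y])], [(2, Rule [] [X,Y,Y,X,X] [X]), (-1, Rule [] [X,Y,X,X,X] [Y])]),
     ([(48, [X,X,X,Y,X,Y]), (24, [X,X,Y,X,X,Y])], [(1, Rule [] [X,Y,X,X,X] [Y])]),
     ([(24, [X,X,X,Y,Y,Y]), (12, [X,X,Y,Y,X,Y]), (12, [Y,Y,X,X,Y,X])], [(-1, Rule [] [Y,X,Y,X,X] [Y]), (1, Rule []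
     [X,Y,Y,X,X] [Y])]),
     ([(1, [X,X,Y,X,Y,Y]), (-1, [Y,Y,X,X,Y,X])], []),
     ([(24, [X,Y,X,Y,X,Y]), (36, [X,X,Y,Y,X,Y]), (36, [Y,Y,X,X,Y,X])], [(1, Rule [] [X,Y,Y,X,X] [Y]), (1, Rule []
     [Y,X,Y,X,X] [Y])]),
     ([(24, [X,X,Y,Y,Y,Y])], [(-1, Rule [] [Y,Y,X,Y,X] [Y]), (1, Rule [] [X,Y,Y,Y,X] [Y])]),
     ([(48, [X,Y,X,Y,Y,Y]), (24, [Y,Y,X,Y,Y,X])], [(1, Rule [] [X,Y,Y,Y,X] [Y]), (1, Rule [] [Y,Y,X,Y,X] [Y])]),
     ([(1, [X,Y,Y,X,Y,Y]), (-1, [Y,Y,X,Y,Y,X])], []),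
     ([(24, [X,Y,Y,Y,Y,Y])], [(1, Rule [] [X,Y,Y,Y,Y] [Y])]),
     ([(48, [X,X,X,X,X,X,Y])], [(1, Rule [] [X,X,Y,X,X,X] [X])]),
     ([(48, [X,X,X,X,X,Y,Y])], [(-1, Rule [] [X,Y,X,Y,X,X] [X]), (1, Rule [] [X,X,Y,Y,X,X] [X])]),
     ([(96, [X,X,X,X,Y,X,Y])], [(-1, Rule [] [X,X,Y,X,X,X] [Y]), (2, Rule [] [X,Y,X,Y,X,X] [X])]),
     ([(48, [X,X,X,Y,X,X,Y])], [(1, Rule [] [X,X,Y,X,X,X] [Y])]),
     ([(144, [X,X,X,X,Y,Y,Y])], [(6, Rule [] [X,X,Y,Y,Y,X] [X]), (4, Rule [] [Y,X,X,Y,X,X] [Y]), (-1, Rule []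
     [X,X,Y,Y,X,X] [Y]), (1, Rule [] [X,Y,X,Y,X,X] [Y])]),
     ([(72, [X,X,X,Y,X,Y,Y]), (72, [X,X,X,Y,Y,X,Y])], [(-4, Rule [] [Y,X,X,Y,X,X] [Y]), (1, Rule [] [X,X,Y,Y,X,X]
     [Y]), (-1, Rule [] [X,Y,X,Y,X,X] [Y])]),
     ([(72, [X,X,Y,X,X,Y,Y])], [(1, Rule [] [X,X,Y,Y,X,X] [Y]), (2, Rule [] [Y,X,X,Y,X,X] [Y])]),
     ([(72, [X,X,Y,X,Y,X,Y])], [(1, Rule [] [X,Y,X,Y,X,X] [Y])]),
     ([(48, [X,X,X,Y,Y,Y,Y])], [(3, Rule [] [Y,X,Y,X,Y,X] [Y]), (-1, Rule [] [X,Y,Y,X,Y,X] [Y])]),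
     ([(1, [X,X,Y,X,Y,Y,Y]), (-1, [Y,Y,Y,X,X,Y,X])], []),
     ([(144, [X,X,Y,Y,X,Y,Y])], [(4, Rule [] [Y,X,Y,Y,X,X] [Y]), (1, Rule [] [X,Y,Y,X,Y,X] [Y]), (4, Rule []
     [X,X,Y,Y,Y,X] [Y]), (1, Rule [] [Y,X,Y,X,Y,X] [Y])]),
     ([(72, [X,X,Y,Y,Y,X,Y]), (72, [Y,Y,Y,X,X,Y,X])], [(4, Rule [] [X,X,Y,Y,Y,X] [Y]), (-2, Rule [] [Y,X,Y,Y,X,X]
     [Y]), (1, Rule [] [X,Y,Y,X,Y,X] [Y]), (-5, Rule [] [Y,X,Y,X,Y,X] [Y])]),
     ([(48, [X,Y,X,Y,X,Y,Y])], [(1, Rule [] [X,Y,Y,X,Y,X] [Y]), (1, Rule [] [Y,X,Y,X,Y,X] [Y])]),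
     ([(24, [X,X,Y,Y,Y,Y,Y])], [(1, Rule [] [X,X,Y,Y,Y,Y] [Y])]),
     ([(120, [X,Y,X,Y,Y,Y,Y])], [(-4, Rule [] [Y,Y,X,Y,Y,X] [Y]), (2, Rule [] [Y,X,Y,Y,Y,X] [Y]), (-3, Rule []
     [X,X,Y,Y,Y,Y] [Y])]),
     ([(120, [X,Y,Y,X,Y,Y,Y])], [(4, Rule [] [Y,X,Y,Y,Y,X] [Y]), (-1, Rule [] [X,X,Y,Y,Y,Y] [Y]), (2, Rule []
     [Y,Y,X,Y,Y,X] [Y])]),
     ([(24, [X,Y,Y,Y,Y,Y,Y])], [(1, Rule [] [Y,X,Y,Y,Y,Y] [Y])]),
     ([(72, [X,X,X,X,X,Y,X,Y])], [(1, Rule [] [X,X,Y,X,Y,X,X] [X]), (-1, Rule [] [X,Y,X,X,Y,X,X] [X])]),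
     ([(72, [X,X,X,X,Y,X,X,Y])], [(1, Rule [] [X,X,Y,X,Y,X,X] [X]), (2, Rule [] [X,Y,X,X,Y,X,X] [X])]),
     ([(288, [X,X,X,X,Y,X,Y,Y])], [(3, Rule [] [Y,X,X,Y,X,Y,X] [X]), (2, Rule [] [X,Y,X,X,Y,X,X] [Y]), (-1, Rule []
     [X,X,Y,X,Y,X,X] [Y])]),
     ([(96, [X,X,X,X,Y,Y,X,Y])], [(-1, Rule [] [Y,X,X,Y,X,Y,X] [X]), (2, Rule [] [X,Y,X,X,Y,X,X] [Y]), (-1, Rule []
     [X,X,Y,X,Y,X,X] [Y]), (4, Rule [] [X,X,Y,Y,X,Y,X] [X])]),
     ([(72, [X,X,X,Y,X,X,Y,Y]), (72, [X,X,X,Y,Y,X,X,Y])], [(2, Rule [] [X,Y,X,X,Y,X,X] [Y]), (-1, Rule []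
     [X,X,Y,X,Y,X,X] [Y]), (3, Rule [] [X,X,X,Y,Y,X,X] [Y])]),
     ([(72, [X,X,X,Y,X,Y,X,Y])], [(-2, Rule [] [X,Y,X,X,Y,X,X] [Y]), (1, Rule [] [X,X,Y,X,Y,X,X] [Y])]),
     ([(72, [X,X,Y,X,X,Y,X,Y])], [(1, Rule [] [X,X,Y,X,Y,X,X] [Y]), (1, Rule [] [X,Y,X,X,Y,X,X] [Y])]),
     ([(1, [X,X,X,Y,X,Y,Y,Y]), (-1, [Y,Y,Y,X,X,X,Y,X])], []),
     ([(24, [X,X,X,Y,Y,X,Y,Y]), (24, [X,X,X,Y,Y,Y,X,Y]), (24, [Y,Y,Y,X,X,X,Y,X])], [(1, Rule [] [X,X,X,Y,Y,Y,X]
     [Y])]),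
     ([(48, [X,X,Y,X,X,Y,Y,Y]), (48, [X,X,X,Y,Y,Y,X,Y]), (48, [Y,Y,Y,X,X,X,Y,X])], [(-4, Rule [] [X,Y,Y,X,Y,Y,X]
     [X]), (-1, Rule [] [X,Y,X,Y,Y,X,X] [Y]), (-1, Rule [] [Y,X,X,Y,X,Y,X] [Y]), (2, Rule [] [X,X,X,Y,Y,Y,X] [Y])]),
     ([(48, [X,X,Y,X,Y,X,Y,Y]), (48, [Y,Y,Y,X,X,X,Y,X])], [(1, Rule [] [X,Y,X,Y,Y,X,X] [Y]), (1, Rule []
     [Y,X,X,Y,X,Y,X] [Y])]),
     ([(24, [X,X,Y,X,Y,Y,X,Y]), (-24, [X,X,X,Y,Y,Y,X,Y]), (-24, [Y,Y,Y,X,X,X,Y,X])], [(1, Rule [] [X,X,Y,Y,X,Y,X]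
     [Y]), (-1, Rule [] [X,Y,X,Y,Y,X,X] [Y]), (2, Rule [] [X,Y,Y,X,Y,Y,X] [X]), (-1, Rule [] [X,X,X,Y,Y,Y,X] [Y])]),
     ([(48, [X,X,Y,Y,X,Y,X,Y]), (48, [X,X,X,Y,Y,Y,X,Y])], [(1, Rule [] [X,Y,X,Y,Y,X,X] [Y]), (-4, Rule []
     [X,Y,Y,X,Y,Y,X] [X]), (-1, Rule [] [Y,X,X,Y,X,Y,X] [Y]), (2, Rule [] [X,X,X,Y,Y,Y,X] [Y])]),
     ([(552, [X,X,Y,X,Y,Y,Y,Y])], [(2, Rule [] [Y,X,Y,Y,X,Y,X] [Y]), (-6, Rule [] [X,Y,X,Y,Y,Y,X] [Y]), (-2, Rule
     [] [X,Y,Y,X,Y,Y,X] [Y]), (7, Rule [] [Y,X,Y,X,Y,Y,X] [Y])]),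
     ([(1, [X,X,Y,Y,X,Y,Y,Y]), (-1, [Y,Y,Y,X,X,Y,Y,X])], []),
     ([(552, [X,X,Y,Y,Y,Y,X,Y])], [(4, Rule [] [Y,X,Y,X,Y,Y,X] [Y]), (-34, Rule [] [X,Y,Y,X,Y,Y,X] [Y]), (-10, Rule
     [] [X,Y,X,Y,Y,Y,X] [Y]), (11, Rule [] [Y,X,Y,Y,X,Y,X] [Y])]),
     ([(552, [X,Y,X,Y,X,Y,Y,Y])], [(-5, Rule [] [Y,X,Y,X,Y,Y,X] [Y]), (-8, Rule [] [Y,X,Y,Y,X,Y,X] [Y]), (24, Rule
     [] [X,Y,X,Y,Y,Y,X] [Y]), (8, Rule [] [X,Y,Y,X,Y,Y,X] [Y])]),
     ([(552, [X,Y,X,Y,Y,X,Y,Y])], [(8, Rule [] [X,Y,X,Y,Y,Y,X] [Y]), (18, Rule [] [X,Y,Y,X,Y,Y,X] [Y]), (6, Rule []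
     [Y,X,Y,X,Y,Y,X] [Y]), (5, Rule [] [Y,X,Y,Y,X,Y,X] [Y])]),
     ([(24, [X,Y,X,Y,Y,Y,Y,Y])], [(1, Rule [] [X,Y,X,Y,Y,Y,Y] [Y])]),
     ([(24, [X,Y,Y,X,Y,Y,Y,Y])], [(1, Rule [] [Y,Y,X,Y,Y,Y,Y] [X])]),
     ([(24, [X,X,X,X,X,Y,X,X,Y])], [(1, Rule [] [X,X,Y,X,X,Y,X,X] [X])]),
     ([(96, [X,X,X,X,Y,X,X,Y,Y])], [(-1, Rule [] [X,Y,X,X,Y,X,Y,X] [X])]),
     ([(24, [X,X,X,X,Y,X,Y,X,Y])], [(1, Rule [] [X,X,Y,X,Y,X,Y,X] [X])]),
     ([(96, [X,X,X,X,Y,Y,X,Y,Y])], [(1, Rule [] [X,X,Y,Y,X,Y,Y,X] [X]), (-4, Rule [] [X,X,Y,X,Y,Y,X,X] [Y]), (-1,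
     Rule [] [X,Y,X,X,Y,X,Y,X] [Y]), (4, Rule [] [X,X,Y,X,Y,X,Y,X] [Y])]),
     ([(192, [X,X,X,Y,X,X,Y,Y,Y]), (192, [X,X,Y,Y,X,Y,X,X,Y])], [(1, Rule [] [X,Y,X,X,Y,Y,X,Y] [X]), (-2, Rule []
     [X,Y,X,X,Y,X,Y,X] [Y]), (8, Rule [] [X,X,Y,X,Y,X,Y,X] [Y]), (1, Rule [] [X,X,X,Y,X,Y,Y,X] [Y]), (-4, Rule []
     [X,X,Y,X,Y,Y,X,X] [Y])]),
     ([(192, [X,X,X,Y,X,Y,X,Y,Y]), (-192, [X,X,Y,Y,X,Y,X,X,Y])], [(-4, Rule [] [X,X,Y,X,Y,Y,X,X] [Y]), (-1, Rule []
     [X,Y,X,X,Y,Y,X,Y] [X]), (-1, Rule [] [X,X,X,Y,X,Y,Y,X] [Y])]),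
     ([(96, [X,X,X,Y,X,Y,Y,X,Y])], [(1, Rule [] [X,X,X,Y,X,Y,Y,X] [Y]), (4, Rule [] [X,X,Y,X,Y,Y,X,X] [Y]), (1,
     Rule [] [X,Y,X,X,Y,X,Y,X] [Y]), (-4, Rule [] [X,X,Y,X,Y,X,Y,X] [Y])]),
     ([(96, [X,X,Y,X,X,Y,X,Y,Y]), (96, [X,X,Y,Y,X,Y,X,X,Y])], [(-1, Rule [] [X,Y,X,X,Y,X,Y,X] [Y]), (4, Rule []
     [X,X,Y,X,Y,X,Y,X] [Y])]),
     ([(1, [X,X,Y,X,X,Y,Y,X,Y]), (-1, [X,X,Y,Y,X,Y,X,X,Y])], []),
     ([(96, [X,X,X,Y,Y,X,Y,Y,Y]), (-96, [Y,Y,X,X,Y,X,Y,Y,X])], [(-1, Rule [] [Y,X,X,Y,X,Y,Y,X] [Y]), (1, Rule []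
     [X,X,Y,Y,X,Y,Y,X] [Y]), (-1, Rule [] [X,Y,X,X,Y,Y,X,Y] [Y])]),
     ([(192, [X,X,Y,X,X,Y,Y,Y,Y])], [(-1, Rule [] [X,X,Y,Y,X,Y,Y,X] [Y]), (1, Rule [] [X,Y,X,X,Y,Y,X,Y] [Y]), (8,
     Rule [] [X,X,Y,X,Y,Y,Y,X] [Y])]),
     ([(384, [X,X,Y,X,Y,X,Y,Y,Y]), (384, [Y,Y,X,X,Y,X,Y,Y,X])], [(2, Rule [] [X,Y,X,Y,Y,X,Y,X] [Y]), (-2, Rule []
     [X,Y,X,Y,X,Y,Y,X] [Y]), (5, Rule [] [X,X,Y,Y,X,Y,Y,X] [Y]), (-5, Rule [] [X,Y,X,X,Y,Y,X,Y] [Y]), (-8, Rule []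
     [X,X,Y,X,Y,Y,Y,X] [Y]), (-4, Rule [] [Y,X,X,Y,X,Y,Y,X] [Y])]),
     ([(1, [X,X,Y,X,Y,Y,X,Y,Y]), (-1, [Y,Y,X,X,Y,X,Y,Y,X])], []),
     ([(384, [X,X,Y,X,Y,Y,Y,X,Y])], [(24, Rule [] [X,X,Y,X,Y,Y,Y,X] [Y]), (-2, Rule [] [X,Y,X,Y,Y,X,Y,X] [Y]), (2,
     Rule [] [X,Y,X,Y,X,Y,Y,X] [Y]), (-3, Rule [] [X,X,Y,Y,X,Y,Y,X] [Y]), (3, Rule [] [X,Y,X,X,Y,Y,X,Y] [Y]), (4,
     Rule [] [Y,X,X,Y,X,Y,Y,X] [Y])]),
     ([(384, [X,X,Y,Y,X,Y,Y,X,Y]), (384, [Y,Y,X,X,Y,X,Y,Y,X])], [(-3, Rule [] [X,Y,X,X,Y,Y,X,Y] [Y]), (8, Rule []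
     [X,X,Y,X,Y,Y,Y,X] [Y]), (2, Rule [] [X,Y,X,Y,Y,X,Y,X] [Y]), (-2, Rule [] [X,Y,X,Y,X,Y,Y,X] [Y]), (7, Rule []
     [X,X,Y,Y,X,Y,Y,X] [Y]), (-4, Rule [] [Y,X,X,Y,X,Y,Y,X] [Y])]),
     ([(24, [X,X,Y,Y,X,Y,Y,Y,Y])], [(1, Rule [] [X,Y,Y,X,Y,Y,Y,Y] [X])]),
     ([(192, [X,Y,X,Y,X,Y,Y,Y,Y])], [(1, Rule [] [Y,X,X,Y,X,Y,Y,Y] [Y]), (-8, Rule [] [X,X,Y,X,Y,Y,Y,Y] [Y]), (-8,
     Rule [] [X,Y,Y,X,Y,Y,Y,Y] [X])]),
     ([(96, [X,Y,X,Y,Y,X,Y,Y,Y]), (96, [Y,Y,Y,X,Y,Y,X,Y,X])], [(1, Rule [] [Y,X,Y,X,Y,Y,Y,X] [Y]), (-8, Rule []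
     [X,Y,Y,X,Y,Y,Y,Y] [X])]),
     ([(24, [X,Y,Y,X,Y,Y,Y,Y,Y])], [(1, Rule [] [X,Y,Y,X,Y,Y,Y,Y] [Y])]),
     ([(384, [X,X,X,X,Y,X,X,Y,X,Y])], [(1, Rule [] [X,X,Y,X,X,Y,X,Y,X] [X])]),
     ([(384, [X,X,X,X,Y,X,Y,X,Y,Y])], [(1, Rule [] [X,X,Y,X,Y,X,Y,Y,X] [X])]),
     ([(768, [X,X,X,Y,X,X,Y,X,Y,Y])], [(-1, Rule [] [X,X,Y,X,X,Y,Y,X,Y] [X]), (1, Rule [] [X,X,X,Y,X,X,Y,Y,X] [Y]),
     (-1, Rule [] [X,X,Y,X,Y,X,Y,Y,X] [X])]),
     ([(768, [X,X,X,Y,X,Y,X,Y,Y,Y]), (-768, [X,X,X,Y,Y,Y,X,X,Y,Y])], [(-32, Rule [] [X,X,X,Y,Y,Y,X] [X,Y,Y]), (8,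
     Rule [] [X,X,X,Y,Y,X,Y,X] [Y,Y]), (2, Rule [] [X,X,X,Y,X,X,Y,Y,Y] [Y]), (-1, Rule [] [X,X,Y,Y,X,Y,Y,Y,X] [X]),
     (1, Rule [] [X,X,X,Y,Y,X,Y,Y,Y] [X])]),
     ([(384, [X,X,X,Y,X,Y,Y,X,Y,Y]), (384, [X,X,X,Y,Y,Y,X,X,Y,Y])], [(16, Rule [] [X,X,X,Y,Y,Y,X] [X,Y,Y]), (-4,
     Rule [] [X,X,X,Y,Y,X,Y,X] [Y,Y]), (-1, Rule [] [X,X,X,Y,X,X,Y,Y,Y] [Y])]),
     ([(768, [X,X,Y,X,X,Y,X,Y,Y,Y]), (768, [X,X,X,Y,Y,Y,X,X,Y,Y])], [(-2, Rule [] [X,X,Y,X,Y,Y,X,Y,X] [Y]), (4,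
     Rule [] [X,Y,X,X,Y,X,Y,Y,X] [Y]), (32, Rule [] [X,X,X,Y,Y,Y,X] [X,Y,Y]), (-8, Rule [] [X,X,X,Y,Y,X,Y,X]
     [Y,Y]), (-2, Rule [] [X,X,X,Y,X,X,Y,Y,Y] [Y]), (1, Rule [] [X,X,Y,Y,X,Y,Y,Y,X] [X]), (-1, Rule []
     [X,X,X,Y,Y,X,Y,Y,Y] [X])]),
     ([(192, [X,X,Y,X,Y,X,Y,Y,Y,Y])], [(1, Rule [] [X,Y,X,Y,X,Y,Y,Y,Y] [X])]),
     ([(1536, [X,X,Y,X,Y,Y,X,Y,Y,Y])], [(1, Rule [] [Y,X,X,Y,Y,X,Y,Y,Y] [X]), (-1, Rule [] [X,X,Y,Y,X,Y,Y,Y,X]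
     [Y]), (-4, Rule [] [X,Y,X,Y,X,Y,Y,Y,Y] [X])]),
     ([(768, [X,Y,X,Y,Y,X,Y,Y,Y,Y])], [(1, Rule [] [Y,X,X,Y,Y,X,Y,Y,Y] [Y]), (-32, Rule [] [X,X,Y,Y,X,Y,Y,Y,Y]
     [Y])])]"

definition gen_words :: "letter list list" where
  "gen_words = [
     [X], [Y], [X,X], [X,Y], [Y,Y], [X,X,X], [X,X,Y], [X,Y,Y], [Y,Y,Y], [X,X,X,X], [X,X,X,Y], [X,X,Y,Y], [X,Y,Y,Y],
     [Y,Y,Y,Y], [X,Y,X,Y], [X,X,X,Y,Y], [Y,Y,Y,X,X], [X,X,Y,X,X,Y], [Y,Y,X,Y,Y,X], [X,X,Y,Y,X,Y], [Y,Y,X,X,Y,X],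
     [X,X,X,Y,Y,X,Y], [Y,Y,Y,X,X,Y,X], [X,X,X,Y,Y,X,X,Y], [Y,Y,Y,X,X,Y,Y,X], [X,X,X,Y,Y,Y,X,Y], [Y,Y,Y,X,X,X,Y,X],
     [X,X,X,Y,X,X,Y,X,Y], [X,X,Y,Y,X,Y,X,X,Y], [Y,Y,X,X,Y,X,Y,Y,X], [Y,Y,Y,X,Y,Y,X,Y,X], [X,X,X,Y,Y,Y,X,X,Y,Y]]"

lemma reductions_check:
  "case derive_rules Tip rule_certs of None \<Rightarrow> False
   | Some rs \<Rightarrow> list_all (check_necklace gen_words rs) necklace_certs \<and>
       sweep (gen_words @ map (\<lambda>(p, cert). snd (hd p)) necklace_certs) rs [[]] 10"
  by code_simp

theorem word_traces_generated:
  "(word_trace w :: 'k::field_char_0 mat4 \<times> 'k mat4 \<Rightarrow> 'k) \<in> generated_algebra (word_trace ` set gen_words)"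
proof -
  obtain rs where r: "derive_rules Tip rule_certs = Some rs"
    "list_all (check_necklace gen_words rs) necklace_certs"
    "sweep (gen_words @ map (\<lambda>(p, cert). snd (hd p)) necklace_certs) rs [[]] 10"
    using reductions_check by (cases "derive_rules Tip rule_certs") auto
  show ?thesis
    by (rule words_generated[OF _ r]) (auto intro: generated_algebra.base)
qed

section \<open>Functionals vanishing on decomposable invariants\<close>

lemma cycle_of_list_next:
  assumes "distinct (as @ x # y # bs)"
  shows "cycle_of_list (as @ x # y # bs) x = y"
proof -
  let ?ds = "as @ x # y # bs"
  have "map (cycle_of_list ?ds) ?ds = rotate1 ?ds"
    using cyclic_rotation[OF assms, of 1] by simp
  then have "map (cycle_of_list ?ds) ?ds ! length as = rotate1 ?ds ! length as" by simp
  then show ?thesis by (cases as) (simp_all add: nth_append)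
qed

lemma cycle_of_list_last:
  assumes "distinct ds" "ds \<noteq> []"
  shows "cycle_of_list ds (last ds) = hd ds"
proof -
  have "map (cycle_of_list ds) ds = rotate1 ds"
    using cyclic_rotation[OF assms(1), of 1] by simp
  then have "last (map (cycle_of_list ds) ds) = last (rotate1 ds)" by simp
  then show ?thesis using assms(2) by (cases ds) (simp_all add: last_map del: map_eq_conv list.map)
qed

lemma cycle_of_list_succ_cases:
  assumes "distinct ds" "x \<in> set ds"
  obtains as bs where "ds = as @ x # cycle_of_list ds x # bs"
  | "x = last ds" "cycle_of_list ds x = hd ds"
proof -
  obtain as bs where ds: "ds = as @ x # bs" using assms(2) by (meson split_list)
  show ?thesis
  proof (cases bs)
    case Nil
    then show ?thesis using that(2) cycle_of_list_last[OF assms(1)] ds by auto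
  next
    case (Cons y bs')
    then have "cycle_of_list ds x = y" using cycle_of_list_next[of as x y bs'] assms(1) ds by simp
    then show ?thesis using that(1)[of as bs'] ds Cons by simp
  qed
qed

lemma cycle_of_list_in: "x \<in> set ds \<Longrightarrow> cycle_of_list ds x \<in> set ds"
  using permutes_in_image[OF cycle_permutes] by metis

text \<open>A cycle acts transitively on its support: following it from one point of
  \<open>K\<close> reaches every element.\<close>

lemma cycle_invariant_subset:
  assumes "distinct ds" "K \<subseteq> set ds" "K \<noteq> {}" "\<And>x. x \<in> K \<Longrightarrow> cycle_of_list ds x \<in> K"
  shows "K = set ds"
proof -
  obtain k where k: "k < length ds" "ds ! k \<in> K"
    using assms(2,3) by (metis all_not_in_conv in_set_conv_nth subsetD)
  define es where "es = rotate k ds"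
  have es: "distinct es" "set es = set ds" "cycle_of_list es = cycle_of_list ds" "es \<noteq> []"
    using assms(1) k cycle_of_list_rotate_independent[OF assms(1), of k] by (auto simp: es_def)
  obtain e es' where e: "es = e # es'" using es(4) by (cases es) auto
  have "ds \<noteq> []" using k by auto
  then have "e \<in> K" using k hd_rotate_conv_nth[of ds k] e unfolding es_def by simp
  have "es ! j \<in> K" if "j < length es" for j
    using that
  proof (induction j)
    case 0
    then show ?case using \<open>e \<in> K\<close> e by simp
  next
    case (Suc j)
    then have "cycle_of_list es (es ! j) = es ! Suc j"
      using cycle_of_list_nth[of e es' j] es(1) e by (simp add: nth_append)
    then show ?case using assms(4)[of "es ! j"] Suc es(3) by simp
  qed
  then have "set es \<subseteq> K" by (metis in_set_conv_nth subsetI)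
  then show ?thesis using assms(2) es(2) by simp
qed

lemma cycle_of_list_rotation:
  assumes "distinct cs" "distinct ds" "set cs = set ds" "cycle_of_list cs = cycle_of_list ds"
  shows "\<exists>k. ds = rotate k cs"
proof (cases ds)
  case Nil
  then show ?thesis using assms by auto
next
  case (Cons d ds')
  then obtain k where k: "k < length cs" "cs ! k = d"
    using assms(3) by (metis in_set_conv_nth list.set_intros(1))
  then have "cs \<noteq> []" by auto
  then have "hd (rotate k cs) = d" using k by (simp add: hd_rotate_conv_nth)
  then obtain es where es: "rotate k cs = d # es"
    using \<open>cs \<noteq> []\<close> by (cases "rotate k cs") auto
  have "es = ds'"
  proof (rule cycle_of_list_eqI)
    show "distinct (d # es)" unfolding es[symmetric] using assms(1) by simp
    show "distinct (d # ds')" using assms(2) Cons by simp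
    have "insert d (set es) = insert d (set ds')"
      using assms(3) Cons es by (metis list.simps(15) set_rotate)
    then show "set ds' = set es"
      using \<open>distinct (d # es)\<close> \<open>distinct (d # ds')\<close> by auto
    show "cycle_of_list (d # es) = cycle_of_list (d # ds')"
      unfolding es[symmetric] Cons[symmetric] using assms(4) cycle_of_list_rotate_independent[OF assms(1), of k] by simp
  qed
  then show ?thesis using es Cons by metis
qed

text \<open>The converse of \<open>cycles_of_exists\<close>, by which a product of traces is
  realized as a contraction.\<close>

lemma cycles_of_construct:
  assumes "distinct (concat css)" "[] \<notin> set css"
  shows "\<exists>s. s permutes set (concat css) \<and> cycles_of css (set (concat css)) s"
  using assms
proof (induction css)
  case Nil
  show ?case
    by (intro exI[of _ id] conjI) (simp_all only: concat.simps list.set permutes_id cycles_of_def, simp_all)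
next
  case (Cons cs css)
  then obtain s where s: "s permutes set (concat css)" "cycles_of css (set (concat css)) s" by auto
  let ?t = "cycle_of_list cs \<circ> s"
  have perm: "?t permutes set (concat (cs # css))"
    by (intro permutes_compose permutes_subset[OF s(1)] permutes_subset[OF cycle_permutes]) auto
  have "?t l = cycle_of_list ds l" if "ds \<in> set (cs # css)" "l \<in> set ds" for ds l
  proof (cases "l \<in> set cs")
    case True
    then have "l \<notin> set (concat css)" using Cons.prems by auto
    then have "s l = l" using s(1) by (simp add: permutes_not_in)
    moreover have "ds = cs" using that True Cons.prems by auto
    ultimately show ?thesis by simp
  next
    case False
    then have ds: "ds \<in> set css" using that by auto
    then have "s l = cycle_of_list ds l" using s(2) that by (auto simp: cycles_of_def)
    moreover have "cycle_of_list ds l \<notin> set cs"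
      using cycle_of_list_in[OF that(2)] ds Cons.prems by auto
    ultimately show ?thesis by (simp add: id_outside_supp)
  qed
  then have "cycles_of (cs # css) (set (concat (cs # css))) ?t"
    using Cons.prems by (auto simp: cycles_of_def)
  with perm show ?case by (intro exI[of _ ?t] conjI)
qed

lemma chunk_list:
  assumes "map c D = concat ws"
  shows "\<exists>css. concat css = D \<and> map (map c) css = ws"
  using assms
proof (induction ws arbitrary: D)
  case Nil
  then show ?case by (intro exI[of _ "[]"]) simp
next
  case (Cons w ws)
  have "map c (drop (length w) D) = concat ws" "map c (take (length w) D) = w"
    using Cons.prems by (simp_all add: drop_map[symmetric] take_map[symmetric])
  then obtain css where "concat css = drop (length w) D" "map (map c) css = ws"
    using Cons.IH by blast
  then show ?case using \<open>map c (take (length w) D) = w\<close>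
    by (intro exI[of _ "take (length w) D # css"]) simp
qed

lemma split_segments:
  assumes "cs \<noteq> [] \<Longrightarrow> last cs \<in> P"
  shows "\<exists>segs. concat segs = cs \<and> (\<forall>S\<in>set segs. S \<noteq> [] \<and> last S \<in> P \<and> set (butlast S) \<inter> P = {})"
  using assms
proof (induction "length cs" arbitrary: cs rule: less_induct)
  case less
  show ?case
  proof (cases "cs = []")
    case True
    then show ?thesis by (intro exI[of _ "[]"]) simp
  next
    case False
    then have "\<exists>x\<in>set cs. x \<in> P" using less.prems last_in_set by blast
    from split_list_first_prop[OF this]
    obtain as p bs where cs: "cs = as @ p # bs" "p \<in> P" "\<forall>y\<in>set as. y \<notin> P"
      by (elim exE bexE conjE)
    have "\<exists>segs. concat segs = bs \<and> (\<forall>S\<in>set segs. S \<noteq> [] \<and> last S \<in> P \<and> set (butlast S) \<inter> P = {})"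
      using less.prems cs by (intro less.hyps) auto
    then obtain segs where "concat segs = bs" "\<forall>S\<in>set segs. S \<noteq> [] \<and> last S \<in> P \<and> set (butlast S) \<inter> P = {}"
      by blast
    then show ?thesis using cs by (intro exI[of _ "(as @ [p]) # segs"]) auto
  qed
qed

text \<open>The points of \<open>P\<close> name the segments by their last elements. Joining the
  segments in the cyclic order of \<open>qs\<close> gives a cycle whose successors inside the
  segments do not depend on \<open>qs\<close>; only the successors of the points of \<open>P\<close>
  do.\<close>

context
  fixes P :: "'a set" and seg :: "'a \<Rightarrow> 'a list"
  assumes seg_last: "\<And>p. p \<in> P \<Longrightarrow> seg p \<noteq> [] \<and> last (seg p) = p \<and> set (butlast (seg p)) \<inter> P = {}"
begin

lemma cycle_of_segments_inside:
  assumes "distinct qs" "set qs = P" "distinct (concat (map seg qs))" "p \<in> P" "seg p = as @ x # y # bs"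
  shows "cycle_of_list (concat (map seg qs)) x = y"
proof -
  obtain A B where "qs = A @ p # B" using assms(2,4) by (metis split_list)
  then have "concat (map seg qs) = (concat (map seg A) @ as) @ x # y # (bs @ concat (map seg B))"
    using assms(5) by simp
  then show ?thesis using assms(3) cycle_of_list_next by metis
qed

lemma cycle_of_segments_last:
  assumes "distinct qs" "set qs = P" "distinct (concat (map seg qs))" "p \<in> P"
  shows "cycle_of_list (concat (map seg qs)) p = hd (seg (cycle_of_list qs p))"
proof -
  have p: "seg p = butlast (seg p) @ [p]" using seg_last[OF assms(4)] by (metis append_butlast_last_id)
  have "p \<in> set qs" using assms by simp
  with assms(1) show ?thesis
  proof (cases rule: cycle_of_list_succ_cases)
    case (1 A B)
    let ?q = "cycle_of_list qs p"
    have "?q \<in> P" using assms(2,4) cycle_of_list_in by metis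
    then have q: "seg ?q = hd (seg ?q) # tl (seg ?q)" using seg_last by simp
    have "concat (map seg qs) = concat (map seg A) @ seg p @ seg ?q @ concat (map seg B)"
      by (subst 1) simp
    also have "\<dots> = (concat (map seg A) @ butlast (seg p)) @ p # hd (seg ?q) # (tl (seg ?q) @ concat (map seg B))"
      by (subst p, subst q) simp
    finally show ?thesis using assms(3) cycle_of_list_next by metis
  next
    case 2
    have "qs \<noteq> []" using \<open>p \<in> set qs\<close> by auto
    then have "hd qs \<in> P" "last qs \<in> P" using assms(2) by auto
    obtain q qs' where qs: "qs = q # qs'" using \<open>qs \<noteq> []\<close> by (cases qs) auto
    have "hd (concat (map seg qs)) = hd (seg q)" "concat (map seg qs) \<noteq> []"
      using seg_last[of q] assms(2) by (auto simp: qs)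
    moreover have "last (concat (map seg qs)) = p"
    proof -
      obtain B where B: "qs = B @ [p]" using 2(1) \<open>qs \<noteq> []\<close> by (metis append_butlast_last_id)
      show ?thesis unfolding B using seg_last[OF assms(4)] by simp
    qed
    ultimately show ?thesis using cycle_of_list_last[OF assms(3)] 2 by (simp add: qs)
  qed
qed

lemma segment_inside_cases:
  assumes "p \<in> P" "x \<in> set (seg p)" "x \<notin> P"
  obtains as y bs where "seg p = as @ x # y # bs"
proof -
  obtain as bs where s: "seg p = as @ x # bs" using assms(2) by (meson split_list)
  then have "bs \<noteq> []" using seg_last[OF assms(1)] assms(1,3) by auto
  then obtain y bs' where "bs = y # bs'" by (cases bs) auto
  then show ?thesis by (simp add: s that[of as y bs'])
qed

end

lemma mset_concat_cong:
  assumes "mset Ss = mset Ts"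
  shows "mset (concat Ss) = mset (concat Ts)"
proof -
  have "mset (concat Us) = sum_mset (image_mset mset (mset Us))" for Us :: "'a list list"
    by (simp add: mset_concat sum_mset_sum_list[symmetric])
  then show ?thesis using assms by simp
qed

lemma word_trace_scale:
  "word_trace w (scale_mat s x, scale_mat t y)
    = s ^ count_list w X * t ^ count_list w Y * word_trace w (x, y :: 'k::comm_ring_1 mat4)"
proof -
  have 1: "trace (scale_mat c A) = c * trace A" for c and A :: "'k mat4"
    by (simp add: trace_def scale_mat_def sum_distrib_left)
  have 2: "scale_mat c A ** B = scale_mat c (A ** B)" "A ** scale_mat c B = scale_mat c (A ** B)"
    "scale_mat c (scale_mat d A) = scale_mat (c * d) A" "scale_mat 1 A = A" for c d and A B :: "'k mat4"
    by (simp_all add: scale_mat_def matrix_matrix_mult_def vec_eq_iff sum_distrib_left ac_simps)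
  have "matprod (map (\<lambda>l. letter_mat l (scale_mat s x, scale_mat t y)) w)
      = scale_mat (s ^ count_list w X * t ^ count_list w Y) (matprod (map (\<lambda>l. letter_mat l (x, y)) w))"
  proof (induction w)
    case (Cons l w)
    then show ?case by (cases l) (simp_all add: 2 ac_simps)
  qed (simp add: 2)
  then show ?thesis by (simp add: word_trace_def 1)
qed

lemma multilin_scale: "multilin m (\<lambda>i j. c * T i j) Z = c * multilin m T Z"
  by (simp add: multilin_def sum_distrib_left mult.assoc)

lemma contr_conj:
  fixes Z :: "nat \<Rightarrow> 'k::comm_ring_1 ^ 'n ^ 'n"
  assumes h: "h permutes {..<m}" and s: "s permutes {..<m}"
  shows "contr {..<m} (\<lambda>l. Z (h l)) s = contr {..<m} Z (h \<circ> s \<circ> inv h)"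
proof -
  have "perm_mat m s (i \<circ> h) (j \<circ> h) = (perm_mat m (h \<circ> s \<circ> inv h) i j :: 'k)" for i j :: "nat \<Rightarrow> 'n"
  proof -
    have "j \<circ> h = i \<circ> h \<circ> s \<longleftrightarrow> j = i \<circ> (h \<circ> s \<circ> inv h)"
    proof
      assume "j \<circ> h = i \<circ> h \<circ> s"
      then have "j \<circ> h \<circ> inv h = i \<circ> h \<circ> s \<circ> inv h" by simp
      then show "j = i \<circ> (h \<circ> s \<circ> inv h)" by (simp only: comp_assoc permutes_inv_o[OF h] comp_id)
    next
      assume "j = i \<circ> (h \<circ> s \<circ> inv h)"
      then show "j \<circ> h = i \<circ> h \<circ> s" by (simp only: comp_assoc permutes_inv_o[OF h] comp_id)
    qed
    then show ?thesis unfolding perm_mat_def tuples_comp_perm[OF h] by simp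
  qed
  moreover have "h \<circ> s \<circ> inv h permutes {..<m}"
    by (intro permutes_compose permutes_inv h s)
  ultimately show ?thesis
    by (simp only: multilin_perm_mat[symmetric] s multilin_permute[OF h])
qed

text \<open>
  The segments of a cycle can be rotated and the sum is symmetric in \<open>zs\<close>, so demanding in \<open>kill\<close> that
  \<open>z\<close> is longest and \<open>zs\<close> is sorted by length loses nothing; it shortens the computation.
\<close>

locale necklace_functional =
  fixes a b :: nat and \<phi> :: "letter list \<Rightarrow> int"
  assumes nonempty: "a + b > 0"
    and rot: "\<And>u v. \<phi> (u @ v) = \<phi> (v @ u)"
    and kill: "\<And>z zs. count_list (z @ concat zs) X = a \<Longrightarrow> count_list (z @ concat zs) Y = b \<Longrightarrow>
      z \<noteq> [] \<Longrightarrow> length zs = 4 \<Longrightarrow> [] \<notin> set zs \<Longrightarrow> sorted (map length zs) \<Longrightarrow>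
      (\<forall>z'\<in>set zs. length z' \<le> length z) \<Longrightarrow> (\<Sum>qs\<leftarrow>perm_list zs. \<phi> (z @ concat qs)) = 0"
begin

definition label :: "nat \<Rightarrow> letter" where
  "label l = (if l < a then X else Y)"

definition full_cycle :: "nat list \<Rightarrow> (nat \<Rightarrow> nat) \<Rightarrow> bool" where
  "full_cycle cs s \<longleftrightarrow> distinct cs \<and> set cs = {..<a + b} \<and> s = cycle_of_list cs"

text \<open>Extension by zero to permutations that are not a single cycle makes the functional
  vanish on proper products of traces. All choices of the list give the same value, since \<phi> is
  constant on rotations.\<close>

definition \<Phi> :: "(nat \<Rightarrow> nat) \<Rightarrow> int" where
  "\<Phi> s = (if \<exists>cs. full_cycle cs s then \<phi> (map label (SOME cs. full_cycle cs s)) else 0)"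

lemma rotate_invariant: "\<phi> (rotate k w) = \<phi> w"
  by (simp add: rotate_drop_take rot[of "drop _ _"])

lemma \<Phi>_full_cycle:
  assumes "full_cycle cs s"
  shows "\<Phi> s = \<phi> (map label cs)"
proof -
  define ds where "ds = (SOME cs. full_cycle cs s)"
  have "full_cycle ds s" unfolding ds_def using assms by (rule someI)
  then obtain k where "ds = rotate k cs"
    using cycle_of_list_rotation[of cs ds] assms unfolding full_cycle_def by auto
  then have "\<phi> (map label ds) = \<phi> (map label cs)"
    by (simp add: rotate_map[symmetric] rotate_invariant)
  then show ?thesis using assms by (auto simp: \<Phi>_def ds_def)
qed

lemma count_label:
  assumes "distinct cs" "set cs = {..<a + b}"
  shows "count_list (map label cs) X = a" "count_list (map label cs) Y = b"
proof -
  have *: "count_list (map label cs) c = card {l \<in> {..<a + b}. label l = c}" for c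
  proof -
    have "count_list (map label cs) c = length (filter (\<lambda>l. label l = c) cs)"
      by (induction cs) auto
    also have "\<dots> = card (set (filter (\<lambda>l. label l = c) cs))"
      using assms(1) by (intro distinct_card[symmetric]) simp
    finally show ?thesis using assms(2) by simp
  qed
  have "{l \<in> {..<a + b}. label l = X} = {..<a}" "{l \<in> {..<a + b}. label l = Y} = {a..<a + b}"
    by (auto simp: label_def)
  then show "count_list (map label cs) X = a" "count_list (map label cs) Y = b"
    by (simp_all add: *)
qed

text \<open>The sum over all orders of the four segments does not depend on how they are listed, so
  they may be sorted by length to meet the hypotheses of \<open>kill\<close>, with the longest
  segment as \<open>z\<close>.\<close>

lemma segment_sum:
  assumes segs: "segs = S # segs'" "length segs' = 4" "distinct (concat segs)" "set (concat segs) = {..<a + b}"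
    and ne: "[] \<notin> set segs" and longest: "\<And>T. T \<in> set segs' \<Longrightarrow> length T \<le> length S"
    and seg: "\<And>T. T \<in> set segs' \<Longrightarrow> seg (last T) = T"
  shows "(\<Sum>ps | distinct ps \<and> set ps = last ` set segs'. \<phi> (map label (S @ concat (map seg ps)))) = 0"
proof -
  define xs where "xs = sort_key (\<lambda>p. length (seg p)) (map last segs')"
  define zs where "zs = map (\<lambda>p. map label (seg p)) xs"
  have dist: "distinct (map last segs')"
  proof -
    have "distinct segs'"
      using segs(1,3) ne by (auto simp: distinct_concat_iff removeAll_id)
    moreover have "inj_on last (set segs')" by (rule inj_on_inverseI[of _ seg]) (rule seg)
    ultimately show ?thesis by (simp add: distinct_map)
  qed
  then have xs: "distinct xs" "set xs = last ` set segs'" "length xs = 4"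
    using segs(2) by (simp_all add: xs_def)
  have mset_xs: "mset (map seg xs) = mset segs'"
  proof -
    have "mset (map seg xs) = image_mset seg (mset (map last segs'))" by (simp add: xs_def)
    also have "\<dots> = mset (map (seg \<circ> last) segs')" by (simp add: multiset.map_comp)
    also have "map (seg \<circ> last) segs' = segs'" by (rule map_idI) (simp add: seg)
    finally show ?thesis .
  qed
  have segs_xs: "seg p \<in> set segs'" if "p \<in> set xs" for p
    using that seg by (auto simp: xs(2))
  have set_eq: "set (concat (S # map seg xs)) = set (concat segs)"
    using arg_cong[OF mset_xs, of set_mset] by (simp add: segs(1))
  have "mset (concat (S # map seg xs)) = mset (concat segs)"
    by (rule mset_concat_cong) (simp only: mset.simps mset_xs segs(1))
  then have "distinct (concat (S # map seg xs))"
    using segs(3) mset_eq_imp_distinct_iff by blast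
  then have cnt: "count_list (map label (concat (S # map seg xs))) X = a"
    "count_list (map label (concat (S # map seg xs))) Y = b"
    using count_label[of "concat (S # map seg xs)"] set_eq segs(4) by simp_all
  have zs_eq: "map label S @ concat zs = map label (concat (S # map seg xs))"
    by (simp add: zs_def map_concat comp_def)
  have "(\<Sum>ps | distinct ps \<and> set ps = last ` set segs'. \<phi> (map label (S @ concat (map seg ps))))
      = (\<Sum>ps\<leftarrow>perm_list xs. \<phi> (map label (S @ concat (map seg ps))))"
    using xs by (simp add: sum_list_perm_list)
  also have "\<dots> = (\<Sum>qs\<leftarrow>perm_list zs. \<phi> (map label S @ concat qs))"
    by (simp add: zs_def perm_list_map comp_def map_concat)
  also have "\<dots> = 0"
  proof (rule kill)
    show "count_list (map label S @ concat zs) X = a" "count_list (map label S @ concat zs) Y = b"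
      unfolding zs_eq by (fact cnt)+
    show "map label S \<noteq> []" using ne segs(1) by auto
    show "length zs = 4" using xs(3) by (simp add: zs_def)
    show "[] \<notin> set zs" using segs_xs ne segs(1) by (fastforce simp: zs_def)
    have "sorted (map (\<lambda>p. length (seg p)) xs)" unfolding xs_def by (rule sorted_sort_key)
    then show "sorted (map length zs)" by (simp add: zs_def comp_def)
    show "\<forall>z'\<in>set zs. length z' \<le> length (map label S)"
      using segs_xs longest by (auto simp: zs_def)
  qed
  finally show ?thesis .
qed

text \<open>Five points cut a full cycle into five segments. After a shift by the cyclic order of
  these segments only 5-cycles contribute, all with sign 1, and their values belong to the
  arrangements of four segments behind the longest one; this is the sum in
  \<open>kill\<close>.\<close>

lemma alternating_full_cycle:
  assumes u: "full_cycle cs u" and P: "P \<subseteq> {..<a + b}" "card P = 5"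
  shows "(\<Sum>r | r permutes P. sign r * \<Phi> (u \<circ> r)) = 0"
proof -
  have finP: "finite P" using P(2) card.infinite by fastforce
  have cs: "distinct cs" "set cs = {..<a + b}" "u = cycle_of_list cs" using u by (auto simp: full_cycle_def)
  obtain p where "p \<in> P" using P(2) by fastforce
  then obtain k where k: "k < length cs" "cs ! k = p" using P(1) cs(2) by (metis in_set_conv_nth subsetD)
  \<comment> \<open>Rotation by \<open>Suc k\<close> puts \<open>p\<close> last, so that cutting
    after the points of \<open>P\<close> leaves no remainder.\<close>
  define cs' where "cs' = rotate (Suc k) cs"
  have cs'0: "cs' \<noteq> []" "last cs' = p"
  proof -
    have "cs \<noteq> []" using k by auto
    then obtain d ds where "rotate k cs = d # ds" by (cases "rotate k cs") auto
    moreover have "hd (rotate k cs) = p" using k \<open>cs \<noteq> []\<close> by (simp add: hd_rotate_conv_nth)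
    ultimately show "cs' \<noteq> []" "last cs' = p" by (simp_all add: cs'_def)
  qed
  have cs': "distinct cs'" "set cs' = {..<a + b}" "u = cycle_of_list cs'"
    using cs cycle_of_list_rotate_independent[OF cs(1), of "Suc k"] by (simp_all add: cs'_def del: rotate_Suc)
  obtain segs0 where segs0: "concat segs0 = cs'"
    "\<forall>S\<in>set segs0. S \<noteq> [] \<and> last S \<in> P \<and> set (butlast S) \<inter> P = {}"
    using split_segments[of cs' P] cs'0 \<open>p \<in> P\<close> by auto
  have "segs0 \<noteq> []" using segs0(1) cs'0(1) by auto
  obtain S where S: "S \<in> set segs0" "\<And>T. T \<in> set segs0 \<Longrightarrow> length T \<le> length S"
  proof -
    have "finite (length ` set segs0)" "length ` set segs0 \<noteq> {}" using \<open>segs0 \<noteq> []\<close> by auto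
    then obtain S where "S \<in> set segs0" "length S = Max (length ` set segs0)"
      using Max_in by (metis (no_types, lifting) imageE)
    then show ?thesis using that \<open>finite (length ` set segs0)\<close> by (metis Max_ge imageI)
  qed
  obtain A B where AB: "segs0 = A @ S # B" using S(1) by (meson split_list)
  \<comment> \<open>A rotation that begins with the longest segment, which becomes the word
    \<open>z\<close> of \<open>kill\<close>.\<close>
  define segs' where "segs' = B @ A"
  define segs where "segs = S # segs'"
  have set_segs: "set segs = set segs0" by (auto simp: segs_def segs'_def AB)
  have rot_segs: "concat segs = rotate (length (concat A)) cs'"
    unfolding segs0(1)[symmetric] AB segs_def segs'_def by (simp add: rotate_append)
  then have segs: "distinct (concat segs)" "set (concat segs) = {..<a + b}" "u = cycle_of_list (concat segs)"
    using cs' cycle_of_list_rotate_independent[OF cs'(1)] by simp_all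
  have ne: "S \<noteq> []" "last S \<in> P" "set (butlast S) \<inter> P = {}" if "S \<in> set segs" for S
    using segs0(2) that set_segs by auto
  have uniq: "S = T" if "S \<in> set segs" "T \<in> set segs" "x \<in> set S" "x \<in> set T" for S T x
  proof (rule ccontr)
    assume "S \<noteq> T"
    then have "set S \<inter> set T = {}" using segs(1) that by (auto simp: distinct_concat_iff)
    then show False using that by auto
  qed
  define seg where "seg q = (THE S. S \<in> set segs \<and> last S = q)" for q
  have seg: "seg (last S) = S" if "S \<in> set segs" for S
    unfolding seg_def
  proof (rule the_equality)
    fix T assume T: "T \<in> set segs \<and> last T = last S"
    then have "last S \<in> set T" "last S \<in> set S"
      using ne(1) that last_in_set by metis+
    then show "T = S" using uniq T that by blast
  qed (use that in simp)
  have mem_last: "last S = x" if "S \<in> set segs" "x \<in> set S" "x \<in> P" for S x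
  proof -
    have "S = butlast S @ [last S]" using ne(1)[OF that(1)] by simp
    then have "x \<in> set (butlast S) \<or> x = last S" using that(2) by (metis in_set_conv_decomp rotate1.simps(2) set_ConsD set_rotate1)
    then show ?thesis using ne(3)[OF that(1)] that(3) by auto
  qed
  have last_P: "last ` set segs = P"
  proof (intro equalityI subsetI)
    fix x assume "x \<in> P"
    then have "x \<in> set (concat segs)" using segs(2) P(1) by auto
    then obtain S where "S \<in> set segs" "x \<in> set S" by auto
    then show "x \<in> last ` set segs" using mem_last \<open>x \<in> P\<close> by blast
  qed (use ne in auto)
  have seg_P: "seg q \<in> set segs" "seg q \<noteq> []" "last (seg q) = q" "set (butlast (seg q)) \<inter> P = {}" if qP: "q \<in> P" for q
  proof -
    obtain T where T: "T \<in> set segs" "q = last T" using qP last_P by blast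
    then have "seg q = T" using seg by simp
    then show "seg q \<in> set segs" "seg q \<noteq> []" "last (seg q) = q" "set (butlast (seg q)) \<inter> P = {}"
      using T ne[OF T(1)] by simp_all
  qed
  have segP: "seg q \<noteq> [] \<and> last (seg q) = q \<and> set (butlast (seg q)) \<inter> P = {}" if "q \<in> P" for q
    using seg_P that by auto
  define p0 where "p0 = last S"
  have distsegs: "distinct segs"
  proof -
    have "[] \<notin> set segs" using ne(1) by blast
    then show ?thesis using segs(1) by (simp add: distinct_concat_iff removeAll_id)
  qed
  define qs0 where "qs0 = map last segs"
  have "inj_on last (set segs)" by (rule inj_on_inverseI[of _ seg]) (rule seg)
  then have qs0: "distinct qs0" "set qs0 = P" "map seg qs0 = segs"
    using distsegs last_P seg by (auto simp: qs0_def distinct_map intro: map_idI)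
  have len: "length segs' = 4"
    using distinct_card[OF qs0(1)] qs0(2) P(2) by (simp add: qs0_def segs_def)
  define v where "v = cycle_of_list qs0"
  have v: "v permutes P" unfolding v_def using cycle_permutes qs0(2) by metis
  have u_perm: "u permutes {..<a + b}" unfolding cs(3) cs(2)[symmetric] by (rule cycle_permutes)
  have u_last: "u q = hd (seg (v q))" if "q \<in> P" for q
    using cycle_of_segments_last[OF segP qs0(1,2) _ that] qs0(3) segs by (simp add: v_def)
  have u_inside: "u x = y" if "q \<in> P" "seg q = as @ x # y # bs" for q as x y bs
    using cycle_of_segments_inside[OF segP qs0(1,2) _ that] qs0(3) segs by simp
  have last_segs': "last ` set segs' = P - {p0}"
  proof -
    have "P = insert p0 (last ` set segs')" using last_P by (simp add: segs_def p0_def)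
    moreover have "p0 \<notin> last ` set segs'" using qs0(1) by (simp add: qs0_def segs_def p0_def)
    ultimately show ?thesis by auto
  qed
  define Q where "Q = {ps. distinct ps \<and> set ps = P - {p0}}"
  define C where "C = (\<lambda>ps. cycle_of_list (p0 # ps)) ` Q"
  \<comment> \<open>\<open>P\<close> cuts the cycle \<open>u\<close> into segments, joined in the cyclic order \<open>v\<close>;
    \<open>u \<circ> (inv v \<circ> r)\<close> joins them according to \<open>r\<close> instead and is a full cycle iff \<open>r\<close> is one.\<close>
  define f where "f r = \<Phi> (u \<circ> (inv v \<circ> r))" for r
  have p0P: "p0 \<in> P" using last_P by (auto simp: p0_def segs_def)
  have Q: "distinct (p0 # ps)" "set (p0 # ps) = P" "length ps = 4" if "ps \<in> Q" for ps
    using that p0P P(2) finP distinct_card[of ps] by (auto simp: Q_def)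
  have inj: "inj_on (\<lambda>ps. cycle_of_list (p0 # ps)) Q"
  proof (rule inj_onI)
    fix ps qs assume "ps \<in> Q" "qs \<in> Q" "cycle_of_list (p0 # ps) = cycle_of_list (p0 # qs)"
    then show "ps = qs" using Q(1) by (intro cycle_of_list_eqI[of p0]) (auto simp: Q_def)
  qed
  have on_cycles: "f (cycle_of_list (p0 # ps)) = \<phi> (map label (S @ concat (map seg ps)))" if ps: "ps \<in> Q" for ps
  proof -
    let ?qs = "p0 # ps"
    have "mset ?qs = mset qs0"
      using Q(1,2)[OF ps] qs0(1,2) set_eq_iff_mset_eq_distinct by metis
    then have "mset (map seg ?qs) = mset segs"
      unfolding qs0(3)[symmetric] mset_map by simp
    then have "mset (concat (map seg ?qs)) = mset (concat segs)"
      by (rule mset_concat_cong)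
    then have D: "distinct (concat (map seg ?qs))" "set (concat (map seg ?qs)) = {..<a + b}"
      using segs(1,2) mset_eq_imp_distinct_iff mset_eq_setD by metis+
    let ?r = "inv v \<circ> cycle_of_list ?qs"
    have r: "?r permutes P"
      using permutes_compose[OF cycle_permutes[of ?qs, unfolded Q(2)[OF ps]] permutes_inv[OF v]] .
    have vr: "v (?r x) = cycle_of_list ?qs x" for x
      using permutes_inverses(1)[OF v] by simp
    have "(u \<circ> ?r) x = cycle_of_list (concat (map seg ?qs)) x" for x
    proof -
      consider "x \<in> P" | "x \<in> {..<a + b}" "x \<notin> P" | "x \<notin> {..<a + b}" by blast
      then show ?thesis
      proof cases
        case 1
        then have "?r x \<in> P" using permutes_in_image[OF r] by simp
        from u_last[OF this] have "u (?r x) = hd (seg (cycle_of_list ?qs x))"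
          unfolding vr .
        moreover have "cycle_of_list (concat (map seg ?qs)) x = hd (seg (cycle_of_list ?qs x))"
          using cycle_of_segments_last[of P seg, OF segP Q(1,2)[OF ps] D(1) 1] .
        ultimately show ?thesis by (simp only: comp_apply)
      next
        case 2
        then have "x \<in> set (concat segs)" using segs(2) by simp
        then obtain T where T: "T \<in> set segs" "x \<in> set T" by auto
        then have q: "last T \<in> P" "x \<in> set (seg (last T))" using ne(2) seg by auto
        obtain as y bs where y: "seg (last T) = as @ x # y # bs"
          using segment_inside_cases[of P seg, OF segP q(1,2) 2(2)] by blast
        have "?r x = x" using r 2(2) by (rule permutes_not_in)
        moreover have "u x = y" by (rule u_inside[OF q(1) y])
        moreover have "cycle_of_list (concat (map seg ?qs)) x = y"
          using cycle_of_segments_inside[of P seg, OF segP Q(1,2)[OF ps] D(1) q(1) y] .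
        ultimately show ?thesis by (simp only: comp_apply)
      next
        case 3
        then have "?r x = x" using r P(1) by (meson permutes_not_in subsetD)
        moreover have "u x = x" using u_perm 3 by (rule permutes_not_in)
        moreover have "cycle_of_list (concat (map seg ?qs)) x = x"
          by (rule id_outside_supp) (use 3 D(2) in blast)
        ultimately show ?thesis by (simp only: comp_apply)
      qed
    qed
    then have "full_cycle (concat (map seg ?qs)) (u \<circ> ?r)"
      unfolding full_cycle_def using D by blast
    then have "f (cycle_of_list ?qs) = \<phi> (map label (concat (map seg ?qs)))"
      unfolding f_def by (rule \<Phi>_full_cycle)
    moreover have "seg p0 = S" unfolding p0_def by (rule seg) (simp add: segs_def)
    ultimately show ?thesis by simp
  qed
  have off_cycles: "f r = 0" if r: "r permutes P" "r \<notin> C" for r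
  proof (rule ccontr)
    assume "f r \<noteq> 0"
    let ?t = "inv v \<circ> r"
    obtain ds where "full_cycle ds (u \<circ> ?t)"
      using \<open>f r \<noteq> 0\<close> unfolding f_def \<Phi>_def by (metis (no_types, lifting))
    then have ds: "distinct ds" "set ds = {..<a + b}" "u \<circ> ?t = cycle_of_list ds"
      by (simp_all add: full_cycle_def)
    have t: "?t permutes P" by (rule permutes_compose[OF r(1) permutes_inv[OF v]])
    have vt: "v (?t x) = r x" for x using permutes_inverses(1)[OF v] by simp
    obtain css where css: "cycles_of css P r" using cycles_of_exists[OF r(1) finP] by blast
    have "css \<noteq> []" using css p0P by (auto simp: cycles_of_def)
    then obtain c1 css' where c1: "css = c1 # css'" by (cases css) auto
    have K: "set c1 \<subseteq> P" "c1 \<noteq> []" "distinct c1" using css by (auto simp: c1 cycles_of_def)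
    have r_K: "r q \<in> set c1" if "q \<in> set c1" for q
      using css that cycle_of_list_in[OF that] by (auto simp: c1 cycles_of_def)
    \<comment> \<open>The segments named by one cycle \<open>c1\<close> of \<open>r\<close> form a
      set invariant under \<open>u \<circ> ?t\<close>. As this is a full cycle, they are all the
      segments, so \<open>c1\<close> exhausts \<open>P\<close> and \<open>r\<close> is a
      5-cycle.\<close>
    define U where "U = (\<Union>q\<in>set c1. set (seg q))"
    have "U = set ds"
    proof (rule cycle_invariant_subset[OF ds(1)])
      show "U \<subseteq> set ds"
        unfolding ds(2) segs(2)[symmetric] U_def using K(1) seg_P(1) by auto
      obtain q where "q \<in> set c1" using K(2) by (cases c1) auto
      then have "seg q \<noteq> []" using K(1) seg_P(2) by blast
      then have "hd (seg q) \<in> set (seg q)" by simp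
      then have "hd (seg q) \<in> U" using \<open>q \<in> set c1\<close> unfolding U_def by blast
      then show "U \<noteq> {}" by blast
    next
      fix x assume "x \<in> U"
      then obtain q where q: "q \<in> set c1" "x \<in> set (seg q)" by (auto simp: U_def)
      then have "q \<in> P" using K(1) by blast
      have "u (?t x) \<in> U"
      proof (cases "x \<in> P")
        case True
        then have "x = q" using mem_last[OF seg_P(1)[OF \<open>q \<in> P\<close>] q(2)] seg_P(3)[OF \<open>q \<in> P\<close>] by simp
        then have "r x \<in> set c1" using q(1) r_K by simp
        then have "r x \<in> P" "seg (r x) \<noteq> []" using K(1) seg_P(2) by auto
        have "?t x \<in> P" using permutes_in_image[OF t] True by simp
        from u_last[OF this] have "u (?t x) = hd (seg (r x))" unfolding vt .
        also have "\<dots> \<in> set (seg (r x))" using \<open>seg (r x) \<noteq> []\<close> by simp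
        finally show ?thesis using \<open>r x \<in> set c1\<close> unfolding U_def by blast
      next
        case False
        obtain as y bs where y: "seg q = as @ x # y # bs"
          using segment_inside_cases[of P seg, OF segP \<open>q \<in> P\<close> q(2) False] by blast
        have "?t x = x" using t False by (rule permutes_not_in)
        then have "u (?t x) = y" using u_inside[OF \<open>q \<in> P\<close> y] by simp
        moreover have "y \<in> set (seg q)" by (simp add: y)
        ultimately show ?thesis using q(1) unfolding U_def by blast
      qed
      then show "cycle_of_list ds x \<in> U" unfolding ds(3)[symmetric] by simp
    qed
    then have "U = {..<a + b}" using ds(2) by simp
    have "set c1 = P"
    proof (intro equalityI subsetI)
      fix x assume "x \<in> P"
      then have "x \<in> U" using \<open>U = {..<a + b}\<close> P(1) by blast
      then obtain q where q: "q \<in> set c1" "x \<in> set (seg q)" by (auto simp: U_def)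
      then have "q \<in> P" using K(1) by blast
      then have "x = q" using mem_last[OF seg_P(1) q(2) \<open>x \<in> P\<close>] seg_P(3) by simp
      then show "x \<in> set c1" using q(1) by simp
    qed (use K in auto)
    then have "cycles_of [c1] P r" using css K by (auto simp: c1 cycles_of_def)
    from cycles_of_single[OF this r(1) p0P]
    obtain ps where ps: "distinct (p0 # ps)" "set (p0 # ps) = P" "r = cycle_of_list (p0 # ps)"
      by (elim exE conjE)
    then have "ps \<in> Q" by (auto simp: Q_def)
    with ps(3) have "r \<in> C" unfolding C_def by (rule image_eqI)
    then show False using r(2) by blast
  qed
  have C_sub: "C \<subseteq> {r. r permutes P}"
    unfolding C_def using Q(2) cycle_permutes by (metis (no_types, lifting) image_subsetI mem_Collect_eq)
  have fin: "finite {r. r permutes P}" using finP by (simp add: finite_permutations)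
  have "(\<Sum>r | r permutes P. sign r * \<Phi> (u \<circ> r)) = (\<Sum>r | r permutes P. sign (inv v \<circ> r) * f r)"
    unfolding f_def by (rule setum_permutations_compose_left[OF permutes_inv[OF v]])
  also have "\<dots> = (\<Sum>r | r permutes P. sign (inv v) * (sign r * f r))"
    using v finP by (intro sum.cong refl) (simp add: sign_compose permutes_imp_permutation permutes_inv)
  also have "\<dots> = sign (inv v) * (\<Sum>r | r permutes P. sign r * f r)"
    by (simp add: sum_distrib_left)
  also have "(\<Sum>r | r permutes P. sign r * f r) = (\<Sum>r\<in>C. sign r * f r)"
    using fin C_sub off_cycles by (intro sum.mono_neutral_right) auto
  also have "\<dots> = (\<Sum>ps\<in>Q. sign (cycle_of_list (p0 # ps)) * f (cycle_of_list (p0 # ps)))"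
    unfolding C_def by (simp add: sum.reindex[OF inj])
  also have "\<dots> = (\<Sum>ps\<in>Q. \<phi> (map label (S @ concat (map seg ps))))"
    using Q(1,3) by (intro sum.cong refl) (simp add: sign_cycle_of_list on_cycles del: cycle_of_list.simps)
  also have "\<dots> = 0"
    unfolding Q_def last_segs'[symmetric]
    using ne(1) S(2) set_segs seg by (intro segment_sum[OF segs_def len segs(1,2)]) (auto simp: segs_def)
  finally show ?thesis by (simp only: mult_zero_right)
qed

text \<open>If some \<open>s \<circ> r0\<close> is a full cycle, replacing \<open>r\<close> by
  \<open>r0 \<circ> r\<close> moves the sum to that cycle at the cost of the sign of
  \<open>r0\<close>; otherwise all terms are zero.\<close>

lemma alternating_\<Phi>: "alternating_vanishing 4 (a + b) (\<lambda>s. of_int (\<Phi> s) :: 'k::field_char_0)"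
  unfolding alternating_vanishing_def
proof (intro allI impI)
  fix s P assume s: "s permutes {..<a + b}" and P: "P \<subseteq> {..<a + b}" "card P = Suc 4"
  have finP: "finite P" using P(2) card.infinite by fastforce
  have "(\<Sum>r | r permutes P. sign r * \<Phi> (s \<circ> r)) = 0"
  proof (cases "\<forall>r. r permutes P \<longrightarrow> \<Phi> (s \<circ> r) = 0")
    case False
    then obtain r0 where r0: "r0 permutes P" "\<Phi> (s \<circ> r0) \<noteq> 0" by blast
    then obtain cs where cs: "full_cycle cs (s \<circ> r0)" unfolding \<Phi>_def by metis
    have "(\<Sum>r | r permutes P. sign r * \<Phi> (s \<circ> r)) = (\<Sum>r | r permutes P. sign (r0 \<circ> r) * \<Phi> (s \<circ> (r0 \<circ> r)))"
      by (rule setum_permutations_compose_left[OF r0(1)])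
    also have "\<dots> = (\<Sum>r | r permutes P. sign r0 * (sign r * \<Phi> ((s \<circ> r0) \<circ> r)))"
      using r0 finP by (intro sum.cong refl) (simp add: sign_compose permutes_imp_permutation comp_assoc)
    also have "\<dots> = sign r0 * (\<Sum>r | r permutes P. sign r * \<Phi> ((s \<circ> r0) \<circ> r))"
      by (simp add: sum_distrib_left)
    finally show ?thesis using alternating_full_cycle[OF cs P(1)] P(2) by simp
  qed simp
  then have "of_int (\<Sum>r | r permutes P. sign r * \<Phi> (s \<circ> r)) = (0 :: 'k)" by simp
  then show "(\<Sum>r | r permutes P. of_int (sign r) * of_int (\<Phi> (s \<circ> r))) = (0 :: 'k)" by simp
qed

lemma full_cycle_conj:
  assumes h: "h permutes {..<a + b}" and "full_cycle cs s"
  shows "full_cycle (map h cs) (h \<circ> s \<circ> inv h)"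
proof -
  have cs: "distinct cs" "set cs = {..<a + b}" "s = cycle_of_list cs"
    using assms(2) by (auto simp: full_cycle_def)
  have "h \<circ> s \<circ> inv h = cycle_of_list (map h cs)"
    unfolding cs(3) by (rule conjugation_of_cycle[OF cs(1) permutes_bij[OF h]])
  moreover have "distinct (map h cs)"
    using cs(1) permutes_inj_on[OF h] by (simp add: distinct_map)
  moreover have "set (map h cs) = {..<a + b}"
    using permutes_image[OF h] cs(2) by simp
  ultimately show ?thesis unfolding full_cycle_def by blast
qed

text \<open>Conjugation by \<open>h\<close> renames the entries of a cycle, and \<open>h\<close>
  keeps their letters, so the cycle spells the same word.\<close>

lemma \<Phi>_conj:
  assumes h: "h permutes {..<a + b}" and lab: "\<And>l. l < a + b \<Longrightarrow> label (h l) = label l"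
  shows "\<Phi> (h \<circ> s \<circ> inv h) = \<Phi> s"
proof (cases "\<exists>cs. full_cycle cs s")
  case True
  then obtain cs where cs: "full_cycle cs s" by blast
  have eq: "map label (map h cs) = map label cs"
    using cs lab by (auto simp: full_cycle_def)
  show ?thesis
    using \<Phi>_full_cycle[OF cs] \<Phi>_full_cycle[OF full_cycle_conj[OF h cs]] unfolding eq by (rule trans[OF _ sym, rotated])
next
  case False
  have "\<not> full_cycle ds (h \<circ> s \<circ> inv h)" for ds
  proof
    assume "full_cycle ds (h \<circ> s \<circ> inv h)"
    then have "full_cycle (map (inv h) ds) (inv h \<circ> (h \<circ> s \<circ> inv h) \<circ> inv (inv h))"
      by (rule full_cycle_conj[OF permutes_inv[OF h]])
    also have "inv h \<circ> (h \<circ> s \<circ> inv h) \<circ> inv (inv h) = s"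
      using permutes_inverses[OF h] by (simp add: permutes_inv_inv[OF h] fun_eq_iff)
    finally show False using False by blast
  qed
  then show ?thesis using False by (simp add: \<Phi>_def)
qed

text \<open>By this \<Phi> descends to functions on pairs of matrices: a combination of contractions
  that vanishes as a function is sent to zero.\<close>

lemma \<Phi>_relation:
  fixes d :: "(nat \<Rightarrow> nat) \<Rightarrow> 'k::field_char_0"
  assumes zero: "\<And>p. (\<Sum>s | s permutes {..<a + b}. d s * contr {..<a + b} (std_point a p) s) = 0"
  shows "(\<Sum>s | s permutes {..<a + b}. d s * of_int (\<Phi> s)) = 0"
proof -
  define m where "m = a + b"
  let ?S = "{s. s permutes {..<m}}"
  define H where "H = {h. h permutes {..<m} \<and> (\<forall>l<m. (h l < a) = (l < a))}"
  define T where "T i j = (\<Sum>s\<in>?S. d s * perm_mat m s i j)" for i j :: "nat \<Rightarrow> 4"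
  have T: "multilin m T Z = (\<Sum>s\<in>?S. d s * contr {..<m} Z s)" for Z
    unfolding T_def multilin_sum multilin_scale by (intro sum.cong refl) (simp add: multilin_perm_mat)
  have reindex: "(\<Sum>t\<in>?S. F (inv h \<circ> t \<circ> h) t) = (\<Sum>s\<in>?S. F s (h \<circ> s \<circ> inv h))"
    if h: "h \<in> H" for h and F :: "_ \<Rightarrow> _ \<Rightarrow> 'k"
  proof -
    have h': "h permutes {..<m}" using h by (simp add: H_def)
    have eq: "h \<circ> (inv h \<circ> t \<circ> h) \<circ> inv h = t" "inv h \<circ> (h \<circ> t \<circ> inv h) \<circ> h = t" for t
      by (simp_all add: fun_eq_iff permutes_inverses[OF h'])
    have "h \<circ> t \<circ> inv h \<in> ?S" "inv h \<circ> t \<circ> h \<in> ?S" if "t \<in> ?S" for t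
      using that by (auto intro!: permutes_compose permutes_inv h')
    then show ?thesis
      by (intro sum.reindex_bij_witness[where i = "\<lambda>s. h \<circ> s \<circ> inv h" and j = "\<lambda>t. inv h \<circ> t \<circ> h"])
        (simp_all only: eq)
  qed
  \<comment> \<open>Polarization turns the relation in two matrices into one in \<open>m\<close> independent matrices,
    symmetrized over \<open>H\<close>; \<open>\<Phi>\<close> is invariant under conjugation by \<open>H\<close>.\<close>
  have polar: "(\<Sum>h\<in>H. multilin m T (\<lambda>l. Z (h l))) = 0" for Z
  proof -
    have "(\<lambda>l. \<Sum>k | k \<in> S \<and> (k < a) = (l < a). Z k)
        = std_point a (\<Sum>k | k \<in> S \<and> k < a. Z k, \<Sum>k | k \<in> S \<and> \<not> k < a. Z k)" for S
      by (auto simp: std_point_def fun_eq_iff)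
    then show ?thesis
      unfolding H_def by (subst multilin_polarization) (simp add: T zero[folded m_def])
  qed
  define d' where "d' t = (\<Sum>h\<in>H. d (inv h \<circ> t \<circ> h))" for t
  have zero': "(\<Sum>t\<in>?S. d' t * contr {..<m} Z t) = 0" for Z :: "nat \<Rightarrow> 'k mat4"
  proof -
    have "(\<Sum>t\<in>?S. d' t * contr {..<m} Z t) = (\<Sum>h\<in>H. \<Sum>t\<in>?S. d (inv h \<circ> t \<circ> h) * contr {..<m} Z t)"
      unfolding d'_def sum_distrib_right by (rule sum.swap)
    also have "\<dots> = (\<Sum>h\<in>H. \<Sum>s\<in>?S. d s * contr {..<m} Z (h \<circ> s \<circ> inv h))"
      by (rule sum.cong[OF refl]) (rule reindex)
    also have "\<dots> = (\<Sum>h\<in>H. multilin m T (\<lambda>l. Z (h l)))"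
      unfolding T by (intro sum.cong refl) (simp add: H_def contr_conj)
    finally show ?thesis by (simp add: polar)
  qed
  have "alternating_vanishing CARD(4) m (\<lambda>t. of_int (\<Phi> t) :: 'k)"
    using alternating_\<Phi> by (simp add: m_def)
  from second_fundamental_theorem[OF zero' this]
  have "(\<Sum>t\<in>?S. d' t * of_int (\<Phi> t)) = 0" .
  also have "(\<Sum>t\<in>?S. d' t * of_int (\<Phi> t)) = (\<Sum>h\<in>H. \<Sum>t\<in>?S. d (inv h \<circ> t \<circ> h) * of_int (\<Phi> t))"
    unfolding d'_def sum_distrib_right by (rule sum.swap)
  also have "\<dots> = (\<Sum>h\<in>H. \<Sum>s\<in>?S. d s * of_int (\<Phi> (h \<circ> s \<circ> inv h)))"
    by (rule sum.cong[OF refl]) (rule reindex)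
  also have "\<dots> = (\<Sum>h\<in>H. \<Sum>s\<in>?S. d s * of_int (\<Phi> s))"
    by (intro sum.cong refl) (simp add: H_def m_def label_def \<Phi>_conj)
  also have "\<dots> = of_nat (card H) * (\<Sum>s\<in>?S. d s * of_int (\<Phi> s))" by simp
  finally have "of_nat (card H) * (\<Sum>s\<in>?S. d s * of_int (\<Phi> s)) = 0" .
  moreover have "finite H" unfolding H_def by (rule finite_subset[OF _ finite_permutations[of "{..<m}"]]) auto
  moreover have "id \<in> H" by (simp add: H_def permutes_id)
  ultimately show ?thesis by (auto simp: m_def)
qed

text \<open>The positions \<open>{..<a + b}\<close> are arranged so that their letters spell the
  concatenation of \<open>ws\<close>; cutting the arrangement into the words gives the cycles of
  \<open>s\<close>. There is a single cycle exactly for a single word, so \<Phi> vanishes on proper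
  products.\<close>

lemma product_contraction:
  assumes cnt: "count_list (concat ws) X = a" "count_list (concat ws) Y = b" and ne: "[] \<notin> set ws"
  shows "\<exists>s. s permutes {..<a + b} \<and>
    (\<forall>p :: 'k::comm_ring_1 mat4 \<times> 'k mat4. (\<Prod>w\<leftarrow>ws. word_trace w p) = contr {..<a + b} (std_point a p) s) \<and>
    \<Phi> s = (if length ws = 1 then \<phi> (hd ws) else 0)"
proof -
  define m where "m = a + b"
  have "mset (concat ws) = mset (map label [0..<m])"
  proof (rule multiset_eqI)
    fix l show "count (mset (concat ws)) l = count (mset (map label [0..<m])) l"
      unfolding count_mset using cnt count_label[of "[0..<m]"]
      by (cases l) (simp_all add: m_def atLeast0LessThan)
  qed
  then obtain f where f: "f permutes {..<length (map label [0..<m])}" "permute_list f (map label [0..<m]) = concat ws"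
    by (rule mset_eq_permutation)
  then have fm: "f permutes {..<m}" by simp
  define D where "D = map f [0..<m]"
  have "f l < m" if "l < m" for l using permutes_in_image[OF fm] that by (metis lessThan_iff)
  then have "map label D = concat ws"
    unfolding f(2)[symmetric] by (auto simp: permute_list_def D_def)
  then obtain css where css: "concat css = D" "map (map label) css = ws"
    using chunk_list by blast
  have "distinct D" "set D = {..<m}"
    using permutes_inj_on[OF fm] permutes_image[OF fm] by (auto simp: D_def distinct_map atLeast0LessThan)
  moreover have "[] \<notin> set css" using ne css(2) by force
  ultimately obtain s where s: "s permutes {..<m}" "cycles_of css {..<m} s"
    using cycles_of_construct[of css] css(1) by auto
  have "(\<Prod>w\<leftarrow>ws. word_trace w p) = contr {..<m} (std_point a p) s" for p :: "'k mat4 \<times> 'k mat4"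
    unfolding contr_cycles_of[OF s(2)] css(2)[symmetric]
    by (simp add: comp_def word_trace_def std_point_def[abs_def] label_def)
  moreover have "\<Phi> s = (if length ws = 1 then \<phi> (hd ws) else 0)"
  proof (cases "length ws = 1")
    case True
    then obtain cs where cs: "css = [cs]" using css(2) by (auto simp: length_Suc_conv)
    then have d: "distinct cs" "set cs = {..<m}" "\<And>l. l \<in> set cs \<Longrightarrow> s l = cycle_of_list cs l"
      using s(2) by (auto simp: cycles_of_def)
    have "s l = cycle_of_list cs l" for l
    proof (cases "l \<in> set cs")
      case False
      then show ?thesis using permutes_not_in[OF s(1)] d(2) id_outside_supp[of l cs] by simp
    qed (rule d(3))
    then have "full_cycle cs s" using d by (auto simp: full_cycle_def m_def)
    then show ?thesis using \<Phi>_full_cycle cs css(2) True by auto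
  next
    case False
    have "\<not> full_cycle ds s" for ds
    proof
      assume "full_cycle ds s"
      then have ds: "distinct ds" "set ds = {..<m}" "s = cycle_of_list ds"
        by (simp_all add: full_cycle_def m_def)
      have "css \<noteq> []" using s(2) nonempty by (auto simp: cycles_of_def m_def lessThan_empty_iff)
      then obtain c1 css' where c1: "css = c1 # css'" by (cases css) auto
      then have "css' \<noteq> []" using False css(2) by auto
      then obtain c2 css'' where c2: "css' = c2 # css''" by (cases css') auto
      have K: "set c1 \<subseteq> set ds" "c1 \<noteq> []" "set c1 \<inter> set c2 = {}" "c2 \<noteq> []" "set c2 \<subseteq> set ds"
        using s(2) ds(2) by (auto simp: c1 c2 cycles_of_def)
      have "set c1 = set ds"
      proof (rule cycle_invariant_subset[OF ds(1) K(1)])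
        fix x assume "x \<in> set c1"
        then show "cycle_of_list ds x \<in> set c1"
          using s(2) cycle_of_list_in[of x c1] unfolding ds(3)[symmetric] by (auto simp: c1 cycles_of_def)
      qed (use K(2) in simp)
      then show False using K(3-5) by (cases c2) auto
    qed
    then show ?thesis using False by (simp add: \<Phi>_def)
  qed
  ultimately show ?thesis using s(1) unfolding m_def by blast
qed

text \<open>A representation of the trace of \<open>t\<close> through \<open>W\<close> is a relation
  between products of traces. Its part of bidegree \<open>(a, b)\<close> is a relation between
  contractions, so \<Phi> sends it to zero; but proper products and the words of \<open>W\<close>
  contribute nothing, whereas \<open>t\<close>, entered with coefficient -1, contributes the
  negative of \<open>\<phi> t\<close>.\<close>

theorem indecomposable:
  fixes W :: "letter list set"
  assumes t: "count_list t X = a" "count_list t Y = b" "\<phi> t \<noteq> 0"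
    and W: "[] \<notin> W" "\<And>w. w \<in> W \<Longrightarrow> count_list w X = a \<Longrightarrow> count_list w Y = b \<Longrightarrow> \<phi> w = 0"
  shows "(word_trace t :: 'k::field_char_0 mat4 \<times> 'k mat4 \<Rightarrow> 'k) \<notin> generated_algebra (word_trace ` W)"
proof
  assume "(word_trace t :: 'k mat4 \<times> 'k mat4 \<Rightarrow> 'k) \<in> generated_algebra (word_trace ` W)"
  then obtain cs where cs: "\<forall>(c, ws)\<in>set cs. set ws \<subseteq> W"
    "(word_trace t :: 'k mat4 \<times> 'k mat4 \<Rightarrow> 'k) = (\<lambda>p. \<Sum>(c, ws)\<leftarrow>cs. c * (\<Prod>w\<leftarrow>ws. word_trace w p))"
    using generated_algebra_products by blast
  define es where "es = (- 1, [t]) # cs"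
  define A where "A e = count_list (concat (snd e)) X" for e :: "'k \<times> letter list list"
  define B where "B e = count_list (concat (snd e)) Y" for e :: "'k \<times> letter list list"
  define val where "val e p = fst e * (\<Prod>w\<leftarrow>snd e. word_trace w p)" for e :: "'k \<times> letter list list" and p
  have val0: "(\<Sum>e\<leftarrow>es. val e p) = 0" for p
    using fun_cong[OF cs(2), of p] by (simp add: es_def val_def case_prod_unfold)
  have val_scale: "val e (scale_mat s x, scale_mat u y) = val e (x, y) * u ^ B e * s ^ A e" for e s u x y
  proof -
    have "(\<Prod>w\<leftarrow>ws. word_trace w (scale_mat s x, scale_mat u y))
        = (\<Prod>w\<leftarrow>ws. word_trace w (x, y)) * u ^ count_list (concat ws) Y * s ^ count_list (concat ws) X" for ws
      by (induction ws) (simp_all add: word_trace_scale power_add ac_simps)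
    then show ?thesis by (simp add: val_def A_def B_def)
  qed
  define n where "n = Max (insert (a + b) ((\<lambda>e. A e + B e) ` set es))"
  have n: "A e \<le> n \<and> B e \<le> n" if "e \<in> set es" for e
  proof -
    have "A e + B e \<le> n" unfolding n_def by (rule Max_ge) (use that in auto)
    then show ?thesis by simp
  qed
  have "a + b \<le> n" unfolding n_def by (rule Max_ge) auto
  then have ab: "a \<le> n" "b \<le> n" by auto
  have part0: "(\<Sum>e\<leftarrow>es. if A e = a \<and> B e = b then val e p else 0) = 0" for p
  proof -
    obtain x y where p: "p = (x, y)" by (cases p)
    have "(\<Sum>i\<le>n. (\<Sum>j\<le>n. (\<Sum>e\<leftarrow>es. if A e = i \<and> B e = j then val e p else 0) * u ^ j) * s ^ i) = 0" for s u
    proof -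
      have "(\<Sum>e\<leftarrow>es. val e p * u ^ B e * s ^ A e) = 0"
        using val0[of "(scale_mat s x, scale_mat u y)"] by (simp add: val_scale p)
      then show ?thesis using sum_list_bigraded[of es A n B "\<lambda>e. val e p" u s] n by simp
    qed
    then have "(\<Sum>j\<le>n. (\<Sum>e\<leftarrow>es. if A e = a \<and> B e = j then val e p else 0) * u ^ j) = 0" for u
      using ab(1) by (rule sum_powers_zero)
    then show ?thesis using ab(2) by (rule sum_powers_zero)
  qed
  define fs where "fs = filter (\<lambda>e. A e = a \<and> B e = b) es"
  have fs0: "(\<Sum>e\<leftarrow>fs. val e p) = 0" for p
    using part0[of p] unfolding fs_def by (simp add: sum_list_map_filter')
  have "t \<noteq> []" using t nonempty by auto
  then have ne: "[] \<notin> set (snd e)" if "e \<in> set fs" for e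
  proof -
    have "e = (- 1, [t]) \<or> e \<in> set cs" using that by (auto simp: fs_def es_def split: if_splits)
    then show ?thesis using \<open>t \<noteq> []\<close> cs(1) W(1) by (cases e) auto
  qed
  have "\<forall>e\<in>set fs. \<exists>s. s permutes {..<a + b} \<and>
      (\<forall>p :: 'k mat4 \<times> 'k mat4. (\<Prod>w\<leftarrow>snd e. word_trace w p) = contr {..<a + b} (std_point a p) s) \<and>
      \<Phi> s = (if length (snd e) = 1 then \<phi> (hd (snd e)) else 0)"
  proof
    fix e assume e: "e \<in> set fs"
    then have "count_list (concat (snd e)) X = a" "count_list (concat (snd e)) Y = b"
      by (auto simp: fs_def A_def B_def)
    then show "\<exists>s. s permutes {..<a + b} \<and>
      (\<forall>p :: 'k mat4 \<times> 'k mat4. (\<Prod>w\<leftarrow>snd e. word_trace w p) = contr {..<a + b} (std_point a p) s) \<and>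
      \<Phi> s = (if length (snd e) = 1 then \<phi> (hd (snd e)) else 0)"
      using ne[OF e] by (rule product_contraction)
  qed
  from bchoice[OF this] obtain \<sigma> where \<sigma>: "\<And>e. e \<in> set fs \<Longrightarrow> \<sigma> e permutes {..<a + b}"
    "\<And>e p. e \<in> set fs \<Longrightarrow> (\<Prod>w\<leftarrow>snd e. word_trace w (p :: 'k mat4 \<times> 'k mat4)) = contr {..<a + b} (std_point a p) (\<sigma> e)"
    "\<And>e. e \<in> set fs \<Longrightarrow> \<Phi> (\<sigma> e) = (if length (snd e) = 1 then \<phi> (hd (snd e)) else 0)"
    by blast
  define d where "d s = (\<Sum>e\<leftarrow>fs. if \<sigma> e = s then fst e else 0)" for s
  have collect: "(\<Sum>s | s permutes {..<a + b}. d s * F s) = (\<Sum>e\<leftarrow>fs. fst e * F (\<sigma> e))" for F :: "_ \<Rightarrow> 'k"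
  proof -
    have "(\<Sum>s | s permutes {..<a + b}. (\<Sum>e\<leftarrow>gs. if \<sigma> e = s then fst e else 0) * F s) = (\<Sum>e\<leftarrow>gs. fst e * F (\<sigma> e))"
      if "set gs \<subseteq> set fs" for gs
      using that
    proof (induction gs)
      case (Cons e gs)
      have "(\<Sum>s | s permutes {..<a + b}. (if \<sigma> e = s then fst e else 0) * F s)
          = (\<Sum>s | s permutes {..<a + b}. if s = \<sigma> e then fst e * F s else 0)"
        by (intro sum.cong) auto
      also have "\<dots> = fst e * F (\<sigma> e)"
        using \<sigma>(1)[of e] Cons.prems by (simp add: finite_permutations)
      finally show ?case
        using Cons by (simp add: distrib_right sum.distrib)
    qed simp
    then show ?thesis by (simp add: d_def)
  qed
  have "(\<Sum>s | s permutes {..<a + b}. d s * contr {..<a + b} (std_point a p) s) = 0" for p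
  proof -
    have "(\<Sum>s | s permutes {..<a + b}. d s * contr {..<a + b} (std_point a p) s)
        = (\<Sum>e\<leftarrow>fs. fst e * contr {..<a + b} (std_point a p) (\<sigma> e))"
      by (rule collect)
    also have "\<dots> = (\<Sum>e\<leftarrow>fs. val e p)"
      by (intro arg_cong[of _ _ sum_list] map_cong refl) (simp add: val_def \<sigma>(2))
    also have "\<dots> = 0" by (rule fs0)
    finally show ?thesis .
  qed
  then have "(\<Sum>s | s permutes {..<a + b}. d s * of_int (\<Phi> s)) = 0"
    by (rule \<Phi>_relation)
  then have "(\<Sum>e\<leftarrow>fs. fst e * of_int (\<Phi> (\<sigma> e))) = 0"
    by (rule trans[OF collect[symmetric]])
  also have "(\<Sum>e\<leftarrow>fs. fst e * of_int (\<Phi> (\<sigma> e))) = (\<Sum>e\<leftarrow>fs. fst e * of_int (if length (snd e) = 1 then \<phi> (hd (snd e)) else 0))"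
    by (intro arg_cong[of _ _ sum_list] map_cong refl) (simp add: \<sigma>(3))
  also have "\<dots> = - of_int (\<phi> t)"
  proof -
    have fs: "fs = (- 1, [t]) # filter (\<lambda>e. A e = a \<and> B e = b) cs"
      using t by (simp add: fs_def es_def A_def B_def)
    have single: "(if length (snd e) = 1 then \<phi> (hd (snd e)) else 0) = 0"
      if e: "e \<in> set (filter (\<lambda>e. A e = a \<and> B e = b) cs)" for e
    proof (cases "length (snd e) = 1")
      case True
      then obtain w where w: "snd e = [w]" by (auto simp: length_Suc_conv)
      then have "w \<in> W" using cs(1) e by (cases e) auto
      then show ?thesis using W(2)[of w] e w by (simp add: A_def B_def)
    qed simp
    have zero: "(\<Sum>e\<leftarrow>gs. fst e * of_int (F e)) = 0" if "\<And>e. e \<in> set gs \<Longrightarrow> F e = 0"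
      for gs :: "('k \<times> letter list list) list" and F
      using that by (induction gs) auto
    have "(\<Sum>e\<leftarrow>filter (\<lambda>e. A e = a \<and> B e = b) cs.
        fst e * of_int (if length (snd e) = 1 then \<phi> (hd (snd e)) else 0)) = 0"
      by (rule zero) (rule single)
    then show ?thesis unfolding fs by simp
  qed
  finally show False using t(3) by simp
qed

end

section \<open>Verification of the functionals\<close>

fun subtrie :: "letter list \<Rightarrow> 'a trie \<Rightarrow> 'a trie" where
  "subtrie [] t = t"
| "subtrie (l # w) Tip = Tip"
| "subtrie (X # w) (Bin a l r) = subtrie w l"
| "subtrie (Y # w) (Bin a l r) = subtrie w r"

lemma lookup_subtrie: "lookup d (subtrie u t) v = lookup d t (u @ v)"
  by (induction u t rule: subtrie.induct) auto

text \<open>The sums over 2, 6 and 24 rearrangements are evaluated recursively, so that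
  rearrangements with a common beginning share the walk down the trie.\<close>

definition sum2 :: "int trie \<Rightarrow> letter list \<Rightarrow> letter list \<Rightarrow> int" where
  "sum2 t p q = lookup 0 (subtrie p t) q + lookup 0 (subtrie q t) p"

definition sum3 :: "int trie \<Rightarrow> letter list \<Rightarrow> letter list \<Rightarrow> letter list \<Rightarrow> int" where
  "sum3 t p q r = sum2 (subtrie p t) q r + sum2 (subtrie q t) p r + sum2 (subtrie r t) p q"

definition sum4 :: "int trie \<Rightarrow> letter list \<Rightarrow> letter list \<Rightarrow> letter list \<Rightarrow> letter list \<Rightarrow> int" where
  "sum4 t p q r s = sum3 (subtrie p t) q r s + sum3 (subtrie q t) p r s
     + sum3 (subtrie r t) p q s + sum3 (subtrie s t) p q r"

lemma sum4_perm_list: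
  "sum4 (subtrie z t) p q r s = (\<Sum>qs\<leftarrow>perm_list [p, q, r, s]. lookup 0 t (z @ concat qs))"
  by (simp add: sum4_def sum3_def sum2_def lookup_subtrie)

fun rotations :: "letter list \<Rightarrow> letter list \<Rightarrow> letter list list" where
  "rotations [] r = []"
| "rotations (l # k) r = r # rotations k (rotate1 r)"

definition functional_trie :: "poly \<Rightarrow> int trie" where
  "functional_trie p = add_terms id (concat (map (\<lambda>(c, w). map (\<lambda>v. (c, v)) (rotations w w)) p)) Tip"

lemma lookup_functional_trie:
  "lookup 0 (functional_trie p) w = (\<Sum>(c, v)\<leftarrow>p. c * int (count_list (rotations v v) w))"
proof -
  have "(\<Sum>(c, v)\<leftarrow>map (\<lambda>v. (c, v)) vs. if v = w then c else 0) = c * int (count_list vs w)" for c vs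
    by (induction vs) (auto simp: algebra_simps)
  then have "(\<Sum>(c, v)\<leftarrow>concat (map (\<lambda>(c, w). map (\<lambda>v. (c, v)) (rotations w w)) p). if v = w then c else 0)
      = (\<Sum>(c, v)\<leftarrow>p. c * int (count_list (rotations v v) w))"
    by (induction p) (auto simp del: map_map)
  then show ?thesis by (simp add: functional_trie_def lookup_add_terms)
qed

lemma rotations_eq: "rotations k r = map (\<lambda>i. rotate i r) [0..<length k]"
proof (induction k arbitrary: r)
  case (Cons l k)
  have "[0..<length (l # k)] = 0 # map Suc [0..<length k]"
    by (simp add: map_Suc_upt upt_conv_Cons del: upt_Suc)
  then show ?case by (simp add: Cons comp_def rotate1_rotate_swap[symmetric] del: upt_Suc)
qed simp

text \<open>\<open>rotate1\<close> carries the list of rotations of \<open>v\<close> to itself,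
  shifted by one place, and is injective on words.\<close>

lemma count_rotations_rotate1: "count_list (rotations v v) (rotate1 w) = count_list (rotations v v) w"
proof (cases v)
  case (Cons l v')
  let ?n = "length v'"
  have "[0..<length v] = 0 # map Suc [0..<?n]"
    unfolding map_Suc_upt by (simp add: Cons upt_conv_Cons del: upt_Suc)
  moreover have "[0..<length v] = [0..<?n] @ [?n]" by (simp add: Cons)
  ultimately have split: "[0..<length v] = 0 # map Suc [0..<?n]" "[0..<length v] = [0..<?n] @ [?n]" by blast+
  have "rotate1 (rotate ?n v) = v" using rotate_id[of "Suc ?n" v] by (simp add: Cons)
  then have "mset (map rotate1 (rotations v v)) = mset (rotations v v)"
    by (subst (2) rotations_eq, subst split(1), subst rotations_eq, subst split(2)) (simp add: comp_def)
  moreover have "count_list (map rotate1 xs) (rotate1 w) = count_list xs w" for xs :: "letter list list"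
  proof -
    have "rotate1 u = rotate1 w \<longleftrightarrow> u = w" for u :: "letter list" by (cases u; cases w) auto
    then show ?thesis by (induction xs) auto
  qed
  ultimately show ?thesis by (metis count_mset)
qed simp

fun words :: "nat \<Rightarrow> nat \<Rightarrow> letter list list" where
  "words 0 0 = [[]]"
| "words (Suc a) 0 = map ((#) X) (words a 0)"
| "words 0 (Suc b) = map ((#) Y) (words 0 b)"
| "words (Suc a) (Suc b) = map ((#) X) (words a (Suc b)) @ map ((#) Y) (words (Suc a) b)"

lemma words_complete: "count_list w X = a \<Longrightarrow> count_list w Y = b \<Longrightarrow> w \<in> set (words a b)"
proof (induction w arbitrary: a b)
  case (Cons l w)
  then show ?case by (cases l; cases a; cases b) auto
qed auto

text \<open>Lengths of four words cut off from a word of length \<open>n\<close>. The bound on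
  \<open>l\<close> leaves a remainder of length at least \<open>k\<close>; as
  \<open>k \<le> l\<close>, it admits every \<open>l\<close> not exceeding the length of the
  remainder, and some further instances of the same identity.\<close>

definition shapes :: "nat \<Rightarrow> (nat \<times> nat \<times> nat \<times> nat) list" where
  "shapes n = concat (map (\<lambda>i. concat (map (\<lambda>j. concat (map (\<lambda>k. map (\<lambda>l. (i, j, k, l))
     [k..<Suc n - i - j - k - k]) [j..<Suc n])) [i..<Suc n])) [1..<Suc n])"

text \<open>What is left of \<open>w\<close> behind the four pieces is the word \<open>z\<close>, so
  all words of a bidegree and all shapes together cover every instance of
  \<open>kill\<close>.\<close>

fun kills_word :: "int trie \<Rightarrow> letter list \<Rightarrow> (nat \<times> nat \<times> nat \<times> nat) list \<Rightarrow> bool" where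
  "kills_word t w [] \<longleftrightarrow> True"
| "kills_word t w ((i, j, k, l) # ss) \<longleftrightarrow>
     (let v1 = drop i w; v2 = drop j v1; v3 = drop k v2 in
        sum4 (subtrie (drop l v3) t) (take i w) (take j v1) (take k v2) (take l v3) = 0) \<and>
     kills_word t w ss"

fun kills_words :: "int trie \<Rightarrow> (nat \<times> nat \<times> nat \<times> nat) list \<Rightarrow> letter list list \<Rightarrow> bool" where
  "kills_words t ss [] \<longleftrightarrow> True"
| "kills_words t ss (w # ws) \<longleftrightarrow> kills_word t w ss \<and> kills_words t ss ws"

definition check_functional :: "letter list list \<Rightarrow> letter list \<times> poly \<Rightarrow> bool" where
  "check_functional G = (\<lambda>(t, p). let T = functional_trie p; a = count_list t X; b = count_list t Y in
     t \<noteq> [] \<and> lookup 0 T t \<noteq> 0 \<and> list_all (\<lambda>w. w = t \<or> lookup 0 T w = 0) G \<and>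
     kills_words T (shapes (a + b)) (words a b))"

text \<open>
  The second component lists the values on necklaces, each term \<open>(c, v)\<close> contributing \<open>c\<close> for every
  rotation of \<open>v\<close>, counted with multiplicity.
\<close>

definition functionals :: "(letter list \<times> poly) list" where
  "functionals = [
     ([X], [(1, [X])]),
     ([Y], [(1, [Y])]),
     ([X,X], [(1, [X,X])]),
     ([X,Y], [(1, [X,Y])]),
     ([Y,Y], [(1, [Y,Y])]),
     ([X,X,X], [(1, [X,X,X])]),
     ([X,X,Y], [(1, [X,X,Y])]),
     ([X,Y,Y], [(1, [X,Y,Y])]),
     ([Y,Y,Y], [(1, [Y,Y,Y])]),
     ([X,X,X,X], [(1, [X,X,X,X])]),
     ([X,X,X,Y], [(1, [X,X,X,Y])]),
     ([X,X,Y,Y], [(1, [X,X,Y,Y])]),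
     ([X,Y,Y,Y], [(1, [X,Y,Y,Y])]),
     ([Y,Y,Y,Y], [(1, [Y,Y,Y,Y])]),
     ([X,Y,X,Y], [(1, [X,Y,X,Y])]),
     ([X,X,X,Y,Y], [(1, [X,X,X,Y,Y]), (-1, [X,X,Y,X,Y])]),
     ([Y,Y,Y,X,X], [(1, [X,X,Y,Y,Y]), (-1, [X,Y,X,Y,Y])]),
     ([X,X,Y,X,X,Y], [(-1, [X,X,X,Y,X,Y]), (1, [X,X,Y,X,X,Y])]),
     ([Y,Y,X,Y,Y,X], [(-1, [X,Y,X,Y,Y,Y]), (1, [X,Y,Y,X,Y,Y])]),
     ([X,X,Y,Y,X,Y], [(-1, [X,X,X,Y,Y,Y]), (2, [X,X,Y,Y,X,Y]), (-1, [X,Y,X,Y,X,Y])]),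
     ([Y,Y,X,X,Y,X], [(-1, [X,X,X,Y,Y,Y]), (2, [X,X,Y,X,Y,Y]), (-1, [X,Y,X,Y,X,Y])]),
     ([X,X,X,Y,Y,X,Y], [(-1, [X,X,X,Y,X,Y,Y]), (1, [X,X,X,Y,Y,X,Y])]),
     ([Y,Y,Y,X,X,Y,X], [(1, [X,X,Y,X,Y,Y,Y]), (-1, [X,X,Y,Y,Y,X,Y])]),
     ([X,X,X,Y,Y,X,X,Y], [(-1, [X,X,X,Y,X,X,Y,Y]), (1, [X,X,X,Y,Y,X,X,Y])]),
     ([Y,Y,Y,X,X,Y,Y,X], [(1, [X,X,Y,Y,X,Y,Y,Y]), (-1, [X,X,Y,Y,Y,X,Y,Y])]),
     ([X,X,X,Y,Y,Y,X,Y], [(-1, [X,X,X,Y,Y,X,Y,Y]), (1, [X,X,X,Y,Y,Y,X,Y]), (-1, [X,X,Y,X,X,Y,Y,Y]), (1,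
     [X,X,Y,X,Y,Y,X,Y]), (1, [X,X,Y,Y,X,X,Y,Y]), (-1, [X,X,Y,Y,X,Y,X,Y])]),
     ([Y,Y,Y,X,X,X,Y,X], [(1, [X,X,X,Y,X,Y,Y,Y]), (-1, [X,X,X,Y,Y,X,Y,Y]), (-1, [X,X,Y,X,X,Y,Y,Y]), (-1,
     [X,X,Y,X,Y,X,Y,Y]), (1, [X,X,Y,X,Y,Y,X,Y]), (1, [X,X,Y,Y,X,X,Y,Y])]),
     ([X,X,X,Y,X,X,Y,X,Y], [(1, [X,X,X,Y,X,X,Y,X,Y]), (-1, [X,X,X,Y,X,Y,X,X,Y])]),
     ([X,X,Y,Y,X,Y,X,X,Y], [(-1, [X,X,X,Y,X,X,Y,Y,Y]), (1, [X,X,X,Y,X,Y,X,Y,Y]), (-1, [X,X,X,Y,Y,X,Y,X,Y]), (1,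
     [X,X,X,Y,Y,Y,X,X,Y]), (-1, [X,X,Y,X,X,Y,X,Y,Y]), (1, [X,X,Y,X,X,Y,Y,X,Y])]),
     ([Y,Y,X,X,Y,X,Y,Y,X], [(1, [X,X,X,Y,Y,X,Y,Y,Y]), (-1, [X,X,X,Y,Y,Y,X,Y,Y]), (-1, [X,X,Y,X,Y,X,Y,Y,Y]), (1,
     [X,X,Y,X,Y,Y,X,Y,Y]), (-1, [X,X,Y,Y,X,Y,Y,X,Y]), (1, [X,X,Y,Y,Y,X,Y,X,Y])]),
     ([Y,Y,Y,X,Y,Y,X,Y,X], [(-1, [X,Y,X,Y,Y,X,Y,Y,Y]), (1, [X,Y,X,Y,Y,Y,X,Y,Y])]),
     ([X,X,X,Y,Y,Y,X,X,Y,Y], [(1, [X,X,X,Y,X,Y,X,Y,Y,Y]), (-1, [X,X,X,Y,X,Y,Y,X,Y,Y]), (-1, [X,X,X,Y,Y,X,X,Y,Y,Y]),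
     (1, [X,X,X,Y,Y,X,Y,Y,X,Y]), (1, [X,X,X,Y,Y,Y,X,X,Y,Y]), (-1, [X,X,X,Y,Y,Y,X,Y,X,Y]), (-1,
     [X,X,Y,X,X,Y,X,Y,Y,Y]), (1, [X,X,Y,X,X,Y,Y,Y,X,Y]), (-1, [X,X,Y,X,Y,X,Y,Y,X,Y]), (1, [X,X,Y,X,Y,Y,X,X,Y,Y]),
     (1, [X,X,Y,X,Y,Y,X,Y,X,Y]), (-1, [X,X,Y,Y,X,X,Y,Y,X,Y])])]"

lemma shapesI:
  assumes "1 \<le> i" "i \<le> j" "j \<le> k" "k \<le> l" "i + j + k + l + l \<le> n"
  shows "(i, j, k, l) \<in> set (shapes n)"
proof -
  have "i \<in> set [1..<Suc n]" "j \<in> set [i..<Suc n]" "k \<in> set [j..<Suc n]" "l \<in> set [k..<Suc n - i - j - k - k]"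
    using assms by auto
  then show ?thesis
    unfolding shapes_def set_concat set_map UN_iff image_image by blast
qed

lemma functionals_correct:
  "list_all (check_functional (map fst functionals)) functionals" "map fst functionals = gen_words"
  by code_simp+

lemma length_eq_counts: "length w = count_list w X + count_list w Y"
proof (induction w)
  case (Cons l w)
  then show ?case by (cases l) auto
qed simp

lemma kills_word_iff:
  "kills_word t w ss \<longleftrightarrow> (\<forall>(i, j, k, l)\<in>set ss. let v1 = drop i w; v2 = drop j v1; v3 = drop k v2 in
     sum4 (subtrie (drop l v3) t) (take i w) (take j v1) (take k v2) (take l v3) = 0)"
  by (induction t w ss rule: kills_word.induct) auto

lemma kills_words_iff: "kills_words t ss ws \<longleftrightarrow> (\<forall>w\<in>set ws. kills_word t w ss)"
  by (induction t ss ws rule: kills_words.induct) auto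

lemma check_functional_kills:
  assumes "check_functional G (t, d)"
  shows "necklace_functional (count_list t X) (count_list t Y) (lookup 0 (functional_trie d))"
proof
  let ?\<phi> = "lookup 0 (functional_trie d)"
  let ?a = "count_list t X" and ?b = "count_list t Y"
  show "?a + ?b > 0"
  proof -
    have "0 < length t" using assms by (simp add: check_functional_def Let_def)
    then show ?thesis unfolding length_eq_counts .
  qed
  have "?\<phi> (rotate1 w) = ?\<phi> w" for w
    by (simp add: lookup_functional_trie count_rotations_rotate1)
  then have "?\<phi> (rotate n w) = ?\<phi> w" for n w
    by (induction n) simp_all
  then show "?\<phi> (u @ v) = ?\<phi> (v @ u)" for u v
    by (metis rotate_append)
  fix z zs
  assume cnt: "count_list (z @ concat zs) X = ?a" "count_list (z @ concat zs) Y = ?b"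
    and z: "z \<noteq> []" and zs4: "length zs = 4" and ne: "[] \<notin> set zs" and sorted: "sorted (map length zs)"
    and longest: "\<forall>z'\<in>set zs. length z' \<le> length z"
  obtain p q r s where zs: "zs = [p, q, r, s]"
    using zs4 by (auto simp: length_Suc_conv numeral_eq_Suc)
  define w where "w = p @ q @ r @ s @ z"
  have "count_list w X = ?a" "count_list w Y = ?b"
    using cnt by (simp_all add: zs w_def)
  then have w: "w \<in> set (words ?a ?b)" by (rule words_complete)
  have n: "?a + ?b = length p + length q + length r + length s + length z"
    using cnt length_eq_counts[of "z @ concat zs"] by (simp add: zs)
  have len: "1 \<le> length p" "length p \<le> length q" "length q \<le> length r" "length r \<le> length s" "length s \<le> length z"
    using ne sorted longest by (auto simp: zs Suc_le_eq)
  have shape: "(length p, length q, length r, length s) \<in> set (shapes (?a + ?b))"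
    using len by (intro shapesI) (simp_all add: n)
  have "kills_word (functional_trie d) w (shapes (?a + ?b))"
    using assms w by (simp add: check_functional_def Let_def kills_words_iff)
  from bspec[OF this[unfolded kills_word_iff] shape]
  have "sum4 (subtrie z (functional_trie d)) p q r s = 0"
    by (simp add: Let_def w_def)
  then show "(\<Sum>qs\<leftarrow>perm_list zs. ?\<phi> (z @ concat qs)) = 0"
    by (simp only: sum4_perm_list zs)
qed

lemma word_trace_independent:
  assumes "w \<in> set gen_words"
  shows "(word_trace w :: 'k::field_char_0 mat4 \<times> 'k mat4 \<Rightarrow> 'k)
    \<notin> generated_algebra (word_trace ` (set gen_words - {w}))"
proof -
  obtain d where d: "(w, d) \<in> set functionals"
    using assms unfolding functionals_correct(2)[symmetric] by auto
  then have ck: "check_functional gen_words (w, d)"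
    using functionals_correct by (auto simp: list_all_iff)
  have nil: "v \<noteq> []" if v: "v \<in> set gen_words" for v
  proof -
    obtain d where "(v, d) \<in> set functionals"
      using v unfolding functionals_correct(2)[symmetric] by auto
    then have "check_functional gen_words (v, d)"
      using functionals_correct by (auto simp: list_all_iff)
    then show ?thesis by (simp add: check_functional_def Let_def)
  qed
  show ?thesis
    by (rule necklace_functional.indecomposable[OF check_functional_kills[OF ck] refl refl])
      (use ck nil in \<open>auto simp: check_functional_def Let_def list_all_iff\<close>)
qed

section \<open>The minimal generating set\<close>

text \<open>The generic matrices have entries in a ring of functions; this and the next lemmas
  evaluate expressions in them at a point, where they become matrices over the base ring.\<close>

lemma trace_apply: "trace (M :: ('p \<Rightarrow> 'k::comm_ring_1) ^ 'n ^ 'n) p = trace (\<chi> i j. (M $ i $ j) p)"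
  by (simp add: trace_def sum_fun_apply)

lemma matrix_mult_apply:
  "(\<chi> i j. ((M ** N) $ i $ j) p) = (\<chi> i j. (M $ i $ j) p) ** (\<chi> i j. ((N :: ('p \<Rightarrow> 'k::comm_ring_1) ^ 'n ^ 'n) $ i $ j) p)"
  by (simp add: matrix_matrix_mult_def sum_fun_apply vec_eq_iff)

lemma generic_apply: "(\<chi> i j. (generic_x $ i $ j) p) = fst p" "(\<chi> i j. (generic_y $ i $ j) p) = snd p"
  by (simp_all add: generic_x_def generic_y_def vec_eq_iff)

lemma matrix_inv_mult:
  assumes "invertible (g :: 'k::comm_ring_1 ^ 'n ^ 'n)"
  shows "matrix_inv g ** g = mat 1"
  unfolding matrix_inv_def using assms[unfolded invertible_def]
  by (rule someI2_ex) blast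

lemma word_trace_in_C42: "(word_trace w :: 'k::field_char_0 mat4 \<times> 'k mat4 \<Rightarrow> 'k) \<in> C42"
proof -
  have poly: "(\<lambda>p :: 'k mat4 \<times> 'k mat4. matprod (map (\<lambda>l. letter_mat l p) w) $ i $ j) \<in> polynomial_functions" for i j
  proof (induction w arbitrary: i)
    case Nil
    then show ?case by (simp add: polynomial_functions_def generated_algebra.const)
  next
    case (Cons l w)
    have "(\<lambda>p :: 'k mat4 \<times> 'k mat4. letter_mat l p $ i $ k) \<in> polynomial_functions" for k
    proof -
      have "(\<lambda>p :: 'k mat4 \<times> 'k mat4. letter_mat l p $ i $ k) \<in>
          {generic_x $ i $ j |i j. True} \<union> {generic_y $ i $ j |i j. True}"
        by (cases l) (auto simp: generic_x_def generic_y_def)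
      then show ?thesis unfolding polynomial_functions_def by (rule generated_algebra.base)
    qed
    then have "(\<Sum>k\<in>UNIV. (\<lambda>p :: 'k mat4 \<times> 'k mat4. letter_mat l p $ i $ k) *
        (\<lambda>p. matprod (map (\<lambda>l. letter_mat l p) w) $ k $ j)) \<in> polynomial_functions"
      using Cons unfolding polynomial_functions_def by (intro generated_algebra_sum generated_algebra.mult) auto
    also have "(\<Sum>k\<in>UNIV. (\<lambda>p :: 'k mat4 \<times> 'k mat4. letter_mat l p $ i $ k) *
        (\<lambda>p. matprod (map (\<lambda>l. letter_mat l p) w) $ k $ j))
      = (\<lambda>p. matprod (map (\<lambda>l. letter_mat l p) (l # w)) $ i $ j)"
      by (simp add: fun_eq_iff sum_fun_apply matrix_matrix_mult_def)
    finally show ?case .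
  qed
  have "(\<Sum>i\<in>UNIV. (\<lambda>p :: 'k mat4 \<times> 'k mat4. matprod (map (\<lambda>l. letter_mat l p) w) $ i $ i)) \<in> polynomial_functions"
    using poly unfolding polynomial_functions_def by (intro generated_algebra_sum) auto
  also have "(\<Sum>i\<in>UNIV. (\<lambda>p :: 'k mat4 \<times> 'k mat4. matprod (map (\<lambda>l. letter_mat l p) w) $ i $ i)) = word_trace w"
    by (simp add: fun_eq_iff sum_fun_apply word_trace_def trace_def)
  finally have "word_trace w \<in> (polynomial_functions :: ('k mat4 \<times> 'k mat4 \<Rightarrow> 'k) set)" .
  moreover have "word_trace w (g ** x ** matrix_inv g, g ** y ** matrix_inv g) = word_trace w (x, y)"
    if g: "invertible g" for g x y :: "'k mat4"
  proof -
    let ?c = "\<lambda>M. g ** M ** matrix_inv g"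
    have cancel: "?c M ** ?c N = ?c (M ** N)" for M N
    proof -
      have "?c M ** ?c N = g ** M ** (matrix_inv g ** g) ** N ** matrix_inv g"
        by (simp only: matrix_mul_assoc)
      then show ?thesis by (simp add: matrix_inv_mult[OF g] matrix_mul_assoc)
    qed
    have "matprod (map (\<lambda>l. letter_mat l (?c x, ?c y)) w) = ?c (matprod (map (\<lambda>l. letter_mat l (x, y)) w))"
    proof (induction w)
      case Nil
      then show ?case by (simp add: mult_matrix_inv[OF g])
    next
      case (Cons l w)
      have "letter_mat l (?c x, ?c y) = ?c (letter_mat l (x, y))" by (cases l) simp_all
      then show ?case using Cons by (simp add: cancel)
    qed
    moreover have "trace (?c M) = trace M" for M
    proof -
      have "trace (?c M) = trace (matrix_inv g ** (g ** M))" by (rule trace_mul_sym)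
      then show ?thesis by (simp add: matrix_mul_assoc matrix_inv_mult[OF g])
    qed
    ultimately show ?thesis by (simp add: word_trace_def)
  qed
  ultimately show ?thesis by (simp add: C42_def)
qed

lemma C42_generated_algebra:
  assumes "S \<subseteq> (C42 :: ('k::field_char_0 mat4 \<times> 'k mat4 \<Rightarrow> 'k) set)"
  shows "generated_algebra S \<subseteq> C42"
proof
  fix f assume "f \<in> generated_algebra S"
  then show "f \<in> C42"
  proof (induction rule: generated_algebra.induct)
    case (base f)
    then show ?case using assms by blast
  next
    case (const c)
    then show ?case by (simp add: C42_def polynomial_functions_def generated_algebra.const)
  next
    case (add f g)
    then have "f + g \<in> polynomial_functions"
      unfolding polynomial_functions_def C42_def by (blast intro: generated_algebra.add)
    moreover have "(f + g) (a ** x ** matrix_inv a, a ** y ** matrix_inv a) = (f + g) (x, y)"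
      if "invertible a" for a x y
      using add that by (simp add: C42_def)
    ultimately show ?case unfolding C42_def by blast
  next
    case (mult f g)
    then have "f * g \<in> polynomial_functions"
      unfolding polynomial_functions_def C42_def by (blast intro: generated_algebra.mult)
    moreover have "(f * g) (a ** x ** matrix_inv a, a ** y ** matrix_inv a) = (f * g) (x, y)"
      if "invertible a" for a x y
      using mult that by (simp add: C42_def)
    ultimately show ?case unfolding C42_def by blast
  qed
qed

lemma C42_eq:
  "(C42 :: ('k::field_char_0 mat4 \<times> 'k mat4 \<Rightarrow> 'k) set) = generated_algebra (word_trace ` set gen_words)"
  (is "?C = ?A")
proof
  show "?C \<subseteq> ?A"
  proof
    fix f :: "'k mat4 \<times> 'k mat4 \<Rightarrow> 'k" assume "f \<in> C42"
    then have "f \<in> generated_algebra (range word_trace)" by (rule first_fundamental_theorem)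
    then show "f \<in> ?A"
      by (rule generated_algebra_mono) (auto intro: word_traces_generated)
  qed
  show "?A \<subseteq> ?C"
    by (rule C42_generated_algebra) (auto intro: word_trace_in_C42)
qed

lemma distinct_gen_words: "distinct gen_words"
  by code_simp

text \<open>If two of the traces coincided, one would lie in the algebra generated by the others,
  against independence.\<close>

lemma word_trace_inj_on_gen_words:
  "inj_on (word_trace :: _ \<Rightarrow> 'k::field_char_0 mat4 \<times> 'k mat4 \<Rightarrow> 'k) (set gen_words)"
proof (rule inj_onI, rule ccontr)
  fix v w assume "v \<in> set gen_words" and w: "w \<in> set gen_words" and "v \<noteq> w"
    and eq: "(word_trace v :: 'k mat4 \<times> 'k mat4 \<Rightarrow> 'k) = word_trace w"
  then have "(word_trace w :: 'k mat4 \<times> 'k mat4 \<Rightarrow> 'k) \<in> generated_algebra (word_trace ` (set gen_words - {w}))"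
    unfolding eq[symmetric] by (intro generated_algebra.base) auto
  then show False using word_trace_independent[OF w] by blast
qed

text \<open>A proper subset omits the trace of some \<open>w\<close> and lies among the others, so
  generating everything would contradict the independence of that trace.\<close>

lemma minimal_gen_words:
  "minimal_generating_set (word_trace ` set gen_words) (C42 :: ('k::field_char_0 mat4 \<times> 'k mat4 \<Rightarrow> 'k) set)"
  unfolding minimal_generating_set_def
proof (intro conjI allI impI notI)
  show "generated_algebra (word_trace ` set gen_words) = (C42 :: ('k mat4 \<times> 'k mat4 \<Rightarrow> 'k) set)"
    by (rule C42_eq[symmetric])
  fix T :: "('k mat4 \<times> 'k mat4 \<Rightarrow> 'k) set"
  assume T: "T \<subset> word_trace ` set gen_words" "generated_algebra T = C42"
  then obtain w where w: "w \<in> set gen_words" "word_trace w \<notin> T" by blast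
  then have "T \<subseteq> word_trace ` (set gen_words - {w})" using T(1) by blast
  then have "T \<subseteq> generated_algebra (word_trace ` (set gen_words - {w}))"
    by (auto intro: generated_algebra.base)
  moreover have "word_trace w \<in> generated_algebra T"
    unfolding T(2) by (rule word_trace_in_C42)
  ultimately have "(word_trace w :: 'k mat4 \<times> 'k mat4 \<Rightarrow> 'k) \<in> generated_algebra (word_trace ` (set gen_words - {w}))"
    by (rule generated_algebra_mono[rotated])
  then show False using word_trace_independent[OF w(1)] by blast
qed

theorem theorem4p2:
  fixes x y :: "('k::field_char_0 mat4 \<times> 'k mat4 \<Rightarrow> 'k) ^ 4 ^ 4"
    and ts :: "('k mat4 \<times> 'k mat4 \<Rightarrow> 'k) list"
  assumes "x = generic_x" and "y = generic_y"
    and "ts = map trace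
      [x, y,
       x ** x, x ** y, y ** y,
       x ** x ** x, x ** x ** y, x ** y ** y, y ** y ** y,
       x ** x ** x ** x, x ** x ** x ** y, x ** x ** y ** y, x ** y ** y ** y,
       y ** y ** y ** y, x ** y ** x ** y,
       x ** x ** x ** y ** y, y ** y ** y ** x ** x,
       (x ** x ** y) ** (x ** x ** y), (y ** y ** x) ** (y ** y ** x),
       x ** x ** y ** y ** x ** y, y ** y ** x ** x ** y ** x,
       x ** x ** x ** y ** y ** x ** y, y ** y ** y ** x ** x ** y ** x,
       x ** x ** x ** y ** y ** x ** x ** y, y ** y ** y ** x ** x ** y ** y ** x,
       x ** x ** x ** y ** y ** y ** x ** y, y ** y ** y ** x ** x ** x ** y ** x,
       x ** x ** x ** y ** x ** x ** y ** x ** y, x ** x ** y ** y ** x ** y ** x ** x ** y,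
       y ** y ** x ** x ** y ** x ** y ** y ** x, y ** y ** y ** x ** y ** y ** x ** y ** x,
       x ** x ** x ** y ** y ** y ** x ** x ** y ** y]"
  shows "length ts = 32 \<and> distinct ts \<and> minimal_generating_set (set ts) C42"
proof -
  have "ts = map word_trace gen_words"
    unfolding assms gen_words_def
    by (simp add: fun_eq_iff word_trace_def trace_apply matrix_mult_apply generic_apply matrix_mul_assoc)
  moreover have "length gen_words = 32" by code_simp
  ultimately show ?thesis
    using distinct_gen_words word_trace_inj_on_gen_words minimal_gen_words
    by (simp add: distinct_map)
qed

end
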